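(* Let $s,p\in\mathbb{R}$, $\alpha>1/2$ and $\alpha'\ge0$ satisfy $\min\{\alpha,\alpha'\}+s>0$ and $\min\{\alpha,\alpha'\}+(p-1/2)>0$. Suppose that $|l_j^\dagger|=\Theta(j^{-1/2-s}S(j))$ as $j\to\infty$ for some function $S:\mathbb{R}_{\ge0}\to\mathbb{R}_{\ge0}$ that is slowly varying at infinity; that the prior variances satisfy $\sigma_j^2=\Theta(j^{-2p})$ as $j\to\infty$; that the training and test covariances satisfy $\vartheta_j^2=\langle\varphi_j,\Lambda\varphi_j\rangle=\Theta(j^{-2\alpha})$ and $\vartheta_j'^2=\langle\varphi_j,\Lambda'\varphi_j\rangle=\Theta(j^{-2\alpha'})$ as $j\to\infty$; and that the training distribution $\nu$ satisfies the moment assumption (M) in the context. Let $J_N=\lfloor N^{1/(2(\alpha+p))}\rfloor$ and $$\rho_N=\begin{cases}N^{-\left(1-\frac{\alpha+1/2-\alpha'}{\alpha+p}\right)},&\alpha'<\alpha+1/2,\\ N^{-1}\log N,&\alpha'=\alpha+1/2,\\ N^{-1},&\alpha'>\alpha+1/2.\end{cases}$$ Then $$\mathbb{E}^{D_N}\mathbb{E}^{L^{(N)}\sim\mu^{D_N}}\bigl\|L^\dagger-L^{(N)}\bigr\|^2_{L^2_{\nu'}(H;H)}=\Theta\Bigl(\rho_N+N^{-\frac{\alpha'+s}{\alpha+p}}S^2(J_N)\Bigr)\quad\text{as }N\to\infty.$$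
   Context: $H$ is a real, separable, infinite-dimensional Hilbert space with inner product $\langle\cdot,\cdot\rangle$ and norm $\|\cdot\|$; $\{\varphi_j\}_{j\in\mathbb{N}}$ is a fixed known orthonormal basis of $H$. For nonnegative sequences, $a_n=O(b_n)$ means $\limsup a_n/b_n<\infty$, $a_n=\Omega(b_n)$ means $b_n=O(a_n)$, $a_n=\Theta(b_n)$ means both. A (measurable) function $S:\mathbb{R}_{\ge0}\to\mathbb{R}_{\ge0}$ is slowly varying at infinity if $S(\lambda x)/S(x)\to1$ as $x\to\infty$ for every $\lambda>0$. Truth: $L^\dagger=\sum_jl_j^\dagger\varphi_j\otimes\varphi_j$ is a fixed, possibly unbounded, self-adjoint operator on $H$ with real eigenvalues $l_j^\dagger$ and domain $\{h\in H:\sum_j|l_j^\dagger|^2\langle\varphi_j,h\rangle^2<\infty\}$. Data: $\gamma>0$ is fixed; $\nu$ is a centered Borel probability measure on $H$ with finite second moment and strictly positive-definite trace-class covariance operator $\Lambda$; $x_1,\dots,x_N$ are i.i.d. from $\nu$; $g_{jn}=\langle\varphi_j,x_n\rangle$; $y_{jn}=g_{jn}l_j^\dagger+\gamma\xi_{jn}$ for $j\in\mathbb{N}$, $1\le n\le N$, with $\xi_{jn}$ i.i.d. $\mathcal{N}(0,1)$ independent of $X=(x_1,\dots,x_N)$. $Y=\{y_{jn}\}$, $D_N=(X,Y)$, and $\mathbb{E}^{D_N}$ is expectation over the joint law of $D_N$. Prior and posterior: the prior on the eigenvalues is $\bigotimes_j\mathcal{N}(0,\sigma_j^2)$ with $\sigma_j^2>0$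 for all $j$. The posterior on the eigenvalues is $\bigotimes_j\mathcal{N}(\bar l_j^{(N)},(\sigma_j^{(N)})^2)$ with $$\bar l_j^{(N)}=\frac{N\gamma^{-2}\sigma_j^2\,\frac1N\sum_{n}y_{jn}g_{jn}}{1+N\gamma^{-2}\sigma_j^2\,\frac1N\sum_ng_{jn}^2},\qquad(\sigma_j^{(N)})^2=\frac{\sigma_j^2}{1+N\gamma^{-2}\sigma_j^2\,\frac1N\sum_ng_{jn}^2}.$$ $\mu^{D_N}$ is the law of $L^{(N)}=\sum_jl_j^{(N)}\varphi_j\otimes\varphi_j$ with $\{l_j^{(N)}\}$ drawn from this posterior. Test distribution: $\nu'$ is a centered Borel probability measure with bounded covariance operator $\Lambda'\in\mathcal{L}(H)$ (possibly not trace-class). For $T=\sum_jt_j\varphi_j\otimes\varphi_j$, $\|T\|^2_{L^2_{\nu'}(H;H)}=\mathbb{E}^{x\sim\nu'}\|Tx\|^2=\sum_j\vartheta_j'^2t_j^2$, where $\vartheta_j'^2=\langle\varphi_j,\Lambda'\varphi_j\rangle$. Assumption (M): $x\sim\nu$ has Karhunen–Loève expansion $x=\sum_k\lambda_k\zeta_k\phi_k$, where $\{\phi_k\}$ is an orthonormal eigenbasis of $\Lambda$ with nonincreasing eigenvalues $\lambda_k^2$, and the zero mean, unit variance random variables $\{\zeta_k\}$ are independent, have finite fourth moments, and satisfy $\mathbb{E}[\zeta_k^4]=O(1)$ as $k\to\infty$. Moreover, there is a constant $C$ such that $\limsup_{N\to\infty}\mathbb{E}\bigl[(\frac1N\sum_{n=1}^Ng_{jn}^2)^{-4}\bigr]\le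 C\langle\varphi_j,\Lambda\varphi_j\rangle^{-4}$ for all $j\in\mathbb{N}$. *)

theory Defs
  imports "HOL-Probability.Probability" "HOL-Library.Landau_Symbols"
begin

text \<open>
  The mathematical index set of the basis is \<open>{1, 2, \<dots>}\<close>.  Sequences indexed by it are functions on
  \<open>nat\<close> whose value at \<open>j\<close> is the entry with number \<open>j + 1\<close>; this only shows up in asymptotic
  conditions, where the entry number is \<open>real (Suc j)\<close>.  Samples are numbered \<open>1, \<dots>, N\<close>.
\<close>

definition orthonormal_basis :: "(nat \<Rightarrow> 'h::real_inner) \<Rightarrow> bool" where
  "orthonormal_basis e \<longleftrightarrow>
     (\<forall>i j. inner (e i) (e j) = (if i = j then 1 else 0)) \<and> closure (span (range e)) = UNIV"

text \<open>The functions \<open>\<real>\<^sub>\<ge>\<^sub>0 \<rightarrow> \<real>\<^sub>\<ge>\<^sub>0\<close> are those on \<open>real\<close>, disregarding their values on negative arguments.\<close>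

definition slowly_varying :: "(real \<Rightarrow> real) \<Rightarrow> bool" where
  "slowly_varying S \<longleftrightarrow>
     S \<in> borel_measurable (restrict_space borel {0..}) \<and> (\<forall>x\<ge>0. S x \<ge> 0) \<and>
     (\<forall>c>0. ((\<lambda>x. S (c * x) / S x) \<longlongrightarrow> 1) at_top)"

subsection \<open>Measures on the Hilbert space\<close>

definition borel_prob :: "'h::topological_space measure \<Rightarrow> bool" where
  "borel_prob \<nu> \<longleftrightarrow> prob_space \<nu> \<and> sets \<nu> = sets borel"

text \<open>
  The mean is taken weakly, since a measure whose covariance is merely bounded need not have
  a Bochner-integrable norm.
\<close>

definition centered :: "'h::real_inner measure \<Rightarrow> bool" where
  "centered \<nu> \<longleftrightarrow> (\<forall>h. integrable \<nu> (\<lambda>x. inner h x) \<and> (\<integral>x. inner h x \<partial>\<nu>) = 0)"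

text \<open>Covariance of a centered measure; no centering term is subtracted.\<close>

definition has_covariance :: "'h::real_inner measure \<Rightarrow> ('h \<Rightarrow> 'h) \<Rightarrow> bool" where
  "has_covariance \<nu> \<Lambda> \<longleftrightarrow> bounded_linear \<Lambda> \<and>
     (\<forall>h k. integrable \<nu> (\<lambda>x. inner h x * inner k x) \<and>
            inner h (\<Lambda> k) = (\<integral>x. inner h x * inner k x \<partial>\<nu>))"

definition strictly_positive :: "('h::real_inner \<Rightarrow> 'h) \<Rightarrow> bool" where
  "strictly_positive \<Lambda> \<longleftrightarrow> (\<forall>h. h \<noteq> 0 \<longrightarrow> 0 < inner h (\<Lambda> h))"

text \<open>
  For a positive self-adjoint operator, finiteness of the trace in one orthonormal basis \<open>e\<close> is the
  trace-class property.
\<close>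

definition positive_trace_class :: "(nat \<Rightarrow> 'h::real_inner) \<Rightarrow> ('h \<Rightarrow> 'h) \<Rightarrow> bool" where
  "positive_trace_class e \<Lambda> \<longleftrightarrow> (\<forall>h. 0 \<le> inner h (\<Lambda> h)) \<and> summable (\<lambda>j. inner (e j) (\<Lambda> (e j)))"

subsection \<open>Diagonal operators\<close>

definition diag_dom :: "(nat \<Rightarrow> 'h::real_inner) \<Rightarrow> (nat \<Rightarrow> real) \<Rightarrow> 'h set" where
  "diag_dom \<phi> t = {h. summable (\<lambda>j. (t j)\<^sup>2 * (inner (\<phi> j) h)\<^sup>2)}"

definition diag_op :: "(nat \<Rightarrow> 'h::real_inner) \<Rightarrow> (nat \<Rightarrow> real) \<Rightarrow> 'h \<Rightarrow> 'h" where
  "diag_op \<phi> t h = (\<Sum>j. (t j * inner (\<phi> j) h) *\<^sub>R \<phi> j)"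

text \<open>
  The square of the \<open>L\<^sup>2\<close> norm over \<open>\<nu>'\<close> of the diagonal operator with eigenvalues \<open>t\<close>.  The operator may be
  unbounded; outside its domain the squared norm of the image counts as \<open>\<infinity>\<close>.
\<close>

definition L2_norm_sq :: "'h::real_inner measure \<Rightarrow> (nat \<Rightarrow> 'h) \<Rightarrow> (nat \<Rightarrow> real) \<Rightarrow> ennreal" where
  "L2_norm_sq \<nu>' \<phi> t =
     (\<integral>\<^sup>+x. (if x \<in> diag_dom \<phi> t then ennreal ((norm (diag_op \<phi> t x))\<^sup>2) else \<infinity>) \<partial>\<nu>')"

subsection \<open>Data and posterior\<close>

abbreviation gaussian :: "real \<Rightarrow> real \<Rightarrow> real measure" where
  "gaussian m sd \<equiv> density lborel (\<lambda>x. ennreal (normal_density m sd x))"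

text \<open>
  The joint law of \<open>(X, Y)\<close>, where \<open>X n\<close> is the \<open>n\<close>-th input and \<open>Y (j, n)\<close> is the \<open>j\<close>-th coefficient
  of the \<open>n\<close>-th noisy output: the image of the law of inputs and noise.
\<close>

definition data_law ::
  "'h::real_inner measure \<Rightarrow> (nat \<Rightarrow> 'h) \<Rightarrow> (nat \<Rightarrow> real) \<Rightarrow> real \<Rightarrow> nat \<Rightarrow>
     ((nat \<Rightarrow> 'h) \<times> (nat \<times> nat \<Rightarrow> real)) measure" where
  "data_law \<nu> \<phi> l \<gamma> N =
     distr (PiM {1..N} (\<lambda>_. \<nu>) \<Otimes>\<^sub>M PiM (UNIV \<times> {1..N}) (\<lambda>_. gaussian 0 1))
           (PiM {1..N} (\<lambda>_. \<nu>) \<Otimes>\<^sub>M PiM (UNIV \<times> {1..N}) (\<lambda>_. borel))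
           (\<lambda>(X, \<xi>). (X, \<lambda>(j, n) \<in> UNIV \<times> {1..N}. inner (\<phi> j) (X n) * l j + \<gamma> * \<xi> (j, n)))"

definition post_mean ::
  "(nat \<Rightarrow> 'h::real_inner) \<Rightarrow> (nat \<Rightarrow> real) \<Rightarrow> real \<Rightarrow> nat \<Rightarrow>
     (nat \<Rightarrow> 'h) \<times> (nat \<times> nat \<Rightarrow> real) \<Rightarrow> nat \<Rightarrow> real" where
  "post_mean \<phi> \<sigma> \<gamma> N D j =
     (let X = fst D; Y = snd D in
      (real N * (1 / \<gamma>\<^sup>2) * (\<sigma> j)\<^sup>2 * (1 / real N * (\<Sum>n=1..N. Y (j, n) * inner (\<phi> j) (X n)))) /
      (1 + real N * (1 / \<gamma>\<^sup>2) * (\<sigma> j)\<^sup>2 * (1 / real N * (\<Sum>n=1..N. (inner (\<phi> j) (X n))\<^sup>2))))"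

definition post_var ::
  "(nat \<Rightarrow> 'h::real_inner) \<Rightarrow> (nat \<Rightarrow> real) \<Rightarrow> real \<Rightarrow> nat \<Rightarrow>
     (nat \<Rightarrow> 'h) \<times> (nat \<times> nat \<Rightarrow> real) \<Rightarrow> nat \<Rightarrow> real" where
  "post_var \<phi> \<sigma> \<gamma> N D j =
     (let X = fst D in
      (\<sigma> j)\<^sup>2 /
      (1 + real N * (1 / \<gamma>\<^sup>2) * (\<sigma> j)\<^sup>2 * (1 / real N * (\<Sum>n=1..N. (inner (\<phi> j) (X n))\<^sup>2))))"

text \<open>The posterior on operators, represented as the law of the eigenvalue sequence.\<close>

definition posterior ::
  "(nat \<Rightarrow> 'h::real_inner) \<Rightarrow> (nat \<Rightarrow> real) \<Rightarrow> real \<Rightarrow> nat \<Rightarrow>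
     (nat \<Rightarrow> 'h) \<times> (nat \<times> nat \<Rightarrow> real) \<Rightarrow> (nat \<Rightarrow> real) measure" where
  "posterior \<phi> \<sigma> \<gamma> N D =
     PiM UNIV (\<lambda>j. gaussian (post_mean \<phi> \<sigma> \<gamma> N D j) (sqrt (post_var \<phi> \<sigma> \<gamma> N D j)))"

text \<open>
  Extended-valued.  When \<open>enn2real\<close> of it is compared by \<open>\<Theta>\<close> with an eventually positive rate, the lower
  bound excludes the value \<open>\<infinity>\<close> (which \<open>enn2real\<close> sends to \<open>0\<close>) for all large \<open>N\<close>.
\<close>

definition expected_error ::
  "'h::real_inner measure \<Rightarrow> 'h measure \<Rightarrow> (nat \<Rightarrow> 'h) \<Rightarrow> (nat \<Rightarrow> real) \<Rightarrow> (nat \<Rightarrow> real) \<Rightarrow> real \<Rightarrow>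
     nat \<Rightarrow> ennreal" where
  "expected_error \<nu> \<nu>' \<phi> l \<sigma> \<gamma> N =
     (\<integral>\<^sup>+D. (\<integral>\<^sup>+t. L2_norm_sq \<nu>' \<phi> (\<lambda>j. l j - t j) \<partial>posterior \<phi> \<sigma> \<gamma> N D) \<partial>data_law \<nu> \<phi> l \<gamma> N)"

subsection \<open>The moment assumption on the training distribution\<close>

text \<open>
  The coefficients \<open>\<zeta> k\<close> are random variables on the space of \<open>\<nu>\<close> itself, with \<open>x\<close> the identity.
\<close>

definition KL_moment :: "'h::real_inner measure \<Rightarrow> ('h \<Rightarrow> 'h) \<Rightarrow> bool" where
  "KL_moment \<nu> \<Lambda> \<longleftrightarrow>
     (\<exists>\<psi> (lam :: nat \<Rightarrow> real) \<zeta>.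
        orthonormal_basis \<psi> \<and>
        (\<forall>k. \<Lambda> (\<psi> k) = (lam k)\<^sup>2 *\<^sub>R \<psi> k) \<and> decseq (\<lambda>k. (lam k)\<^sup>2) \<and>
        (AE x in \<nu>. (\<lambda>k. (lam k * \<zeta> k x) *\<^sub>R \<psi> k) sums x) \<and>
        prob_space.indep_vars \<nu> (\<lambda>_. borel) \<zeta> UNIV \<and>
        (\<forall>k. integrable \<nu> (\<zeta> k) \<and> (\<integral>x. \<zeta> k x \<partial>\<nu>) = 0) \<and>
        (\<forall>k. integrable \<nu> (\<lambda>x. (\<zeta> k x)\<^sup>2) \<and> (\<integral>x. (\<zeta> k x)\<^sup>2 \<partial>\<nu>) = 1) \<and>
        (\<forall>k. integrable \<nu> (\<lambda>x. (\<zeta> k x) ^ 4)) \<and>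
        (\<lambda>k. \<integral>x. (\<zeta> k x) ^ 4 \<partial>\<nu>) \<in> O(\<lambda>_. 1))"

text \<open>The inverse is the one of \<open>ennreal\<close>, so that a vanishing empirical second moment contributes \<open>\<infinity>\<close>.\<close>

definition inverse_moment :: "'h::real_inner measure \<Rightarrow> ('h \<Rightarrow> 'h) \<Rightarrow> (nat \<Rightarrow> 'h) \<Rightarrow> bool" where
  "inverse_moment \<nu> \<Lambda> \<phi> \<longleftrightarrow>
     (\<exists>C::real. \<forall>j.
        limsup (\<lambda>N. \<integral>\<^sup>+X. (inverse (ennreal (1 / real N * (\<Sum>n=1..N. (inner (\<phi> j) (X n))\<^sup>2)))) ^ 4
                      \<partial>PiM {1..N} (\<lambda>_. \<nu>))
        \<le> ennreal (C * (1 / inner (\<phi> j) (\<Lambda> (\<phi> j))) ^ 4))"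

subsection \<open>The rate\<close>

definition J :: "real \<Rightarrow> real \<Rightarrow> nat \<Rightarrow> int" where
  "J \<alpha> p N = \<lfloor>real N powr (1 / (2 * (\<alpha> + p)))\<rfloor>"

definition rho :: "real \<Rightarrow> real \<Rightarrow> real \<Rightarrow> nat \<Rightarrow> real" where
  "rho \<alpha> \<alpha>' p N =
     (if \<alpha>' < \<alpha> + 1/2 then real N powr (- (1 - (\<alpha> + 1/2 - \<alpha>') / (\<alpha> + p)))
      else if \<alpha>' = \<alpha> + 1/2 then real N powr (-1) * ln (real N)
      else real N powr (-1))"

end

theory Submission imports Defs begin

text \<open>
  The problem is diagonal in the basis \<open>\<phi>\<close>, so the expected error is a sum over the eigenvalues.  Let
  \<open>\<theta>\<^sub>j\<close> and \<open>\<theta>'\<^sub>j\<close> be the variances of the \<open>j\<close>-th coordinate of a training and of a test input, let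
  \<open>G\<^sub>j\<close> be the empirical second moment of that coordinate over the \<open>N\<close> inputs, and put
  \<open>a\<^sub>j = N \<sigma>\<^sub>j\<^sup>2 / \<gamma>\<^sup>2\<close>.  The posterior shrinks the prior variance of the \<open>j\<close>-th eigenvalue, and the bias
  of its mean, by the same factor \<open>r\<^sub>j = 1 / (1 + a\<^sub>j G\<^sub>j)\<close>.  Integrating over the test input, the
  posterior and the noise, in this order, gives the exact formula of \<open>expected_error_eq\<close>:
  the error is the sum over \<open>j\<close> of \<open>\<theta>'\<^sub>j (l\<^sub>j\<^sup>2 E[r\<^sub>j\<^sup>2] + \<sigma>\<^sub>j\<^sup>2 (2 E[r\<^sub>j] - E[r\<^sub>j\<^sup>2]))\<close>.

  The randomness that is left is that of \<open>G\<^sub>j\<close>, an average of \<open>N\<close> independent nonnegative variables with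
  mean \<open>\<theta>\<^sub>j\<close>.  Convexity of \<open>1 / (1 + a x)\<^sup>k\<close> bounds \<open>E[r\<^sub>j\<^sup>k]\<close> from below by its value at the mean.
  For the upper bound, the Karhunen--Loeve expansion with independent coefficients bounds the fourth
  moment of every coordinate by \<open>K \<theta>\<^sub>j\<^sup>2\<close> with one constant \<open>K\<close> (\<open>fourth_moment_bound\<close>).  An average of
  nonnegative variables with such a second moment falls below half its mean with probability
  at most \<open>exp (- N / (8 K))\<close>, and as \<open>a\<^sub>j \<theta>\<^sub>j = O(N)\<close> uniformly in \<open>j\<close>, this is negligible against
  \<open>1 / (1 + a\<^sub>j \<theta>\<^sub>j)\<^sup>2\<close>.  So \<open>G\<^sub>j\<close> may be replaced by \<open>\<theta>\<^sub>j\<close> up to constants that depend neither on \<open>j\<close> nor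
  on \<open>N\<close> (\<open>shrinkage_moment_bounds\<close>).

  What remains is deterministic (\<open>expected_error_bounds\<close>): with \<open>q = \<alpha> + p\<close> and \<open>b\<^sub>j = a\<^sub>j \<theta>\<^sub>j / N\<close>, which
  is of order \<open>j powr (-2 q)\<close>, the error is comparable to the bias \<open>\<Sum>j. A\<^sub>j / (1 + N b\<^sub>j)\<^sup>2\<close> plus the spread
  \<open>\<Sum>j. B\<^sub>j / (1 + N b\<^sub>j)\<close>, where \<open>A\<^sub>j = \<theta>'\<^sub>j l\<^sub>j\<^sup>2\<close> and \<open>B\<^sub>j = \<theta>'\<^sub>j \<sigma>\<^sub>j\<^sup>2\<close>.  The filter \<open>1 / (1 + N b\<^sub>j)\<close> is of
  order \<open>j powr (2 q) / N\<close> below the cutoff \<open>J\<^sub>N\<close> and of order \<open>1\<close> above it.  The spread therefore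
  has order \<open>\<rho>\<^sub>N\<close>, and its three cases are those of a sum of powers up to \<open>J\<^sub>N\<close> that diverges, diverges
  logarithmically or converges.  For the bias, put \<open>\<beta> = 2 (\<alpha>' + s)\<close>.  A window just above \<open>J\<^sub>N\<close> contributes
  a multiple of \<open>J\<^sub>N powr (-\<beta>) * (S J\<^sub>N)\<^sup>2\<close>, which gives the lower bound.  If \<open>\<beta> \<le> 2 q\<close>, the summands decay
  polynomially on both sides of \<open>J\<^sub>N\<close>, slowly varying functions being smaller than any power
  (\<open>potter_bounds\<close>), so the whole sum is of that order; the finitely many entries to which asymptotic
  hypotheses do not apply add \<open>O(1 / N)\<close>.  If \<open>\<beta> > 2 q\<close>, the whole bias is \<open>O(1 / N)\<close>.  Both are
  absorbed because \<open>1 / N\<close> never exceeds \<open>\<rho>\<^sub>N\<close> for \<open>N \<ge> 3\<close>.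
\<close>

section \<open>Slowly varying functions\<close>

text \<open>
  The uniform convergence theorem for slowly varying functions, in additive form.  Measurability enters
  through the Lebesgue measure of the set of bad shifts in \<open>[0, 3]\<close>, which tends to \<open>0\<close> by dominated
  convergence.  If the shifts that are bad at \<open>x\<close> or, after translation by \<open>u\<close>, bad at \<open>x + u\<close> do not cover
  \<open>[1, 3]\<close>, then an uncovered \<open>v\<close> compares \<open>h (x + u)\<close> with \<open>h x\<close> through \<open>h (x + v)\<close>.
\<close>

lemma shifts_converge_uniformly:
  fixes h :: "real \<Rightarrow> real"
  assumes [measurable]: "h \<in> borel_measurable borel"
    and lim: "\<And>u. ((\<lambda>x. h (x + u) - h x) \<longlongrightarrow> 0) at_top" and "e > 0"
  shows "\<exists>X. \<forall>x\<ge>X. \<forall>u\<in>{0..1}. \<bar>h (x + u) - h x\<bar> < e"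
proof -
  define bad where "bad x v = (indicator {v\<in>{0..3}. e/2 \<le> \<bar>h (x + v) - h x\<bar>} v :: real)" for x v
  define d where "d x = (\<integral>v. bad x v \<partial>lborel)" for x
  have bad_meas [measurable]: "bad x \<in> borel_measurable borel" for x
    unfolding bad_def by measurable
  have bad_le: "bad x v \<le> indicator {0..3} v" "0 \<le> bad x v" for x v
    by (auto simp: bad_def indicator_def)
  have int_bad: "integrable lborel (bad x)" for x
    by (rule Bochner_Integration.integrable_bound[where f = "indicator {0..3}"])
       (use bad_le in \<open>auto simp: bad_def indicator_def\<close>)
  have "(d \<longlongrightarrow> (\<integral>v. 0 \<partial>(lborel :: real measure))) at_top"
    unfolding d_def
  proof (rule integral_dominated_convergence_at_top[where w = "indicator {0..3}"])
    show "AE v in lborel. ((\<lambda>x. bad x v) \<longlongrightarrow> 0) at_top"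
    proof (rule AE_I2)
      fix v
      have "\<forall>\<^sub>F x in at_top. \<bar>h (x + v) - h x\<bar> < e/2"
        using order_tendstoD(2)[OF tendsto_rabs[OF lim[of v]], of "e/2"] \<open>e > 0\<close> by simp
      then have "\<forall>\<^sub>F x in at_top. bad x v = 0"
        by eventually_elim (auto simp: bad_def indicator_def)
      then show "((\<lambda>x. bad x v) \<longlongrightarrow> 0) at_top"
        by (rule tendsto_eventually)
    qed
  qed (use bad_le in \<open>auto intro!: always_eventually\<close>)
  then have "\<forall>\<^sub>F x in at_top. d x < 1/2"
    by (intro order_tendstoD(2)) auto
  then obtain X where X: "\<And>x. x \<ge> X \<Longrightarrow> d x < 1/2"
    by (auto simp: eventually_at_top_linorder)
  have "\<bar>h (x + u) - h x\<bar> < e" if x: "x \<ge> X" and u: "u \<in> {0..1}" for x u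
  proof -
    have "\<exists>v\<in>{1..3}. bad x v = 0 \<and> bad (x + u) (v - u) = 0"
    proof (rule ccontr)
      assume no: "\<not> ?thesis"
      have sh: "integrable lborel (\<lambda>v. bad (x + u) (v - u))" "(\<integral>v. bad (x + u) (v - u) \<partial>lborel) = d (x + u)"
        using lborel_integrable_real_affine[OF int_bad[of "x + u"], of 1 "-u"]
          lborel_integral_real_affine[of 1 "bad (x + u)" "-u"]
        by (simp_all add: d_def)
      have "(\<integral>v. indicator {1..3::real} v \<partial>lborel) \<le> (\<integral>v. bad x v + bad (x + u) (v - u) \<partial>lborel)"
      proof (rule integral_mono)
        fix v :: real
        show "indicator {1..3} v \<le> bad x v + bad (x + u) (v - u)"
          using no u by (auto simp: bad_def indicator_def split: if_splits)
      qed (use sh int_bad in auto)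
      also have "\<dots> = d x + d (x + u)"
        using sh int_bad by (simp add: d_def)
      also have "\<dots> < 1/2 + 1/2"
        using X x u by (intro add_strict_mono) auto
      finally show False by simp
    qed
    then obtain v where v: "v \<in> {1..3}" "bad x v = 0" "bad (x + u) (v - u) = 0" by blast
    have "\<bar>h (x + v) - h x\<bar> < e/2" "\<bar>h (x + u + (v - u)) - h (x + u)\<bar> < e/2"
      using v u by (auto simp: bad_def indicator_def split: if_splits)
    then show ?thesis by (simp add: abs_less_iff) argo
  qed
  then show ?thesis by blast
qed

text \<open>
  Since division by \<open>0\<close> yields \<open>0\<close>, the limit of \<open>S (1 * x) / S x\<close> rules out zeros of \<open>S\<close> near infinity.
\<close>

lemma slowly_varying_pos:
  assumes "slowly_varying S"
  shows "\<forall>\<^sub>F x in at_top. S x > 0"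
proof -
  have nn: "\<And>x. x \<ge> 0 \<Longrightarrow> S x \<ge> 0"
    and "\<forall>c>0. ((\<lambda>x. S (c * x) / S x) \<longlongrightarrow> 1) at_top"
    using assms by (simp_all add: slowly_varying_def)
  from this(2)[rule_format, of 1] have "((\<lambda>x. S (1 * x) / S x) \<longlongrightarrow> 1) at_top"
    by simp
  from order_tendstoD(1)[OF this, of 0] have "\<forall>\<^sub>F x in at_top. S (1 * x) / S x > 0"
    by simp
  then show ?thesis
    using eventually_ge_at_top[of 0]
    by eventually_elim (use nn in \<open>force simp: less_le\<close>)
qed

text \<open>
  With \<open>h = ln \<circ> S \<circ> exp\<close>, uniform convergence bounds the change of \<open>h\<close> over a step of length at most \<open>1\<close>
  by \<open>e\<close>, hence over an arbitrary distance \<open>v\<close> by \<open>e * (v + 1)\<close>.  The additional \<open>1\<close>, from the last incomplete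
  step, is the factor \<open>exp e\<close>.
\<close>

lemma potter_bounds:
  assumes S: "slowly_varying S" and "e > 0"
  obtains X where "X \<ge> 1" "\<And>x. x \<ge> X \<Longrightarrow> S x > 0"
    "\<And>x y. X \<le> x \<Longrightarrow> x \<le> y \<Longrightarrow> S y \<le> exp e * (y / x) powr e * S x"
    "\<And>x y. X \<le> x \<Longrightarrow> x \<le> y \<Longrightarrow> S x \<le> exp e * (y / x) powr e * S y"
proof -
  define h where "h x = ln (S (exp x))" for x
  have "exp \<in> borel \<rightarrow>\<^sub>M restrict_space borel {0::real..}"
    by (rule measurable_restrict_space2) auto
  moreover have "S \<in> restrict_space borel {0..} \<rightarrow>\<^sub>M borel"
    using S by (simp add: slowly_varying_def)
  ultimately have "(\<lambda>x. S (exp x)) \<in> borel_measurable borel"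
    by (rule measurable_compose)
  then have [measurable]: "h \<in> borel_measurable borel"
    unfolding h_def by measurable
  have lim: "((\<lambda>x. h (x + u) - h x) \<longlongrightarrow> 0) at_top" for u
  proof -
    have "((\<lambda>x. S (exp u * x) / S x) \<longlongrightarrow> 1) at_top"
      using S by (auto simp: slowly_varying_def)
    from filterlim_compose[OF this exp_at_top]
    have "((\<lambda>x. ln (S (exp u * exp x) / S (exp x))) \<longlongrightarrow> ln 1) at_top"
      by (rule tendsto_ln) auto
    moreover have "\<forall>\<^sub>F x in at_top. ln (S (exp u * exp x) / S (exp x)) = h (x + u) - h x"
    proof -
      have 1: "\<forall>\<^sub>F x in at_top. S (exp x) > 0"
        by (rule eventually_compose_filterlim[OF slowly_varying_pos[OF S] exp_at_top])
      have "filterlim (\<lambda>x. exp (u + x)) at_top (at_top :: real filter)"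
        by (rule filterlim_compose[OF exp_at_top filterlim_tendsto_add_at_top[OF tendsto_const filterlim_ident]])
      then have 2: "\<forall>\<^sub>F x in at_top. S (exp (u + x)) > 0"
        by (rule eventually_compose_filterlim[OF slowly_varying_pos[OF S]])
      show ?thesis using 1 2
        by eventually_elim (simp add: h_def ln_div exp_add add.commute mult.commute)
    qed
    ultimately have "((\<lambda>x. h (x + u) - h x) \<longlongrightarrow> ln 1) at_top"
      by (rule Lim_transform_eventually)
    then show ?thesis by simp
  qed
  obtain X0 where X0: "\<And>x u. x \<ge> X0 \<Longrightarrow> u \<in> {0..1} \<Longrightarrow> \<bar>h (x + u) - h x\<bar> < e"
    using shifts_converge_uniformly[OF _ lim \<open>e > 0\<close>] \<open>h \<in> borel_measurable borel\<close> by blast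
  have step: "\<bar>h (x + real k + u) - h x\<bar> \<le> e * (real k + 1)" if "x \<ge> X0" "u \<in> {0..1}" for x u k
  proof (induction k)
    case 0
    then show ?case using X0[OF that] by simp
  next
    case (Suc k)
    have "\<bar>h ((x + real k + u) + 1) - h (x + real k + u)\<bar> < e"
      using that by (intro X0) auto
    moreover have "(x + real k + u) + 1 = x + real (Suc k) + u" by simp
    ultimately show ?case using Suc by (simp add: algebra_simps)
  qed
  have pot: "\<bar>h (x + v) - h x\<bar> \<le> e * (v + 1)" if "x \<ge> X0" "v \<ge> 0" for x v
  proof -
    have "\<bar>h (x + real (nat \<lfloor>v\<rfloor>) + frac v) - h x\<bar> \<le> e * (real (nat \<lfloor>v\<rfloor>) + 1)"
      using that by (intro step) (auto simp: frac_lt_1 less_imp_le)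
    also have "x + real (nat \<lfloor>v\<rfloor>) + frac v = x + v"
      using that by (simp add: frac_def)
    also have "e * (real (nat \<lfloor>v\<rfloor>) + 1) \<le> e * (v + 1)"
      using that \<open>e > 0\<close> by simp
    finally show ?thesis .
  qed
  obtain X1 where X1: "\<And>x. x \<ge> X1 \<Longrightarrow> S x > 0"
    using slowly_varying_pos[OF S] by (auto simp: eventually_at_top_linorder)
  define X where "X = max 1 (max (exp X0) X1)"
  have X: "X \<ge> 1" "X \<ge> exp X0" "X \<ge> X1" by (auto simp: X_def)
  have main: "S y \<le> exp e * (y / x) powr e * S x \<and> S x \<le> exp e * (y / x) powr e * S y"
    if "X \<le> x" "x \<le> y" for x y
  proof -
    have pos: "x > 0" "y > 0" "S x > 0" "S y > 0" using that X X1 by (auto intro: X1)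
    have "\<bar>h (ln x + ln (y / x)) - h (ln x)\<bar> \<le> e * (ln (y / x) + 1)"
      using that pos X by (intro pot) (auto simp: ln_ge_iff ln_div)
    moreover have "ln x + ln (y / x) = ln y" using pos by (simp add: ln_div)
    ultimately have "\<bar>ln (S y) - ln (S x)\<bar> \<le> e * (ln (y / x) + 1)"
      using pos by (simp add: h_def)
    moreover have "exp e * (y / x) powr e = exp (e * (ln (y / x) + 1))"
      using pos by (simp add: powr_def exp_add[symmetric] algebra_simps)
    moreover have "S y \<le> exp E * S x \<and> S x \<le> exp E * S y" if "\<bar>ln (S y) - ln (S x)\<bar> \<le> E" for E
    proof -
      have "ln (S y) \<le> E + ln (S x)" "ln (S x) \<le> E + ln (S y)" using that by auto
      then have "exp (ln (S y)) \<le> exp (E + ln (S x))" "exp (ln (S x)) \<le> exp (E + ln (S y))"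
        by simp_all
      then show ?thesis using pos by (simp add: exp_add)
    qed
    ultimately show ?thesis by metis
  qed
  show ?thesis
    by (rule that[OF X(1)]) (use main X X1 in auto)
qed

text \<open>
  The square of a slowly varying sequence costs an arbitrarily small power, by comparison with a fixed argument.
\<close>

lemma slowly_varying_sq_bigo:
  assumes "slowly_varying S" "e > 0"
  shows "(\<lambda>j. (S (real (Suc j)))\<^sup>2) \<in> O(\<lambda>j. real (Suc j) powr e)"
proof -
  from assms(2) have "e / 2 > 0" by simp
  with assms(1) obtain X where X: "X \<ge> 1" "\<And>x. x \<ge> X \<Longrightarrow> S x > 0"
      "\<And>x y. X \<le> x \<Longrightarrow> x \<le> y \<Longrightarrow> S y \<le> exp (e / 2) * (y / x) powr (e / 2) * S x"
    by (rule potter_bounds) blast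
  have "\<forall>\<^sub>F j in at_top. norm ((S (real (Suc j)))\<^sup>2) \<le> (exp (e / 2) * S X)\<^sup>2 * norm (real (Suc j) powr e)"
    using eventually_ge_at_top[of "nat \<lceil>X\<rceil>"]
  proof eventually_elim
    case (elim j)
    then have jX: "X \<le> real (Suc j)" by linarith
    have "S (real (Suc j)) \<le> exp (e / 2) * (real (Suc j) / X) powr (e / 2) * S X"
      using X(3)[OF order_refl jX] .
    also have "\<dots> \<le> exp (e / 2) * (real (Suc j)) powr (e / 2) * S X"
    proof (intro mult_right_mono mult_left_mono powr_mono2)
      show "real (Suc j) / X \<le> real (Suc j)"
        using divide_left_mono[of 1 X "real (Suc j)"] X(1) by simp
    qed (use X(1,2) assms(2) in \<open>auto intro: less_imp_le\<close>)
    finally have "(S (real (Suc j)))\<^sup>2 \<le> (exp (e / 2) * real (Suc j) powr (e / 2) * S X)\<^sup>2"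
      using X(2)[OF jX] by (intro power_mono) auto
    also have "\<dots> = (exp (e / 2) * S X)\<^sup>2 * (real (Suc j) powr (e / 2))\<^sup>2"
      by (simp add: power_mult_distrib)
    also have "(real (Suc j) powr (e / 2))\<^sup>2 = real (Suc j) powr e"
      by (simp add: power2_eq_square powr_add[symmetric])
    finally show ?case by simp
  qed
  then show ?thesis by (rule bigoI)
qed

lemma regularly_varying_bigo:
  assumes "slowly_varying S" "e > 0" "A \<in> O(\<lambda>j. real (Suc j) powr a * (S (real (Suc j)))\<^sup>2)"
  shows "A \<in> O(\<lambda>j. real (Suc j) powr (a + e))"
proof -
  have "(\<lambda>j. real (Suc j) powr a * (S (real (Suc j)))\<^sup>2) \<in> O(\<lambda>j. real (Suc j) powr a * real (Suc j) powr e)"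
    by (intro landau_o.big.mult slowly_varying_sq_bigo assms) simp
  from landau_o.big_trans[OF assms(3) this] show ?thesis
    by (simp add: powr_add)
qed

section \<open>Sums of powers and the cutoff index\<close>

text \<open>
  Against a strictly positive comparison sequence an asymptotic bound holds at every index, because
  finitely many exceptions only enlarge the constant.
\<close>

lemma bigo_bound_everywhere:
  fixes f g :: "nat \<Rightarrow> real"
  assumes "f \<in> O(g)" and g: "\<And>j. g j > 0"
  obtains C where "C > 0" "\<And>j. \<bar>f j\<bar> \<le> C * g j"
proof -
  from assms(1) obtain c where "c > 0" "\<forall>\<^sub>F j in at_top. \<bar>f j\<bar> \<le> c * \<bar>g j\<bar>"
    by (auto simp: bigo_def)
  then obtain n where n: "\<And>j. j \<ge> n \<Longrightarrow> \<bar>f j\<bar> \<le> c * \<bar>g j\<bar>"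
    by (auto simp: eventually_at_top_linorder)
  define C where "C = c + (\<Sum>j<n. \<bar>f j\<bar> / g j)"
  have "\<bar>f j\<bar> \<le> C * g j" for j
  proof (cases "j < n")
    case True
    have "\<bar>f j\<bar> / g j \<le> (\<Sum>j<n. \<bar>f j\<bar> / g j)"
      using True g by (intro member_le_sum divide_nonneg_pos) auto
    then have "\<bar>f j\<bar> / g j \<le> C" using \<open>c > 0\<close> by (simp add: C_def)
    then show ?thesis using g[of j] by (simp add: field_simps)
  next
    case False
    have "c \<le> C" unfolding C_def using g by (simp add: sum_nonneg divide_nonneg_pos)
    then have "c * g j \<le> C * g j" using g[of j] by (simp add: mult_right_mono)
    moreover have "\<bar>f j\<bar> \<le> c * g j" using False n[of j] g[of j] by simp
    ultimately show ?thesis by linarith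
  qed
  moreover have "C > 0" unfolding C_def using \<open>c > 0\<close> g by (intro add_pos_nonneg sum_nonneg divide_nonneg_pos) auto
  ultimately show ?thesis using that by blast
qed

lemma bigtheta_bounds_everywhere:
  fixes f g :: "nat \<Rightarrow> real"
  assumes "f \<in> \<Theta>(g)" and "\<And>j. f j > 0" and "\<And>j. g j > 0"
  obtains c C where "c > 0" "C > 0" "\<And>j. c * g j \<le> f j" "\<And>j. f j \<le> C * g j"
proof -
  obtain C where C: "C > 0" "\<And>j. \<bar>f j\<bar> \<le> C * g j"
    using bigo_bound_everywhere[of f g] assms by (auto simp: bigtheta_def)
  have "g \<in> O(f)" using assms(1) by (simp add: bigtheta_def bigomega_iff_bigo)
  then obtain D where D: "D > 0" "\<And>j. \<bar>g j\<bar> \<le> D * f j"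
    using bigo_bound_everywhere[of g f] assms(2) by blast
  have "(1/D) * g j \<le> f j" for j
    using D(1) D(2)[of j] assms(3)[of j] by (simp add: field_simps)
  moreover have "f j \<le> C * g j" for j using C(2)[of j] by linarith
  ultimately show ?thesis using that[of "1/D" C] C(1) D(1) by simp
qed

text \<open>
  Within a factor of \<open>2\<close>, powers with exponents of either sign are comparable; this is how integer
  cutoffs, mean-value points and windows \<open>{m..<2*m}\<close> are exchanged for each other.
\<close>

lemma powr_within_factor_2:
  fixes x y a :: real
  assumes "0 < x" "x \<le> y" "y \<le> 2 * x"
  shows "y powr a \<le> 2 powr \<bar>a\<bar> * x powr a" "x powr a \<le> 2 powr \<bar>a\<bar> * y powr a"
proof -
  have r: "1 \<le> y / x" "y / x \<le> 2" using assms by (auto simp: field_simps)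
  have "(y/x) powr b \<le> 2 powr \<bar>a\<bar>" if "\<bar>b\<bar> = \<bar>a\<bar>" for b
  proof -
    have "(y/x) powr b \<le> (y/x) powr \<bar>b\<bar>" using r by (intro powr_mono) auto
    also have "\<dots> \<le> 2 powr \<bar>b\<bar>" using r by (intro powr_mono2) auto
    finally show ?thesis using that by simp
  qed
  from this[of a] this[of "-a"] show "y powr a \<le> 2 powr \<bar>a\<bar> * x powr a" "x powr a \<le> 2 powr \<bar>a\<bar> * y powr a"
    using assms by (simp_all add: powr_divide powr_minus field_simps)
qed

lemma powr_diff_mvt:
  fixes a :: real and j :: nat
  assumes "j \<ge> 1"
  obtains z where "real j < z" "z < real (Suc j)"
    "real (Suc j) powr a - real j powr a = a * z powr (a - 1)"
proof -
  have "\<exists>z>real j. z < real (Suc j) \<and> real (Suc j) powr a - real j powr a = (real (Suc j) - real j) * (a * z powr (a - 1))"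
    by (rule MVT2) (use assms in \<open>auto intro!: derivative_eq_intros\<close>)
  then show ?thesis using that by auto
qed

text \<open>
  Each summand is compared with the increment of \<open>x powr \<kappa>\<close> over a unit interval, and these telescope.
\<close>

lemma sum_powr_le:
  fixes \<kappa> :: real
  assumes "\<kappa> > 0"
  obtains C where "C > 0" "\<And>n. (\<Sum>j<n. real (Suc j) powr (\<kappa> - 1)) \<le> C * real n powr \<kappa>"
proof -
  define C where "C = max 1 (2 powr \<bar>\<kappa> - 1\<bar> / \<kappa>)"
  have C: "C > 0" "C \<ge> 1" "2 powr \<bar>\<kappa> - 1\<bar> \<le> C * \<kappa>"
    using assms by (auto simp: C_def field_simps max_def)
  have term_le: "real (Suc j) powr (\<kappa> - 1) \<le> C * (real (Suc j) powr \<kappa> - real j powr \<kappa>)" for j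
  proof (cases "j = 0")
    case True
    then show ?thesis using C by simp
  next
    case False
    then obtain z where z: "real j < z" "z < real (Suc j)"
      "real (Suc j) powr \<kappa> - real j powr \<kappa> = \<kappa> * z powr (\<kappa> - 1)"
      using powr_diff_mvt[of j \<kappa>] by auto
    have "real (Suc j) powr (\<kappa> - 1) \<le> 2 powr \<bar>\<kappa> - 1\<bar> * z powr (\<kappa> - 1)"
      by (rule powr_within_factor_2) (use False z in auto)
    also have "\<dots> \<le> (C * \<kappa>) * z powr (\<kappa> - 1)"
      using C by (intro mult_right_mono) auto
    finally show ?thesis using z(3) by simp
  qed
  have "(\<Sum>j<n. real (Suc j) powr (\<kappa> - 1)) \<le> C * real n powr \<kappa>" for n
  proof -
    have "(\<Sum>j<n. real (Suc j) powr (\<kappa> - 1)) \<le> (\<Sum>j<n. C * (real (Suc j) powr \<kappa> - real j powr \<kappa>))"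
      by (intro sum_mono term_le)
    also have "\<dots> = C * (real n powr \<kappa> - real 0 powr \<kappa>)"
      using sum_lessThan_telescope[of "\<lambda>j. real j powr \<kappa>" n] by (simp add: sum_distrib_left[symmetric])
    finally show ?thesis by simp
  qed
  then show ?thesis using that C(1) by blast
qed

lemma sum_powr_tail_le:
  fixes \<eta> :: real
  assumes "\<eta> > 0" "m \<ge> 1"
  shows "(\<Sum>j=m..<n. real (Suc j) powr (- \<eta> - 1)) \<le> 1 / \<eta> * real m powr (- \<eta>)"
proof (cases "m \<le> n")
  case True
  have term_le: "real (Suc j) powr (- \<eta> - 1) \<le> 1 / \<eta> * (real j powr (- \<eta>) - real (Suc j) powr (- \<eta>))" if "j \<ge> m" for j
  proof -
    have "j \<ge> 1" using that assms by simp
    then obtain z where z: "real j < z" "z < real (Suc j)"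
      "real (Suc j) powr (-\<eta>) - real j powr (-\<eta>) = - \<eta> * z powr (- \<eta> - 1)"
      by (rule powr_diff_mvt[of j "-\<eta>"])
    have "real (Suc j) powr (- \<eta> - 1) \<le> z powr (- \<eta> - 1)"
      by (rule powr_mono2') (use assms that z in auto)
    also have "\<dots> = 1 / \<eta> * (real j powr (- \<eta>) - real (Suc j) powr (- \<eta>))"
      using z(3) assms by (simp add: field_simps)
    finally show ?thesis .
  qed
  have "(\<Sum>j=m..<n. real (Suc j) powr (- \<eta> - 1))
      \<le> (\<Sum>j=m..<n. 1 / \<eta> * (real j powr (- \<eta>) - real (Suc j) powr (- \<eta>)))"
    by (intro sum_mono term_le) auto
  also have "\<dots> = 1 / \<eta> * (real m powr (- \<eta>) - real n powr (- \<eta>))"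
  proof -
    have "(\<Sum>j=m..<n. real j powr (- \<eta>) - real (Suc j) powr (- \<eta>)) = real m powr (- \<eta>) - real n powr (- \<eta>)"
      using sum_Suc_diff'[OF True, of "\<lambda>j. - (real j powr (- \<eta>))"] by (simp add: algebra_simps)
    then show ?thesis by (simp only: sum_distrib_left[symmetric])
  qed
  also have "\<dots> \<le> 1 / \<eta> * real m powr (- \<eta>)"
    using assms by (intro mult_left_mono) auto
  finally show ?thesis .
qed (use assms in auto)

lemma sum_powr_bounded:
  fixes \<eta> :: real
  assumes "\<eta> > 0"
  shows "(\<Sum>j<n. real (Suc j) powr (- \<eta> - 1)) \<le> 1 + 1 / \<eta>"
proof -
  have "(\<Sum>j<n. real (Suc j) powr (- \<eta> - 1)) \<le> (\<Sum>j\<in>{..<1} \<union> {1..<n}. real (Suc j) powr (- \<eta> - 1))"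
    by (intro sum_mono2) auto
  also have "\<dots> = 1 + (\<Sum>j=1..<n. real (Suc j) powr (- \<eta> - 1))"
    by (subst sum.union_disjoint) auto
  finally show ?thesis using sum_powr_tail_le[OF assms, of 1 n] by simp
qed

lemma summable_of_bigo_powr:
  fixes f :: "nat \<Rightarrow> real"
  assumes "f \<in> O(\<lambda>j. real (Suc j) powr (- \<eta> - 1))" "\<eta> > 0"
  shows "summable f"
proof -
  have "summable (\<lambda>j. real (Suc j) powr (- \<eta> - 1))"
    using sum_powr_bounded[OF assms(2)] by (intro summableI_nonneg_bounded) auto
  then show ?thesis
    using assms(1) by (intro summable_comparison_test_bigo[OF _ assms(1)]) simp
qed

text \<open>
  Writing \<open>x = Suc j\<close>, this is \<open>(x / m) powr \<kappa> / x\<close> up to \<open>m\<close> and \<open>(x / m) powr (- \<eta>) / x\<close> beyond: a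
  discretised bump on a logarithmic scale around \<open>m\<close>, whose mass is bounded uniformly in \<open>m\<close>.  Summands that
  are largest near the cutoff are dominated by multiples of it.
\<close>

definition peak :: "real \<Rightarrow> real \<Rightarrow> nat \<Rightarrow> nat \<Rightarrow> real" where
  "peak \<kappa> \<eta> m j =
     (if Suc j \<le> m then real m powr (- \<kappa>) * real (Suc j) powr (\<kappa> - 1)
      else real m powr \<eta> * real (Suc j) powr (- \<eta> - 1))"

lemma peak_nonneg: "peak \<kappa> \<eta> m j \<ge> 0"
  by (simp add: peak_def)

lemma sum_peak_bounded:
  assumes "\<kappa> > 0" "\<eta> > 0"
  obtains C where "C > 0" "\<And>m n. m \<ge> 1 \<Longrightarrow> (\<Sum>j<n. peak \<kappa> \<eta> m j) \<le> C"
proof -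
  obtain C where C: "C > 0" "\<And>n. (\<Sum>j<n. real (Suc j) powr (\<kappa> - 1)) \<le> C * real n powr \<kappa>"
    using sum_powr_le[OF assms(1)] by blast
  have "(\<Sum>j<n. peak \<kappa> \<eta> m j) \<le> C + 1 / \<eta>" if m: "m \<ge> 1" for m n
  proof -
    have "(\<Sum>j<n. peak \<kappa> \<eta> m j) \<le> (\<Sum>j\<in>{..<m} \<union> {m..<n}. peak \<kappa> \<eta> m j)"
      by (intro sum_mono2) (auto simp: peak_nonneg)
    also have "\<dots> = (\<Sum>j<m. peak \<kappa> \<eta> m j) + (\<Sum>j=m..<n. peak \<kappa> \<eta> m j)"
      by (subst sum.union_disjoint) auto
    also have "\<dots> = real m powr (-\<kappa>) * (\<Sum>j<m. real (Suc j) powr (\<kappa> - 1))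
        + real m powr \<eta> * (\<Sum>j=m..<n. real (Suc j) powr (- \<eta> - 1))"
      unfolding sum_distrib_left by (intro arg_cong2[where f = "(+)"] sum.cong) (auto simp: peak_def)
    also have "\<dots> \<le> real m powr (-\<kappa>) * (C * real m powr \<kappa>) + real m powr \<eta> * (1 / \<eta> * real m powr (- \<eta>))"
      by (intro add_mono mult_left_mono C sum_powr_tail_le assms m) auto
    also have "\<dots> = C + 1 / \<eta>"
      using m by (simp add: powr_minus field_simps)
    finally show ?thesis .
  qed
  then show ?thesis using that[of "C + 1/\<eta>"] C(1) assms by (simp add: add_pos_pos)
qed

text \<open>
  The index up to which \<open>N\<close> samples are informative: \<open>N * x powr (- 2 * q)\<close> is at least \<open>1\<close> precisely
  for \<open>x\<close> up to the real number that is rounded here.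
\<close>

abbreviation cutoff :: "real \<Rightarrow> nat \<Rightarrow> nat" where
  "cutoff q N \<equiv> nat \<lfloor>real N powr (1 / (2 * q))\<rfloor>"

lemma cutoff_bounds:
  fixes q :: real and N :: nat
  assumes "q > 0" "N \<ge> 1" and m_def: "m = cutoff q N"
  shows "m \<ge> 1" "real m powr (2 * q) \<le> real N" "real N \<le> 2 powr (2 * q) * real m powr (2 * q)"
    "real m powr a \<le> 2 powr \<bar>a\<bar> * real N powr (a / (2 * q))"
    "real N powr (a / (2 * q)) \<le> 2 powr \<bar>a\<bar> * real m powr a"
proof -
  define u where "u = real N powr (1 / (2 * q))"
  have u1: "u \<ge> 1" using assms by (simp add: u_def ge_one_powr_ge_zero)
  have m_le: "real m \<le> u" "u < real m + 1" using u1 unfolding m_def u_def[symmetric] by linarith+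
  show m1: "m \<ge> 1" using u1 unfolding m_def u_def[symmetric] by linarith
  have m2: "u \<le> 2 * real m" using m1 m_le by linarith
  have up: "u powr a = real N powr (a / (2 * q))" for a
    using assms by (simp add: u_def powr_powr)
  have uN: "u powr (2 * q) = real N" using assms by (simp add: up)
  have mpos: "0 < real m" using m1 by simp
  show "real m powr (2 * q) \<le> real N" unfolding uN[symmetric]
    using m_le assms by (intro powr_mono2) auto
  show "real N \<le> 2 powr (2 * q) * real m powr (2 * q)" unfolding uN[symmetric]
    using powr_within_factor_2(1)[OF mpos m_le(1) m2, of "2 * q"] assms by simp
  show "real m powr a \<le> 2 powr \<bar>a\<bar> * real N powr (a / (2 * q))"
    "real N powr (a / (2 * q)) \<le> 2 powr \<bar>a\<bar> * real m powr a"
    using powr_within_factor_2[OF mpos m_le(1) m2, of a] by (simp_all add: up)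
qed

lemma cutoff_at_top:
  assumes "q > 0"
  shows "filterlim (cutoff q) at_top at_top"
  unfolding filterlim_at_top
proof
  fix M
  have "\<forall>\<^sub>F N in at_top. real N \<ge> real M powr (2 * q)"
    using filterlim_real_sequentially by (simp add: filterlim_at_top)
  then show "\<forall>\<^sub>F N in at_top. M \<le> cutoff q N"
  proof eventually_elim
    case (elim N)
    have "real M = (real M powr (2 * q)) powr (1 / (2 * q))"
      using assms by (cases "M = 0") (simp_all add: powr_powr)
    also have "\<dots> \<le> real N powr (1 / (2 * q))"
      using elim assms by (intro powr_mono2) auto
    finally show ?case by (simp add: le_nat_floor)
  qed
qed

lemma suminf_le_of_partial_sums:
  fixes f :: "nat \<Rightarrow> real"
  assumes "\<And>j. f j \<ge> 0" "\<And>n. (\<Sum>j<n. f j) \<le> C"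
  shows "(\<Sum>j. f j) \<le> C"
  using assms by (intro suminf_le_const summableI_nonneg_bounded) auto

lemma suminf_bounded_by_powr:
  fixes f :: "nat \<Rightarrow> real"
  assumes "\<eta> > 0" "c \<ge> 0" "\<And>j. 0 \<le> f j" "\<And>j. f j \<le> c * real (Suc j) powr (- \<eta> - 1)"
  shows "(\<Sum>j. f j) \<le> c * (1 + 1 / \<eta>)"
proof (rule suminf_le_of_partial_sums)
  fix n
  have "(\<Sum>j<n. f j) \<le> c * (\<Sum>j<n. real (Suc j) powr (- \<eta> - 1))"
    unfolding sum_distrib_left by (intro sum_mono assms)
  also have "\<dots> \<le> c * (1 + 1 / \<eta>)"
    by (intro mult_left_mono sum_powr_bounded assms)
  finally show "(\<Sum>j<n. f j) \<le> c * (1 + 1 / \<eta>)" .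
qed (use assms in auto)

lemma bigomega_eventually_ge:
  fixes f g :: "nat \<Rightarrow> real"
  assumes "f \<in> \<Omega>(g)" "\<And>j. f j \<ge> 0"
  obtains c n where "c > 0" "\<And>j. j \<ge> n \<Longrightarrow> c * \<bar>g j\<bar> \<le> f j"
proof -
  obtain c where "c > 0" "\<forall>\<^sub>F j in at_top. norm (f j) \<ge> c * norm (g j)"
    using landau_omega.bigE[OF assms(1)] by blast
  then show ?thesis using that assms(2) by (auto simp: eventually_at_top_linorder)
qed

lemma divide_le_numerator:
  fixes x y :: real
  assumes "0 \<le> x" "1 \<le> y"
  shows "x / y \<le> x"
  using assms mult_left_mono[of 1 y x] by (simp add: pos_divide_le_eq)

lemma summable_filtered:
  fixes f b :: "nat \<Rightarrow> real"
  assumes f: "\<And>j. f j \<ge> 0" "summable f" and b: "\<And>j. b j > 0"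
  shows "summable (\<lambda>j. f j / (1 + real N * b j) ^ k)"
proof (rule summable_comparison_test'[OF f(2)])
  fix j :: nat
  have "1 \<le> (1 + real N * b j) ^ k" using b[of j] by (intro one_le_power) simp
  then have "f j / (1 + real N * b j) ^ k \<le> f j" by (intro divide_le_numerator f)
  moreover have "0 \<le> f j / (1 + real N * b j) ^ k" using f(1)[of j] b[of j] by simp
  ultimately show "norm (f j / (1 + real N * b j) ^ k) \<le> f j" by (simp only: real_norm_def abs_of_nonneg)
qed

section \<open>Filtered sums\<close>

text \<open>
  The order of the sum of \<open>x powr (- \<tau>) / (1 + N * x powr (- 2 * q))\<close>.  For \<open>q = \<alpha> + p\<close> and \<open>\<tau> = 2 * (\<alpha>' + p)\<close>
  it is \<open>rho \<alpha> \<alpha>' p\<close>.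
\<close>

definition spectral_rate :: "real \<Rightarrow> real \<Rightarrow> nat \<Rightarrow> real" where
  "spectral_rate q \<tau> N =
     (if \<tau> < 2 * q + 1 then real N powr ((1 - \<tau>) / (2 * q))
      else if \<tau> = 2 * q + 1 then real N powr (-1) * ln (real N)
      else real N powr (-1))"

lemma spectral_rate_ge_inverse:
  assumes "q > 0" "N \<ge> 3"
  shows "1 / real N \<le> spectral_rate q \<tau> N"
proof -
  have "1 \<le> ln (real N)" using assms exp_le by (subst ln_ge_iff) auto
  moreover have "real N powr (-1) = 1 / real N" using assms by (simp add: powr_minus_divide)
  moreover have "real N powr (-1) \<le> real N powr ((1 - \<tau>) / (2 * q))" if "\<tau> < 2 * q + 1"
    using that assms by (intro powr_mono) (auto simp: field_simps)
  ultimately show ?thesis using assms by (auto simp: spectral_rate_def field_simps)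
qed

context
  fixes b :: "nat \<Rightarrow> real" and q :: real
  assumes q: "q > 0" and b_pos: "\<And>j. b j > 0"
    and b: "b \<in> \<Theta>(\<lambda>j. real (Suc j) powr (- 2 * q))"
begin

text \<open>
  The summand is at most a multiple of \<open>x powr (2 * q - \<tau>) / N\<close>, which is sharp where the data dominate, and
  of \<open>x powr (- \<tau>)\<close>, which is sharp where the prior does.  For \<open>\<tau> < 2 * q + 1\<close> the sum of the smaller bound
  concentrates at the cutoff; for \<open>\<tau> = 2 * q + 1\<close> the first one produces a harmonic sum below the cutoff; for larger \<open>\<tau>\<close> it is
  summable over all indices.
\<close>

lemma spread_sum_bigo:
  assumes \<tau>: "\<tau> > 1" and B: "\<And>j. B j \<ge> 0" "B \<in> O(\<lambda>j. real (Suc j) powr (- \<tau>))"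
  shows "(\<lambda>N. \<Sum>j. B j / (1 + real N * b j)) \<in> O(spectral_rate q \<tau>)"
proof -
  obtain cb Cb where cb: "cb > 0" "\<And>j. cb * real (Suc j) powr (- 2 * q) \<le> b j"
    by (rule bigtheta_bounds_everywhere[OF b b_pos]) auto
  obtain CB where CB: "CB > 0" "\<And>j. B j \<le> CB * real (Suc j) powr (- \<tau>)"
    by (rule bigo_bound_everywhere[OF B(2)]) (auto simp: B(1))
  define K where "K = CB / cb"
  have K: "K > 0" using cb CB by (simp add: K_def)
  have nonneg: "0 \<le> B j / (1 + real N * b j)" for j N
    using B(1)[of j] b_pos[of j] by simp
  have data: "B j / (1 + real N * b j) \<le> K * real (Suc j) powr (2 * q - \<tau>) / real N" if "N \<ge> 1" for j N
  proof -
    have "B j / (1 + real N * b j) \<le> (CB * real (Suc j) powr (- \<tau>)) / (real N * (cb * real (Suc j) powr (- 2 * q)))"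
    proof (rule frac_le)
      show "real N * (cb * real (Suc j) powr (- 2 * q)) \<le> 1 + real N * b j"
        using mult_left_mono[OF cb(2)[of j], of "real N"] by simp
    qed (use CB cb B(1)[of j] that in auto)
    also have "\<dots> = K * real (Suc j) powr (2 * q - \<tau>) / real N"
      by (simp add: K_def powr_diff powr_minus field_simps)
    finally show ?thesis .
  qed
  have prior: "B j / (1 + real N * b j) \<le> CB * real (Suc j) powr (- \<tau>)" for j N
  proof -
    have "B j / (1 + real N * b j) \<le> B j / 1"
      using b_pos[of j] B(1)[of j] by (intro divide_left_mono) (auto intro: add_pos_nonneg)
    then show ?thesis using CB(2)[of j] by simp
  qed
  consider "\<tau> < 2 * q + 1" | "\<tau> = 2 * q + 1" | "\<tau> > 2 * q + 1" by linarith
  then have "\<exists>C. \<forall>N\<ge>3. (\<Sum>j. B j / (1 + real N * b j)) \<le> C * spectral_rate q \<tau> N"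
  proof cases
    case 1
    define \<kappa> \<eta> where "\<kappa> = 2 * q + 1 - \<tau>" and "\<eta> = \<tau> - 1"
    have pos: "\<kappa> > 0" "\<eta> > 0" using 1 \<tau> by (auto simp: \<kappa>_def \<eta>_def)
    obtain P where P: "P > 0" "\<And>m n. m \<ge> 1 \<Longrightarrow> (\<Sum>j<n. peak \<kappa> \<eta> m j) \<le> P"
      using sum_peak_bounded[OF pos] by blast
    define L where "L = max K CB"
    have L: "L \<ge> K" "L \<ge> CB" "L > 0" using K by (auto simp: L_def)
    have "(\<Sum>j. B j / (1 + real N * b j)) \<le> L * P * 2 powr \<bar>1 - \<tau>\<bar> * spectral_rate q \<tau> N"
      if N: "N \<ge> 3" for N
    proof -
      define m where "m = cutoff q N"
      have N1: "N \<ge> 1" using N by simp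
      note m = cutoff_bounds[OF q N1 m_def]
      have mN: "1 / real N \<le> real m powr (- 2 * q)"
        using m(1,2) N by (simp add: powr_minus field_simps)
      have "B j / (1 + real N * b j) \<le> L * real m powr (1 - \<tau>) * peak \<kappa> \<eta> m j" for j
      proof (cases "Suc j \<le> m")
        case True
        have "K * real (Suc j) powr (2 * q - \<tau>) / real N \<le> L * real (Suc j) powr (2 * q - \<tau>) * real m powr (- 2 * q)"
          unfolding divide_inverse using mN L K
          by (intro mult_mono mult_right_mono) (auto simp: inverse_eq_divide)
        also have "\<dots> = L * real m powr (1 - \<tau>) * (real m powr (- \<kappa>) * real (Suc j) powr (\<kappa> - 1))"
          using m(1) by (simp add: \<kappa>_def powr_add[symmetric] algebra_simps)
        finally show ?thesis using data[OF N1, of j] True by (simp add: peak_def)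
      next
        case False
        have "CB * real (Suc j) powr (- \<tau>) \<le> L * real (Suc j) powr (- \<tau>)"
          using L by (intro mult_right_mono) auto
        also have "\<dots> = L * real m powr (1 - \<tau>) * (real m powr \<eta> * real (Suc j) powr (- \<eta> - 1))"
          using m(1) by (simp add: \<eta>_def powr_add[symmetric])
        finally show ?thesis using prior[of j N] False by (simp add: peak_def)
      qed
      note term_le = this
      have "(\<Sum>j<n. B j / (1 + real N * b j)) \<le> L * real m powr (1 - \<tau>) * P" for n
      proof -
        have "(\<Sum>j<n. B j / (1 + real N * b j)) \<le> L * real m powr (1 - \<tau>) * (\<Sum>j<n. peak \<kappa> \<eta> m j)"
          unfolding sum_distrib_left by (intro sum_mono term_le)
        also have "\<dots> \<le> L * real m powr (1 - \<tau>) * P"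
          using L m(1) by (intro mult_left_mono P) auto
        finally show ?thesis .
      qed
      then have "(\<Sum>j. B j / (1 + real N * b j)) \<le> L * real m powr (1 - \<tau>) * P"
        by (rule suminf_le_of_partial_sums[OF nonneg])
      also have "\<dots> \<le> L * (2 powr \<bar>1 - \<tau>\<bar> * real N powr ((1 - \<tau>) / (2 * q))) * P"
        using L P m(4)[of "1 - \<tau>"] by (intro mult_right_mono mult_left_mono) auto
      finally show ?thesis using 1 by (simp add: spectral_rate_def mult_ac)
    qed
    then show ?thesis by blast
  next
    case 2
    have "(\<Sum>j. B j / (1 + real N * b j))
        \<le> (K * (1 + 1 / (2 * q)) + CB * (1 / (2 * q) * 2 powr (2 * q))) * spectral_rate q \<tau> N"
      if N: "N \<ge> 3" for N
    proof -
      define m where "m = cutoff q N"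
      have N1: "N \<ge> 1" using N by simp
      note m = cutoff_bounds[OF q N1 m_def]
      have mN: "real m powr (- (2 * q)) \<le> 2 powr (2 * q) / real N"
        using m(1,3) N by (simp add: powr_minus field_simps)
      have "(\<Sum>j<n. B j / (1 + real N * b j))
          \<le> (K * (1 + ln (real N) / (2 * q)) + CB * (1 / (2 * q) * 2 powr (2 * q))) / real N" for n
      proof -
        have "(\<Sum>j<n. B j / (1 + real N * b j)) \<le> (\<Sum>j\<in>{..<m} \<union> {m..<n}. B j / (1 + real N * b j))"
          using nonneg by (intro sum_mono2) auto
        also have "\<dots> = (\<Sum>j<m. B j / (1 + real N * b j)) + (\<Sum>j=m..<n. B j / (1 + real N * b j))"
          by (subst sum.union_disjoint) auto
        also have "(\<Sum>j<m. B j / (1 + real N * b j)) \<le> (\<Sum>j<m. K / real N * (1 / real (Suc j)))"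
        proof (intro sum_mono)
          fix j
          show "B j / (1 + real N * b j) \<le> K / real N * (1 / real (Suc j))"
            using data[OF N1, of j] 2 by (simp add: powr_minus_divide field_simps)
        qed
        also have "\<dots> = K / real N * harm m"
          unfolding sum_distrib_left[symmetric] harm_def
          by (simp add: inverse_eq_divide lessThan_Suc_atMost sum.atLeast1_atMost_eq)
        also have "\<dots> \<le> K / real N * (1 + ln (real N) / (2 * q))"
        proof (rule mult_left_mono)
          have "harm m \<le> ln (real m) + 1"
            using decseqD[OF decseq_harm_diff_ln, of 0 "m - 1"] m(1) by (simp add: harm_def)
          moreover
          have "2 * q * ln (real m) \<le> ln (real N)"
            using m(1) ln_mono[OF m(2)] N by (simp add: ln_powr)
          then have "ln (real m) \<le> ln (real N) / (2 * q)" using q by (simp add: field_simps)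
          ultimately show "harm m \<le> 1 + ln (real N) / (2 * q)" by linarith
        qed (use K in simp)
        also have "(\<Sum>j=m..<n. B j / (1 + real N * b j)) \<le> CB * (\<Sum>j=m..<n. real (Suc j) powr (- (2 * q) - 1))"
        proof -
          have "- \<tau> = - (2 * q) - 1" using 2 by simp
          then show ?thesis
            unfolding sum_distrib_left using prior by (intro sum_mono) metis
        qed
        also have "\<dots> \<le> CB * (1 / (2 * q) * real m powr (- (2 * q)))"
          using CB q m(1) by (intro mult_left_mono sum_powr_tail_le) auto
        also have "\<dots> \<le> CB * (1 / (2 * q) * (2 powr (2 * q) / real N))"
          using CB q mN by (intro mult_left_mono) auto
        finally show ?thesis by (simp add: add_divide_distrib)
      qed
      then have "(\<Sum>j. B j / (1 + real N * b j))
          \<le> (K * (1 + ln (real N) / (2 * q)) + CB * (1 / (2 * q) * 2 powr (2 * q))) / real N"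
        by (rule suminf_le_of_partial_sums[OF nonneg])
      also have "\<dots> \<le> ((K * (1 + 1 / (2 * q)) + CB * (1 / (2 * q) * 2 powr (2 * q))) * ln (real N)) / real N"
      proof (intro divide_right_mono)
        have ln1: "1 \<le> ln (real N)" using N exp_le by (subst ln_ge_iff) auto
        have "K * 1 \<le> K * ln (real N)" using ln1 K by (intro mult_left_mono) auto
        moreover have "CB * (1 / (2 * q) * 2 powr (2 * q)) * 1 \<le> CB * (1 / (2 * q) * 2 powr (2 * q)) * ln (real N)"
          using ln1 CB q by (intro mult_left_mono) auto
        ultimately show "K * (1 + ln (real N) / (2 * q)) + CB * (1 / (2 * q) * 2 powr (2 * q))
            \<le> (K * (1 + 1 / (2 * q)) + CB * (1 / (2 * q) * 2 powr (2 * q))) * ln (real N)"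
          by (simp add: algebra_simps)
      qed auto
      finally show ?thesis using 2 N by (simp add: spectral_rate_def powr_minus_divide)
    qed
    then show ?thesis by blast
  next
    case 3
    define \<eta> where "\<eta> = \<tau> - 2 * q - 1"
    have "(\<Sum>j. B j / (1 + real N * b j)) \<le> K * (1 + 1 / \<eta>) * spectral_rate q \<tau> N" if N: "N \<ge> 3" for N
    proof -
      have "(\<Sum>j. B j / (1 + real N * b j)) \<le> K / real N * (1 + 1 / \<eta>)"
        using data[of N] N nonneg 3 K by (intro suminf_bounded_by_powr) (auto simp: \<eta>_def)
      then show ?thesis using 3 N by (simp add: spectral_rate_def powr_minus_divide mult_ac)
    qed
    then show ?thesis by blast
  qed
  then obtain C where C: "\<And>N. N \<ge> 3 \<Longrightarrow> (\<Sum>j. B j / (1 + real N * b j)) \<le> C * spectral_rate q \<tau> N"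
    by blast
  show ?thesis
  proof (rule bigoI[where c = C])
    show "\<forall>\<^sub>F N in at_top. norm (\<Sum>j. B j / (1 + real N * b j)) \<le> C * norm (spectral_rate q \<tau> N)"
      using eventually_ge_at_top[of 3]
    proof eventually_elim
      case (elim N)
      have "B \<in> O(\<lambda>j. real (Suc j) powr (- (\<tau> - 1) - 1))" using B(2) by simp
      then have "summable B" by (rule summable_of_bigo_powr) (use \<tau> in simp)
      from summable_filtered[OF B(1) this b_pos, where N = N and k = 1] have "summable (\<lambda>j. B j / (1 + real N * b j))"
        by simp
      then have "0 \<le> (\<Sum>j. B j / (1 + real N * b j))" using nonneg by (intro suminf_nonneg)
      moreover have "0 \<le> spectral_rate q \<tau> N"
        using spectral_rate_ge_inverse[OF q elim, of \<tau>] by (rule order_trans[rotated]) simp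
      ultimately show ?case using C[OF elim] by simp
    qed
  qed
qed

text \<open>
  Squaring the filter doubles the power it contributes below the cutoff, so that for \<open>\<beta> < 4 * q\<close> the
  summands peak at the cutoff.  The case distinction is nevertheless made at \<open>2 * q\<close>: beyond that value the
  bound \<open>A j / (b j * N)\<close> is already summable, and its sum is \<open>O(1 / N)\<close>.
\<close>

lemma bias_sum_bigo:
  assumes \<beta>: "\<beta> > 0" and S: "slowly_varying S"
    and A: "\<And>j. A j \<ge> 0" "A \<in> O(\<lambda>j. real (Suc j) powr (- \<beta> - 1) * (S (real (Suc j)))\<^sup>2)"
  shows "(\<lambda>N. \<Sum>j. A j / (1 + real N * b j)\<^sup>2)
    \<in> O(\<lambda>N. 1 / real N + real N powr (- \<beta> / (2 * q)) * (S (real (cutoff q N)))\<^sup>2)"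
proof -
  obtain cb Cb where cb: "cb > 0" "\<And>j. cb * real (Suc j) powr (- 2 * q) \<le> b j"
    by (rule bigtheta_bounds_everywhere[OF b b_pos]) auto
  define V where "V N j = A j / (1 + real N * b j)\<^sup>2" for N j
  have V_nonneg: "0 \<le> V N j" for N j
    using A(1)[of j] by (simp add: V_def)
  have V_le: "V N j \<le> A j / D" if "D > 0" "D \<le> (1 + real N * b j)\<^sup>2" for N j D
    unfolding V_def using that A(1)[of j] by (intro divide_left_mono mult_pos_pos) auto
  have V_le_A: "V N j \<le> A j" for N j
    using V_le[of 1 N j] b_pos[of j] by (simp add: one_le_power)
  have V_le_N: "V N j \<le> A j / b j / real N" if "N \<ge> 1" for N j
  proof -
    have "real N * b j \<le> (1 + real N * b j)\<^sup>2"
      using b_pos[of j] by (simp add: power2_eq_square algebra_simps add_nonneg_nonneg)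
    then have "V N j \<le> A j / (real N * b j)"
      using b_pos[of j] that by (intro V_le) auto
    then show ?thesis by (simp add: mult.commute)
  qed
  have V_le_N2: "V N j \<le> A j * real (Suc j) powr (4 * q) / (cb * real N)\<^sup>2" if "N \<ge> 1" for N j
  proof -
    define w where "w = real N * (cb * real (Suc j) powr (- 2 * q))"
    have w: "w > 0" using cb that by (simp add: w_def)
    have "w \<le> 1 + real N * b j"
      using mult_left_mono[OF cb(2)[of j], of "real N"] by (simp add: w_def)
    then have "V N j \<le> A j / w\<^sup>2"
      using w by (intro V_le power_mono) auto
    also have "w\<^sup>2 = (cb * real N)\<^sup>2 * real (Suc j) powr (- 4 * q)"
      by (simp add: w_def power_mult_distrib power2_eq_square[of "_ powr _"] powr_add[symmetric])
    also have "A j / \<dots> = A j * real (Suc j) powr (4 * q) / (cb * real N)\<^sup>2"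
      by (simp add: powr_minus field_simps)
    finally show ?thesis .
  qed
  \<comment> \<open>\<open>V_le_A\<close> serves above the cutoff, \<open>V_le_N2\<close> below it, and \<open>V_le_N\<close> for finitely many indices or summable \<open>A / b\<close>.\<close>
  have bound: "\<exists>C. \<forall>\<^sub>F N in at_top. (\<Sum>j. V N j) \<le> C * (1 / real N + real N powr (- \<beta> / (2 * q)) * (S (real (cutoff q N)))\<^sup>2)"
  proof (cases "\<beta> > 2 * q")
    case True
    \<comment> \<open>Half of the excess \<open>\<beta> - 2 * q\<close> pays for \<open>S\<close>, the other half for summability.\<close>
    define \<eta> where "\<eta> = (\<beta> - 2 * q) / 2"
    have \<eta>: "\<eta> > 0" using True by (simp add: \<eta>_def)
    have "A \<in> O(\<lambda>j. real (Suc j) powr (- \<beta> - 1 + \<eta>))"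
      by (rule regularly_varying_bigo[OF S \<eta> A(2)])
    then obtain C where C: "C > 0" "\<And>j. \<bar>A j\<bar> \<le> C * real (Suc j) powr (- \<beta> - 1 + \<eta>)"
      by (rule bigo_bound_everywhere) auto
    have "(\<Sum>j. V N j) \<le> C / cb / real N * (1 + 1 / \<eta>)" if N: "N \<ge> 1" for N
    proof (rule suminf_bounded_by_powr[OF \<eta>])
      fix j
      have "V N j \<le> A j / b j / real N" by (rule V_le_N[OF N])
      also have "\<dots> \<le> C * real (Suc j) powr (- \<beta> - 1 + \<eta>) / (cb * real (Suc j) powr (- 2 * q)) / real N"
        using cb(1) cb(2)[of j] C(1) C(2)[of j] A(1)[of j]
        by (intro divide_right_mono frac_le) auto
      also have "\<dots> = C / cb / real N * real (Suc j) powr (- \<eta> - 1)"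
      proof -
        have "real (Suc j) powr (- \<beta> - 1 + \<eta>) / real (Suc j) powr (- 2 * q) = real (Suc j) powr (- \<eta> - 1)"
          by (simp add: powr_diff[symmetric] \<eta>_def field_simps)
        then show ?thesis by (simp add: field_simps)
      qed
      finally show "V N j \<le> C / cb / real N * real (Suc j) powr (- \<eta> - 1)" .
    qed (use C cb V_nonneg in auto)
    then have "(\<Sum>j. V N j) \<le> (C / cb * (1 + 1 / \<eta>)) *
        (1 / real N + real N powr (- \<beta> / (2 * q)) * (S (real (cutoff q N)))\<^sup>2)" if "N \<ge> 1" for N
    proof -
      have "(C / cb * (1 + 1 / \<eta>)) * (1 / real N) \<le> (C / cb * (1 + 1 / \<eta>)) *
        (1 / real N + real N powr (- \<beta> / (2 * q)) * (S (real (cutoff q N)))\<^sup>2)"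
        using C cb \<eta> by (intro mult_left_mono) auto
      then show ?thesis
        using that \<open>\<And>N. N \<ge> 1 \<Longrightarrow> (\<Sum>j. V N j) \<le> C / cb / real N * (1 + 1 / \<eta>)\<close>[of N] by (simp add: mult_ac)
    qed
    then show ?thesis by (meson eventually_ge_at_top eventually_mono)
  next
    case False
    \<comment> \<open>The Potter exponent leaves polynomial decay on both sides of the cutoff: \<open>\<kappa>\<close> and \<open>\<eta>\<close> are positive.\<close>
    define e where "e = min \<beta> (4 * q - \<beta>) / 4"
    define \<kappa> \<eta> where "\<kappa> = 4 * q - \<beta> - 2 * e" and "\<eta> = \<beta> - 2 * e"
    have e: "e > 0" and pos: "\<kappa> > 0" "\<eta> > 0"
      using False \<beta> q by (auto simp: e_def \<kappa>_def \<eta>_def min_def)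
    obtain X where X: "X \<ge> 1" "\<And>x. x \<ge> X \<Longrightarrow> S x > 0"
      "\<And>x y. X \<le> x \<Longrightarrow> x \<le> y \<Longrightarrow> S y \<le> exp e * (y / x) powr e * S x"
      "\<And>x y. X \<le> x \<Longrightarrow> x \<le> y \<Longrightarrow> S x \<le> exp e * (y / x) powr e * S y"
      using potter_bounds[OF S e] by blast
    obtain CA where CA: "CA > 0" "\<forall>\<^sub>F j in at_top. norm (A j) \<le> CA * norm (real (Suc j) powr (- \<beta> - 1) * (S (real (Suc j)))\<^sup>2)"
      using landau_o.bigE[OF A(2)] by blast
    then obtain j1 where j1: "\<And>j. j \<ge> j1 \<Longrightarrow> A j \<le> CA * (real (Suc j) powr (- \<beta> - 1) * (S (real (Suc j)))\<^sup>2)"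
      using A(1) by (auto simp: eventually_at_top_linorder)
    define j0 where "j0 = max j1 (nat \<lceil>X\<rceil>)"
    have j0: "A j \<le> CA * (real (Suc j) powr (- \<beta> - 1) * (S (real (Suc j)))\<^sup>2)" "X \<le> real (Suc j)" if "j \<ge> j0" for j
    proof -
      show "A j \<le> CA * (real (Suc j) powr (- \<beta> - 1) * (S (real (Suc j)))\<^sup>2)"
        using that by (intro j1) (simp add: j0_def)
      have "nat \<lceil>X\<rceil> \<le> j" using that by (simp add: j0_def)
      then show "X \<le> real (Suc j)" by linarith
    qed
    obtain P where P: "P > 0" "\<And>m n. m \<ge> 1 \<Longrightarrow> (\<Sum>j<n. peak \<kappa> \<eta> m j) \<le> P"
      using sum_peak_bounded[OF pos] by blast
    define L where "L = (CA + CA / cb\<^sup>2) * exp (2 * e)"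
    have L: "CA * exp (2 * e) \<le> L" "CA / cb\<^sup>2 * exp (2 * e) \<le> L" "L > 0"
      using CA cb by (auto simp: L_def field_simps add_pos_pos)
    \<comment> \<open>The indices below \<open>j0\<close>, where \<open>S\<close> gives no control, contribute at most \<open>H / N\<close>.\<close>
    define H where "H = (\<Sum>j<j0. A j / b j)"
    have H: "H \<ge> 0" unfolding H_def using A(1) b_pos by (intro sum_nonneg) (simp add: less_imp_le)
    have sq: "(exp e * r powr e * S y)\<^sup>2 = exp (2 * e) * r powr (2 * e) * (S y)\<^sup>2" for r y
      by (simp add: power_mult_distrib exp_double powr_add[symmetric] power2_eq_square[of "_ powr _"])
    have "\<forall>\<^sub>F N in at_top. cutoff q N \<ge> nat \<lceil>X\<rceil>"
      using cutoff_at_top[OF q] unfolding filterlim_at_top by blast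
    then have "\<forall>\<^sub>F N in at_top. (\<Sum>j. V N j) \<le> (H + L * P * 2 powr \<beta>) *
        (1 / real N + real N powr (- \<beta> / (2 * q)) * (S (real (cutoff q N)))\<^sup>2)"
      using eventually_ge_at_top[of 1]
    proof eventually_elim
      case (elim N)
      define m where "m = cutoff q N"
      have N1: "N \<ge> 1" using elim by simp
      note m = cutoff_bounds[OF q N1 m_def]
      have mX: "X \<le> real m" using elim(1) unfolding m_def[symmetric] by linarith
      have mN: "1 / (real N)\<^sup>2 \<le> real m powr (- 4 * q)"
      proof -
        have "(1 / real N)\<^sup>2 \<le> (real m powr (- 2 * q))\<^sup>2"
          using m(1,2) N1 by (intro power_mono) (auto simp: powr_minus field_simps)
        then show ?thesis
          by (simp add: power_divide power2_eq_square[of "_ powr _"] powr_add[symmetric])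
      qed
      have V_peak: "V N j \<le> L * real m powr (- \<beta>) * (S (real m))\<^sup>2 * peak \<kappa> \<eta> m j" if j: "j \<ge> j0" for j
      proof (cases "Suc j \<le> m")
        case True
        have "S (real (Suc j)) \<le> exp e * (real m / real (Suc j)) powr e * S (real m)"
          using j0(2)[OF j] True by (intro X) auto
        then have S2: "(S (real (Suc j)))\<^sup>2 \<le> exp (2 * e) * (real m / real (Suc j)) powr (2 * e) * (S (real m))\<^sup>2"
          unfolding sq[symmetric] using X(2)[OF j0(2)[OF j]] by (intro power_mono) auto
        have "V N j \<le> A j * real (Suc j) powr (4 * q) / (cb * real N)\<^sup>2"
          by (rule V_le_N2[OF N1])
        also have "\<dots> = (A j * real (Suc j) powr (4 * q) / cb\<^sup>2) * (1 / (real N)\<^sup>2)"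
          by (simp add: power_mult_distrib)
        also have "\<dots> \<le> (CA * (real (Suc j) powr (- \<beta> - 1) * (exp (2 * e) * (real m / real (Suc j)) powr (2 * e) * (S (real m))\<^sup>2))
            * real (Suc j) powr (4 * q) / cb\<^sup>2) * real m powr (- 4 * q)"
        proof (intro mult_mono mN divide_right_mono mult_right_mono)
          show "A j \<le> CA * (real (Suc j) powr (- \<beta> - 1) * (exp (2 * e) * (real m / real (Suc j)) powr (2 * e) * (S (real m))\<^sup>2))"
            using j0(1)[OF j] S2 CA(1) by (elim order_trans) (auto intro!: mult_left_mono)
        qed (use CA(1) in auto)
        also have "\<dots> = (CA / cb\<^sup>2 * exp (2 * e)) * (S (real m))\<^sup>2 * (real (Suc j) powr (- \<beta> - 1) *
            (real m / real (Suc j)) powr (2 * e) * real (Suc j) powr (4 * q) * real m powr (- 4 * q))"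
          by (simp only: divide_inverse mult_ac)
        also have "real (Suc j) powr (- \<beta> - 1) * (real m / real (Suc j)) powr (2 * e) * real (Suc j) powr (4 * q) * real m powr (- 4 * q)
            = real m powr (- \<beta>) * (real m powr (- \<kappa>) * real (Suc j) powr (\<kappa> - 1))"
          using m(1) by (simp add: powr_def ln_div mult_exp_exp \<kappa>_def algebra_simps)
        also have "(CA / cb\<^sup>2 * exp (2 * e)) * (S (real m))\<^sup>2 * \<dots> \<le> L * (S (real m))\<^sup>2 * \<dots>"
          by (intro mult_right_mono L) auto
        finally show ?thesis using True by (simp add: peak_def mult_ac)
      next
        case False
        have "S (real (Suc j)) \<le> exp e * (real (Suc j) / real m) powr e * S (real m)"
          using mX False by (intro X) auto
        then have S2: "(S (real (Suc j)))\<^sup>2 \<le> exp (2 * e) * (real (Suc j) / real m) powr (2 * e) * (S (real m))\<^sup>2"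
          unfolding sq[symmetric] using X(2)[OF j0(2)[OF j]] by (intro power_mono) auto
        have "V N j \<le> CA * (real (Suc j) powr (- \<beta> - 1) * (exp (2 * e) * (real (Suc j) / real m) powr (2 * e) * (S (real m))\<^sup>2))"
          using V_le_A[of N j] j0(1)[OF j] S2 CA(1) by (elim order_trans) (auto intro!: mult_left_mono)
        also have "\<dots> = (CA * exp (2 * e)) * (S (real m))\<^sup>2 * (real (Suc j) powr (- \<beta> - 1) * (real (Suc j) / real m) powr (2 * e))"
          by (simp only: mult_ac)
        also have "real (Suc j) powr (- \<beta> - 1) * (real (Suc j) / real m) powr (2 * e)
            = real m powr (- \<beta>) * (real m powr \<eta> * real (Suc j) powr (- \<eta> - 1))"
          using m(1) by (simp add: powr_def ln_div mult_exp_exp \<eta>_def algebra_simps)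
        also have "(CA * exp (2 * e)) * (S (real m))\<^sup>2 * \<dots> \<le> L * (S (real m))\<^sup>2 * \<dots>"
          by (intro mult_right_mono L) auto
        finally show ?thesis using False by (simp add: peak_def mult_ac)
      qed
      have "(\<Sum>j. V N j) \<le> H / real N + L * real m powr (- \<beta>) * (S (real m))\<^sup>2 * P"
      proof (rule suminf_le_of_partial_sums[OF V_nonneg])
        fix n
        have "(\<Sum>j<n. V N j) \<le> (\<Sum>j\<in>{..<j0} \<union> {j0..<n}. V N j)"
          using V_nonneg by (intro sum_mono2) auto
        also have "\<dots> = (\<Sum>j<j0. V N j) + (\<Sum>j=j0..<n. V N j)"
          by (subst sum.union_disjoint) auto
        also have "(\<Sum>j<j0. V N j) \<le> H / real N"
          unfolding H_def sum_divide_distrib by (intro sum_mono V_le_N[OF N1])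
        also have "(\<Sum>j=j0..<n. V N j) \<le> (\<Sum>j=j0..<n. L * real m powr (- \<beta>) * (S (real m))\<^sup>2 * peak \<kappa> \<eta> m j)"
          by (intro sum_mono V_peak) auto
        also have "\<dots> \<le> (\<Sum>j<n. L * real m powr (- \<beta>) * (S (real m))\<^sup>2 * peak \<kappa> \<eta> m j)"
          using L(3) by (intro sum_mono2) (auto simp: peak_nonneg)
        also have "\<dots> \<le> L * real m powr (- \<beta>) * (S (real m))\<^sup>2 * P"
          unfolding sum_distrib_left[symmetric] using L(3) by (intro mult_left_mono P m(1)) auto
        finally show "(\<Sum>j<n. V N j) \<le> H / real N + L * real m powr (- \<beta>) * (S (real m))\<^sup>2 * P"
          by simp
      qed
      also have "\<dots> \<le> H * (1 / real N) + L * (2 powr \<beta> * real N powr (- \<beta> / (2 * q))) * (S (real m))\<^sup>2 * P"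
        using L(3) P(1) m(4)[of "- \<beta>"] \<beta> by (intro add_mono mult_right_mono mult_left_mono) auto
      also have "\<dots> = H * (1 / real N) + (L * P * 2 powr \<beta>) * (real N powr (- \<beta> / (2 * q)) * (S (real m))\<^sup>2)"
        by (simp only: mult_ac)
      also have "\<dots> \<le> (H + L * P * 2 powr \<beta>) * (1 / real N + real N powr (- \<beta> / (2 * q)) * (S (real m))\<^sup>2)"
        unfolding distrib_left using H L(3) P(1)
        by (intro add_mono mult_right_mono) auto
      finally show ?case unfolding m_def .
    qed
    then show ?thesis by blast
  qed
  have "A \<in> O(\<lambda>j. real (Suc j) powr (- (\<beta> / 2) - 1))"
    using regularly_varying_bigo[OF S _ A(2), of "\<beta> / 2"] \<beta> by (simp add: algebra_simps)
  then have "summable A"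
    by (rule summable_of_bigo_powr) (use \<beta> in simp)
  then have "summable (V N)" for N
    unfolding V_def by (intro summable_filtered A(1) b_pos)
  then have "0 \<le> (\<Sum>j. V N j)" for N
    using V_nonneg by (intro suminf_nonneg)
  then have "norm (\<Sum>j. V N j) = (\<Sum>j. V N j)" for N by simp
  moreover obtain C where "\<forall>\<^sub>F N in at_top. (\<Sum>j. V N j) \<le> C * (1 / real N + real N powr (- \<beta> / (2 * q)) * (S (real (cutoff q N)))\<^sup>2)"
    using bound by blast
  ultimately show ?thesis
    unfolding V_def[symmetric] by (intro bigoI[where c = C]) simp
qed

text \<open>
  On the window \<open>{m..<2*m}\<close> above the cutoff, \<open>N * b j\<close> stays bounded, so the filter only costs a constant.
\<close>

lemma window_sum_ge:
  assumes Cb: "Cb > 0" "\<And>j. b j \<le> Cb * real (Suc j) powr (- 2 * q)"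
    and N: "N \<ge> 1" and m_def: "m = cutoff q N" and k: "k \<le> 2"
    and f: "\<And>j. f j \<ge> 0" "summable f" and K: "K \<ge> 0" "\<And>j. j \<in> {m..<2*m} \<Longrightarrow> K \<le> f j"
  shows "1 / (1 + Cb * 2 powr (2 * q))\<^sup>2 * real m * K \<le> (\<Sum>j. f j / (1 + real N * b j) ^ k)"
proof -
  define D where "D = 1 + Cb * 2 powr (2 * q)"
  have D: "D \<ge> 1" using Cb by (simp add: D_def)
  note m = cutoff_bounds[OF q N m_def]
  have nonneg: "0 \<le> f j / (1 + real N * b j) ^ k" for j
    using f b_pos[of j] by simp
  have sm: "summable (\<lambda>j. f j / (1 + real N * b j) ^ k)"
    by (rule summable_filtered[OF f b_pos])
  have "1 / D\<^sup>2 * real m * K = (\<Sum>j=m..<2*m. K / D\<^sup>2)" by simp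
  also have "\<dots> \<le> (\<Sum>j=m..<2*m. f j / (1 + real N * b j) ^ k)"
  proof (rule sum_mono)
    fix j assume j: "j \<in> {m..<2*m}"
    have "real N * b j \<le> (2 powr (2 * q) * real m powr (2 * q)) * (Cb * real m powr (- 2 * q))"
    proof (intro mult_mono m(3))
      have "real (Suc j) powr (- 2 * q) \<le> real m powr (- 2 * q)"
        using j m(1) q by (intro powr_mono2') auto
      then show "b j \<le> Cb * real m powr (- 2 * q)"
        using Cb(2)[of j] mult_left_mono[of _ _ Cb] Cb(1) by (meson less_imp_le order_trans)
    qed (use b_pos[of j] in auto)
    also have "\<dots> = Cb * 2 powr (2 * q)" using m(1) by (simp add: powr_minus field_simps)
    finally have le: "1 + real N * b j \<le> D" by (simp add: D_def)
    have one: "1 \<le> 1 + real N * b j" using b_pos[of j] by simp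
    have "(1 + real N * b j) ^ k \<le> (1 + real N * b j)\<^sup>2" using k one by (intro power_increasing)
    also have "\<dots> \<le> D\<^sup>2" using le one by (intro power_mono) auto
    finally have "(1 + real N * b j) ^ k \<le> D\<^sup>2" .
    then show "K / D\<^sup>2 \<le> f j / (1 + real N * b j) ^ k"
      using one K(1) K(2)[OF j] by (intro frac_le) auto
  qed
  also have "\<dots> \<le> (\<Sum>j. f j / (1 + real N * b j) ^ k)"
    using nonneg by (intro sum_le_suminf sm) auto
  finally show ?thesis unfolding D_def .
qed

text \<open>
  The window at the cutoff suffices: it has \<open>m\<close> indices, on which \<open>S\<close> is comparable to \<open>S m\<close>.
\<close>

lemma bias_sum_bigomega:
  assumes \<beta>: "\<beta> > 0" and S: "slowly_varying S"
    and A: "\<And>j. A j \<ge> 0" "A \<in> \<Theta>(\<lambda>j. real (Suc j) powr (- \<beta> - 1) * (S (real (Suc j)))\<^sup>2)"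
  shows "(\<lambda>N. \<Sum>j. A j / (1 + real N * b j)\<^sup>2)
    \<in> \<Omega>(\<lambda>N. real N powr (- \<beta> / (2 * q)) * (S (real (cutoff q N)))\<^sup>2)"
proof -
  have "A \<in> O(\<lambda>j. real (Suc j) powr (- \<beta> - 1) * (S (real (Suc j)))\<^sup>2)"
    using A(2) by blast
  then have "A \<in> O(\<lambda>j. real (Suc j) powr (- \<beta> - 1 + \<beta> / 2))"
    using \<beta> by (intro regularly_varying_bigo[OF S]) auto
  then have "A \<in> O(\<lambda>j. real (Suc j) powr (- (\<beta> / 2) - 1))"
    by (simp add: algebra_simps)
  then have A_sum: "summable A"
    by (rule summable_of_bigo_powr) (use \<beta> in simp)
  obtain X where X: "X \<ge> 1" "\<And>x. x \<ge> X \<Longrightarrow> S x > 0"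
    "\<And>x y. X \<le> x \<Longrightarrow> x \<le> y \<Longrightarrow> S x \<le> exp 1 * (y / x) powr 1 * S y"
    by (rule potter_bounds[OF S zero_less_one]) blast
  obtain cA n0 where cA: "cA > 0" "\<And>j. j \<ge> n0 \<Longrightarrow> cA * \<bar>real (Suc j) powr (- \<beta> - 1) * (S (real (Suc j)))\<^sup>2\<bar> \<le> A j"
    using bigomega_eventually_ge[of A] A by blast
  obtain cb Cb where Cb: "Cb > 0" "\<And>j. b j \<le> Cb * real (Suc j) powr (- 2 * q)"
    by (rule bigtheta_bounds_everywhere[OF b b_pos]) auto
  define c where "c = 1 / (1 + Cb * 2 powr (2 * q))\<^sup>2"
  have "1 + Cb * 2 powr (2 * q) > 0" using Cb by (intro add_pos_pos) auto
  then have c: "c > 0" by (simp add: c_def)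
  define d where "d = cA / 2 powr (\<beta> + 1) / (2 * exp 1)\<^sup>2"
  have d: "d > 0" using cA by (simp add: d_def)
  have "\<forall>\<^sub>F N in at_top. cutoff q N \<ge> max n0 (nat \<lceil>X\<rceil>)"
    using cutoff_at_top[OF q] unfolding filterlim_at_top by blast
  then have "\<forall>\<^sub>F N in at_top. norm (\<Sum>j. A j / (1 + real N * b j)\<^sup>2)
      \<ge> (c * d / 2 powr \<beta>) * norm (real N powr (- \<beta> / (2 * q)) * (S (real (cutoff q N)))\<^sup>2)"
    using eventually_ge_at_top[of 1]
  proof eventually_elim
    case (elim N)
    define m where "m = cutoff q N"
    have N1: "N \<ge> 1" using elim by simp
    note m = cutoff_bounds[OF q N1 m_def]
    have mX: "X \<le> real m" "n0 \<le> m" using elim(1) unfolding m_def[symmetric] by linarith+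
    have "c * real m * (d * real m powr (- \<beta> - 1) * (S (real m))\<^sup>2) \<le> (\<Sum>j. A j / (1 + real N * b j)\<^sup>2)"
      unfolding c_def
    proof (rule window_sum_ge[OF Cb N1 m_def order_refl A(1) A_sum])
      fix j assume j: "j \<in> {m..<2*m}"
      define x where "x = real (Suc j)"
      have x: "real m \<le> x" "x \<le> 2 * real m" "0 < real m" using j m(1) by (auto simp: x_def)
      have "S (real m) \<le> exp 1 * (x / real m) powr 1 * S x"
        using mX x by (intro X) auto
      also have "\<dots> \<le> exp 1 * 2 * S x"
        using x X(2)[of x] mX by (intro mult_right_mono mult_left_mono) (auto simp: field_simps)
      finally have "(S (real m))\<^sup>2 \<le> (2 * exp 1 * S x)\<^sup>2"
        using X(2)[OF mX(1)] by (intro power_mono) (auto simp: mult_ac)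
      then have S2: "(S (real m))\<^sup>2 / (2 * exp 1)\<^sup>2 \<le> (S x)\<^sup>2"
        by (simp add: power_mult_distrib field_simps)
      have p2: "real m powr (- \<beta> - 1) / 2 powr (\<beta> + 1) \<le> x powr (- \<beta> - 1)"
        using powr_within_factor_2(2)[OF x(3,1,2), of "- \<beta> - 1"] \<beta> by (simp add: field_simps)
      have "d * real m powr (- \<beta> - 1) * (S (real m))\<^sup>2
          = cA * ((real m powr (- \<beta> - 1) / 2 powr (\<beta> + 1)) * ((S (real m))\<^sup>2 / (2 * exp 1)\<^sup>2))"
        by (simp add: d_def)
      also have "\<dots> \<le> cA * (x powr (- \<beta> - 1) * (S x)\<^sup>2)"
        using cA(1) S2 p2 by (intro mult_left_mono mult_mono) auto
      also have "\<dots> \<le> A j" using cA(2)[of j] j mX by (simp add: x_def)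
      finally show "d * real m powr (- \<beta> - 1) * (S (real m))\<^sup>2 \<le> A j" .
    qed (use d in auto)
    moreover have "c * real m * (d * real m powr (- \<beta> - 1) * (S (real m))\<^sup>2) = c * d * (S (real m))\<^sup>2 * real m powr (- \<beta>)"
      using m(1) by (simp add: powr_diff)
    moreover have "c * d * (S (real m))\<^sup>2 * (real N powr (- \<beta> / (2 * q)) / 2 powr \<beta>) \<le> c * d * (S (real m))\<^sup>2 * real m powr (- \<beta>)"
      using m(5)[of "- \<beta>"] \<beta> c d by (intro mult_left_mono) (auto simp: field_simps)
    moreover have "(c * d / 2 powr \<beta>) * (real N powr (- \<beta> / (2 * q)) * (S (real m))\<^sup>2)
        = c * d * (S (real m))\<^sup>2 * (real N powr (- \<beta> / (2 * q)) / 2 powr \<beta>)"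
      by simp
    ultimately have "(c * d / 2 powr \<beta>) * (real N powr (- \<beta> / (2 * q)) * (S (real m))\<^sup>2) \<le> (\<Sum>j. A j / (1 + real N * b j)\<^sup>2)"
      by linarith
    then show ?case unfolding m_def[symmetric] by simp
  qed
  then show ?thesis
    using c d by (intro landau_omega.bigI[where c = "c * d / 2 powr \<beta>"]) auto
qed

text \<open>
  The three regimes have different witnesses: the window at the cutoff, all indices below the cutoff, and
  a single index.
\<close>

lemma spread_sum_bigomega:
  assumes \<tau>: "\<tau> > 1" and B: "\<And>j. B j \<ge> 0" "B \<in> \<Theta>(\<lambda>j. real (Suc j) powr (- \<tau>))"
  shows "(\<lambda>N. \<Sum>j. B j / (1 + real N * b j)) \<in> \<Omega>(spectral_rate q \<tau>)"
proof -
  obtain cb Cb where Cb: "Cb > 0" "\<And>j. b j \<le> Cb * real (Suc j) powr (- 2 * q)"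
    by (rule bigtheta_bounds_everywhere[OF b b_pos]) auto
  have "B \<in> \<Omega>(\<lambda>j. real (Suc j) powr (- \<tau>))" using B(2) by blast
  then obtain cB n0 where cB: "cB > 0" "\<And>j. j \<ge> n0 \<Longrightarrow> cB * \<bar>real (Suc j) powr (- \<tau>)\<bar> \<le> B j"
    using bigomega_eventually_ge[of B] B(1) by blast
  have "B \<in> O(\<lambda>j. real (Suc j) powr (- (\<tau> - 1) - 1))" using B(2) by auto
  then have B_sum: "summable B"
    by (rule summable_of_bigo_powr) (use \<tau> in simp)
  have nonneg: "0 \<le> B j / (1 + real N * b j)" for j N
    using B(1)[of j] b_pos[of j] by simp
  have sm: "summable (\<lambda>j. B j / (1 + real N * b j))" for N
    using summable_filtered[OF B(1) B_sum b_pos, where N = N and k = 1] by simp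
  have fin: "(\<Sum>j\<in>F. B j / (1 + real N * b j)) \<le> (\<Sum>j. B j / (1 + real N * b j))" if "finite F" for F N
    using that nonneg by (intro sum_le_suminf sm) auto
  consider "\<tau> < 2 * q + 1" | "\<tau> = 2 * q + 1" | "\<tau> > 2 * q + 1" by linarith
  then have "\<exists>c>0. \<forall>\<^sub>F N in at_top. c * spectral_rate q \<tau> N \<le> (\<Sum>j. B j / (1 + real N * b j))"
  proof cases
    case 1
    define c where "c = 1 / (1 + Cb * 2 powr (2 * q))\<^sup>2"
    have "1 + Cb * 2 powr (2 * q) > 0" using Cb by (intro add_pos_pos) auto
    then have c: "c > 0" by (simp add: c_def)
    have "\<forall>\<^sub>F N in at_top. cutoff q N \<ge> n0"
      using cutoff_at_top[OF q] unfolding filterlim_at_top by blast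
    then have "\<forall>\<^sub>F N in at_top. c * cB / 2 powr \<tau> / 2 powr \<bar>1 - \<tau>\<bar> * spectral_rate q \<tau> N \<le> (\<Sum>j. B j / (1 + real N * b j))"
      using eventually_ge_at_top[of 1]
    proof eventually_elim
      case (elim N)
      define m where "m = cutoff q N"
      have N1: "N \<ge> 1" using elim by simp
      note m = cutoff_bounds[OF q N1 m_def]
      have n0: "n0 \<le> m" using elim(1) unfolding m_def .
      have "c * real m * (cB / 2 powr \<tau> * real m powr (- \<tau>)) \<le> (\<Sum>j. B j / (1 + real N * b j) ^ 1)"
        unfolding c_def
      proof (rule window_sum_ge[OF Cb N1 m_def _ B(1) B_sum])
        fix j assume j: "j \<in> {m..<2*m}"
        have "real m powr (- \<tau>) \<le> 2 powr \<bar>- \<tau>\<bar> * real (Suc j) powr (- \<tau>)"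
          using j m(1) by (intro powr_within_factor_2) auto
        then have "cB / 2 powr \<tau> * real m powr (- \<tau>) \<le> cB * real (Suc j) powr (- \<tau>)"
          using cB(1) \<tau> by (simp add: field_simps)
        also have "\<dots> \<le> B j" using cB(2)[of j] j n0 by simp
        finally show "cB / 2 powr \<tau> * real m powr (- \<tau>) \<le> B j" .
      qed (use cB in auto)
      moreover have "real N powr ((1 - \<tau>) / (2 * q)) / 2 powr \<bar>1 - \<tau>\<bar> \<le> real m * real m powr (- \<tau>)"
        using m(5)[of "1 - \<tau>"] m(1) by (simp add: powr_diff powr_minus field_simps)
      then have "c * cB / 2 powr \<tau> * (real N powr ((1 - \<tau>) / (2 * q)) / 2 powr \<bar>1 - \<tau>\<bar>) \<le> c * cB / 2 powr \<tau> * (real m * real m powr (- \<tau>))"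
        using c cB by (intro mult_left_mono) auto
      ultimately show ?case using 1 by (simp add: spectral_rate_def mult_ac)
    qed
    then show ?thesis using c cB by (intro exI[of _ "c * cB / 2 powr \<tau> / 2 powr \<bar>1 - \<tau>\<bar>"]) simp
  next
    case 2
    define D where "D = 1 + Cb"
    have D: "D > 0" using Cb by (simp add: D_def)
    define H where "H = (harm n0 :: real) + ln 2"
    have lb: "cB / D * (ln (real N) / (2 * q) - H) / real N \<le> (\<Sum>j. B j / (1 + real N * b j))" if N: "N \<ge> 1" for N
    proof -
      define m where "m = cutoff q N"
      note m = cutoff_bounds[OF q N m_def]
      have term_ge: "cB / D / real N * inverse (real (Suc j)) \<le> B j / (1 + real N * b j)" if j: "j \<in> {n0..<m}" for j
      proof -
        have "real (Suc j) powr (2 * q) \<le> real m powr (2 * q)"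
          using j q by (intro powr_mono2) auto
        then have ge1: "1 \<le> real N * real (Suc j) powr (- 2 * q)"
          using m(2) by (simp add: powr_minus field_simps)
        have "1 + real N * b j \<le> real N * real (Suc j) powr (- 2 * q) + real N * (Cb * real (Suc j) powr (- 2 * q))"
          using ge1 Cb(2)[of j] by (intro add_mono mult_left_mono) auto
        also have "\<dots> = D * real N * real (Suc j) powr (- 2 * q)" by (simp add: D_def algebra_simps)
        finally have den: "1 + real N * b j \<le> D * real N * real (Suc j) powr (- 2 * q)" .
        have "cB / D / real N * inverse (real (Suc j)) = (cB * real (Suc j) powr (- \<tau>)) / (D * real N * real (Suc j) powr (- 2 * q))"
        proof -
          have "real (Suc j) powr (- \<tau>) = real (Suc j) powr (- 2 * q) * inverse (real (Suc j))"
            using 2 by (simp add: powr_diff divide_inverse powr_minus)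
          moreover have "real (Suc j) powr (- 2 * q) \<noteq> 0" by simp
          ultimately show ?thesis using D N by (simp only: divide_inverse inverse_mult_distrib) (simp del: of_nat_Suc)
        qed
        also have "\<dots> \<le> B j / (1 + real N * b j)"
          using den cB(2)[of j] j B(1)[of j] b_pos[of j] by (intro frac_le) (auto intro: add_pos_nonneg)
        finally show ?thesis .
      qed
      have "ln (real N) \<le> ln (2 powr (2 * q) * real m powr (2 * q))"
        using m(3) N by (intro ln_mono) auto
      also have "\<dots> = 2 * q * (ln 2 + ln (real m))"
        using m(1) by (simp add: ln_mult ln_powr algebra_simps)
      finally have "ln (real N) / (2 * q) \<le> ln 2 + ln (real m)"
        using q by (simp add: field_simps)
      moreover have "ln (real m) \<le> harm m"
        using euler_mascheroni_sequence_nonneg[of m] m(1) by simp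
      moreover have "harm m \<le> harm n0 + (\<Sum>j=n0..<m. inverse (real (Suc j)))"
      proof -
        have harm_eq: "harm k = (\<Sum>j<k. inverse (real (Suc j)))" for k
          unfolding harm_def by (simp add: sum.atLeast1_atMost_eq)
        have "(\<Sum>j<m. inverse (real (Suc j))) \<le> (\<Sum>j\<in>{..<n0} \<union> {n0..<m}. inverse (real (Suc j)))"
          by (intro sum_mono2) auto
        also have "\<dots> = (\<Sum>j<n0. inverse (real (Suc j))) + (\<Sum>j=n0..<m. inverse (real (Suc j)))"
          by (subst sum.union_disjoint) auto
        finally show ?thesis unfolding harm_eq .
      qed
      ultimately have "ln (real N) / (2 * q) - H \<le> (\<Sum>j=n0..<m. inverse (real (Suc j)))"
        unfolding H_def by linarith
      then have "cB / D / real N * (ln (real N) / (2 * q) - H) \<le> cB / D / real N * (\<Sum>j=n0..<m. inverse (real (Suc j)))"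
        using cB D by (intro mult_left_mono) auto
      also have "\<dots> \<le> (\<Sum>j=n0..<m. B j / (1 + real N * b j))"
        unfolding sum_distrib_left by (intro sum_mono term_ge)
      also have "\<dots> \<le> (\<Sum>j. B j / (1 + real N * b j))" by (intro fin) simp
      finally show ?thesis by simp
    qed
    have "\<forall>\<^sub>F N in at_top. ln (real N) \<ge> 4 * q * H"
      using filterlim_compose[OF ln_at_top filterlim_real_sequentially] unfolding filterlim_at_top by blast
    then have "\<forall>\<^sub>F N in at_top. cB / D / (4 * q) * spectral_rate q \<tau> N \<le> (\<Sum>j. B j / (1 + real N * b j))"
      using eventually_ge_at_top[of 1]
    proof eventually_elim
      case (elim N)
      have "ln (real N) / (4 * q) \<le> ln (real N) / (2 * q) - H"
        using elim(1) q by (simp add: field_simps)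
      then have "cB / D * (ln (real N) / (4 * q)) / real N \<le> cB / D * (ln (real N) / (2 * q) - H) / real N"
        using cB D by (intro divide_right_mono mult_left_mono) auto
      also note lb[OF elim(2)]
      finally show ?case using 2 elim(2) by (simp add: spectral_rate_def powr_minus_divide)
    qed
    then show ?thesis using cB D q by (intro exI[of _ "cB / D / (4 * q)"]) simp
  next
    case 3
    \<comment> \<open>From \<open>n0\<close> on the lower bound for \<open>B\<close> holds, so that \<open>B n0\<close> is positive.\<close>
    define d where "d = B n0 / (1 + b n0)"
    have "0 < cB * \<bar>real (Suc n0) powr (- \<tau>)\<bar>" using cB by simp
    then have Bn0: "B n0 > 0" using cB(2)[of n0] by linarith
    then have d: "d > 0" using b_pos[of n0] by (simp add: d_def add_pos_pos)
    have "d * spectral_rate q \<tau> N \<le> (\<Sum>j. B j / (1 + real N * b j))" if N: "N \<ge> 1" for N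
    proof -
      have "d * spectral_rate q \<tau> N = B n0 / (real N * (1 + b n0))"
        using 3 N by (simp add: d_def spectral_rate_def powr_minus_divide)
      also have "\<dots> \<le> B n0 / (1 + real N * b n0)"
        using Bn0 b_pos[of n0] N by (intro divide_left_mono) (auto simp: algebra_simps intro!: mult_pos_pos add_pos_nonneg)
      also have "\<dots> \<le> (\<Sum>j. B j / (1 + real N * b j))"
        using fin[of "{n0}" N] by simp
      finally show ?thesis .
    qed
    then have "\<forall>\<^sub>F N in at_top. d * spectral_rate q \<tau> N \<le> (\<Sum>j. B j / (1 + real N * b j))"
      by (rule eventually_at_top_linorderI)
    then show ?thesis using d by blast
  qed
  then obtain c where c: "c > 0" "\<forall>\<^sub>F N in at_top. c * spectral_rate q \<tau> N \<le> (\<Sum>j. B j / (1 + real N * b j))"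
    by blast
  have "\<forall>\<^sub>F N in at_top. norm (\<Sum>j. B j / (1 + real N * b j)) \<ge> c * norm (spectral_rate q \<tau> N)"
    using c(2) eventually_ge_at_top[of 1]
  proof eventually_elim
    case (elim N)
    then have "0 \<le> spectral_rate q \<tau> N" by (auto simp: spectral_rate_def)
    then show ?case using elim by simp
  qed
  then show ?thesis using c(1) by (intro landau_omega.bigI)
qed

end

section \<open>Fourth moments of the training distribution\<close>

context prob_space
begin

lemma integrable_lower_power:
  fixes X :: "'a \<Rightarrow> real"
  assumes [measurable]: "X \<in> borel_measurable M" and "integrable M (\<lambda>x. X x ^ m)" "k \<le> m" "even m"
  shows "integrable M (\<lambda>x. X x ^ k)"
proof (rule Bochner_Integration.integrable_bound)
  show "integrable M (\<lambda>x. 1 + X x ^ m)" using assms by simp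
  have "\<bar>y ^ k\<bar> \<le> \<bar>1 + y ^ m\<bar>" for y :: real
  proof -
    have "\<bar>y\<bar> ^ k \<le> 1 + \<bar>y\<bar> ^ m"
    proof (cases "\<bar>y\<bar> \<le> 1")
      case True
      then have "\<bar>y\<bar> ^ k \<le> 1" by (simp add: power_le_one)
      then show ?thesis by (simp add: add_increasing2)
    next
      case False
      then have "\<bar>y\<bar> ^ k \<le> \<bar>y\<bar> ^ m" using assms by (intro power_increasing) auto
      then show ?thesis by simp
    qed
    then show ?thesis using assms(4) by (simp add: power_abs power_even_abs)
  qed
  then show "AE x in M. norm (X x ^ k) \<le> norm (1 + X x ^ m)" by simp
qed simp

lemma second_moment_weighted_sum:
  fixes X :: "'i \<Rightarrow> 'a \<Rightarrow> real"
  assumes "finite I" and ind: "indep_vars (\<lambda>_. borel) X I"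
    and int: "\<And>i. i \<in> I \<Longrightarrow> integrable M (X i)" "\<And>i. i \<in> I \<Longrightarrow> integrable M (\<lambda>x. (X i x)\<^sup>2)"
    and mean: "\<And>i. i \<in> I \<Longrightarrow> expectation (X i) = 0"
    and var: "\<And>i. i \<in> I \<Longrightarrow> expectation (\<lambda>x. (X i x)\<^sup>2) = 1"
  shows "integrable M (\<lambda>x. (\<Sum>i\<in>I. c i * X i x)\<^sup>2)
    \<and> expectation (\<lambda>x. (\<Sum>i\<in>I. c i * X i x)\<^sup>2) = (\<Sum>i\<in>I. (c i)\<^sup>2)"
  using assms
proof (induction I)
  case empty
  then show ?case by simp
next
  case (insert i I)
  define Z where "Z x = c i * X i x" for x
  define T where "T x = (\<Sum>i\<in>I. c i * X i x)" for x
  have "indep_vars (\<lambda>_. borel) (\<lambda>k x. c k * X k x) (insert i I)"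
    by (rule indep_vars_compose2[OF insert.prems(1)]) simp
  from indep_vars_sum[OF insert.hyps this] have ZT: "indep_var borel Z borel T"
    by (simp add: Z_def[abs_def] T_def[abs_def])
  have intT: "integrable M T" "expectation T = 0"
    unfolding T_def using insert.prems by (auto simp: Bochner_Integration.integral_sum)
  have intZ: "integrable M Z" "integrable M (\<lambda>x. (Z x)\<^sup>2)" "expectation (\<lambda>x. (Z x)\<^sup>2) = (c i)\<^sup>2"
    unfolding Z_def power_mult_distrib using insert.prems by auto
  have IH: "integrable M (\<lambda>x. (T x)\<^sup>2)" "expectation (\<lambda>x. (T x)\<^sup>2) = (\<Sum>i\<in>I. (c i)\<^sup>2)"
    unfolding T_def using insert.IH[OF indep_vars_subset[OF insert.prems(1)]] insert.prems by auto
  have prod: "integrable M (\<lambda>x. Z x * T x)" "expectation (\<lambda>x. Z x * T x) = 0"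
    using indep_var_integrable[OF ZT intZ(1) intT(1)] indep_var_lebesgue_integral[OF ZT intZ(1) intT(1)] intT(2)
    by auto
  have eq: "(\<Sum>i\<in>insert i I. c i * X i x)\<^sup>2 = (Z x)\<^sup>2 + 2 * (Z x * T x) + (T x)\<^sup>2" for x
    using insert.hyps by (simp add: Z_def T_def power2_sum algebra_simps)
  show ?case unfolding eq using intZ IH prod insert.hyps by simp
qed

text \<open>
  In the expansion of \<open>(Z + T) ^ 4\<close> for independent centered \<open>Z\<close> and \<open>T\<close> the odd mixed terms vanish, and the term
  \<open>6 E[Z\<^sup>2] E[T\<^sup>2]\<close> fits into the square of the total variance times \<open>K\<close> as soon as \<open>2 * K \<ge> 6\<close>.  This
  is where \<open>3 \<le> K\<close>, the kurtosis of a Gaussian, comes from.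
\<close>

lemma fourth_moment_weighted_sum:
  fixes X :: "'i \<Rightarrow> 'a \<Rightarrow> real"
  assumes "finite I" and ind: "indep_vars (\<lambda>_. borel) X I"
    and int: "\<And>i. i \<in> I \<Longrightarrow> integrable M (\<lambda>x. (X i x) ^ 4)"
    and mean: "\<And>i. i \<in> I \<Longrightarrow> expectation (X i) = 0"
    and var: "\<And>i. i \<in> I \<Longrightarrow> expectation (\<lambda>x. (X i x)\<^sup>2) = 1"
    and kurt: "\<And>i. i \<in> I \<Longrightarrow> expectation (\<lambda>x. (X i x) ^ 4) \<le> K" and K: "K \<ge> 3"
  shows "integrable M (\<lambda>x. (\<Sum>i\<in>I. c i * X i x) ^ 4)
    \<and> expectation (\<lambda>x. (\<Sum>i\<in>I. c i * X i x) ^ 4) \<le> K * (\<Sum>i\<in>I. (c i)\<^sup>2)\<^sup>2"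
  using assms(1-6)
proof (induction I)
  case empty
  then show ?case using K by simp
next
  case (insert i I)
  define Z where "Z x = c i * X i x" for x
  define T where "T x = (\<Sum>i\<in>I. c i * X i x)" for x
  define V where "V = (\<Sum>i\<in>I. (c i)\<^sup>2)"
  have rv: "random_variable borel (X k)" if "k \<in> insert i I" for k
    using insert.prems(1) that unfolding indep_vars_def by blast
  have low: "integrable M (\<lambda>x. (X k x) ^ r)" if "k \<in> insert i I" "r \<le> 4" for k r
    by (rule integrable_lower_power[OF rv[OF that(1)] insert.prems(2)[OF that(1)] that(2)]) simp
  have low1: "integrable M (X k)" if "k \<in> insert i I" for k
    using low[OF that, of 1] by simp
  have "indep_vars (\<lambda>_. borel) (\<lambda>k x. c k * X k x) (insert i I)"
    by (rule indep_vars_compose2[OF insert.prems(1)]) simp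
  from indep_vars_sum[OF insert.hyps this] have ZT: "indep_var borel Z borel T"
    by (simp add: Z_def[abs_def] T_def[abs_def])
  have [measurable]: "Z \<in> borel_measurable M" "T \<in> borel_measurable M"
    using rv by (auto simp: Z_def[abs_def] T_def[abs_def])
  have meanT: "expectation T = 0"
    unfolding T_def using insert.prems low1 by (auto simp: Bochner_Integration.integral_sum)
  have meanZ: "expectation Z = 0"
    unfolding Z_def using insert.prems by auto
  have sub: "indep_vars (\<lambda>_. borel) X I"
    using indep_vars_subset[OF insert.prems(1)] by auto
  have IH: "integrable M (\<lambda>x. (T x) ^ 4)" "expectation (\<lambda>x. (T x) ^ 4) \<le> K * V\<^sup>2"
    unfolding T_def V_def using insert.IH[OF sub] insert.prems by auto
  have T2: "expectation (\<lambda>x. (T x)\<^sup>2) = V"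
    unfolding T_def V_def
    by (rule second_moment_weighted_sum[THEN conjunct2, OF insert.hyps(1) sub])
      (use insert.prems low low1 in auto)
  have Z4: "integrable M (\<lambda>x. (Z x) ^ 4)" "expectation (\<lambda>x. (Z x) ^ 4) \<le> K * (c i) ^ 4"
    unfolding Z_def power_mult_distrib using insert.prems mult_left_mono[of "expectation (\<lambda>x. (X i x) ^ 4)" K "(c i) ^ 4"]
    by (auto simp: mult.commute)
  have Z2: "expectation (\<lambda>x. (Z x)\<^sup>2) = (c i)\<^sup>2"
    unfolding Z_def power_mult_distrib using insert.prems by auto
  have powT: "integrable M (\<lambda>x. (T x) ^ r)" and powZ: "integrable M (\<lambda>x. (Z x) ^ r)" if "r \<le> 4" for r
    using IH Z4 that by (auto intro!: integrable_lower_power[where m = 4])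
  have prod: "integrable M (\<lambda>x. Z x ^ a * T x ^ b)"
    "expectation (\<lambda>x. Z x ^ a * T x ^ b) = expectation (\<lambda>x. Z x ^ a) * expectation (\<lambda>x. T x ^ b)"
    if "a \<le> 4" "b \<le> 4" for a b
  proof -
    have "indep_var borel ((\<lambda>y. y ^ a) \<circ> Z) borel ((\<lambda>y. y ^ b) \<circ> T)"
      by (rule indep_var_compose[OF ZT]) auto
    then have i: "indep_var borel (\<lambda>x. Z x ^ a) borel (\<lambda>x. T x ^ b)" by (simp add: comp_def)
    show "integrable M (\<lambda>x. Z x ^ a * T x ^ b)"
      "expectation (\<lambda>x. Z x ^ a * T x ^ b) = expectation (\<lambda>x. Z x ^ a) * expectation (\<lambda>x. T x ^ b)"
      using indep_var_integrable[OF i powZ powT] indep_var_lebesgue_integral[OF i powZ powT] that by auto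
  qed
  have eq: "(\<Sum>i\<in>insert i I. c i * X i x) ^ 4
      = Z x ^ 4 + 4 * (Z x ^ 3 * T x ^ 1) + 6 * (Z x ^ 2 * T x ^ 2) + 4 * (Z x ^ 1 * T x ^ 3) + T x ^ 4" for x
    using insert.hyps by (simp add: Z_def T_def power4_eq_xxxx power3_eq_cube power2_eq_square algebra_simps)
  have "integrable M (\<lambda>x. (\<Sum>i\<in>insert i I. c i * X i x) ^ 4)"
    unfolding eq by (intro Bochner_Integration.integrable_add integrable_mult_right prod Z4 IH) auto
  moreover have "expectation (\<lambda>x. (\<Sum>i\<in>insert i I. c i * X i x) ^ 4)
      = expectation (\<lambda>x. Z x ^ 4) + 6 * ((c i)\<^sup>2 * V) + expectation (\<lambda>x. T x ^ 4)"
    unfolding eq using prod[of 3 1] prod[of 2 2] prod[of 1 3] Z4(1) IH(1) meanT meanZ T2 Z2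
    by simp
  moreover have "\<dots> \<le> K * (c i) ^ 4 + 2 * K * ((c i)\<^sup>2 * V) + K * V\<^sup>2"
  proof -
    have "V \<ge> 0" unfolding V_def by (simp add: sum_nonneg)
    then have "6 * ((c i)\<^sup>2 * V) \<le> 2 * K * ((c i)\<^sup>2 * V)"
      using K by (intro mult_right_mono) auto
    then show ?thesis using Z4(2) IH(2) by linarith
  qed
  moreover have "\<dots> = K * (\<Sum>i\<in>insert i I. (c i)\<^sup>2)\<^sup>2"
  proof -
    have "(\<Sum>i\<in>insert i I. (c i)\<^sup>2) = (c i)\<^sup>2 + V" using insert.hyps by (simp add: V_def)
    then show ?thesis by (simp only:) (simp add: power2_eq_square power4_eq_xxxx algebra_simps)
  qed
  ultimately show ?case by simp
qed

end

text \<open>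
  Split \<open>h\<close> into its projection \<open>P\<close> onto the span of the first \<open>n\<close> eigenvectors and the rest.  The span is
  invariant under \<open>\<Lambda>\<close>, so the form splits accordingly, and the part of \<open>h - P\<close> is nonnegative.
\<close>

lemma eigen_coefficients_le_quadratic_form:
  fixes \<Lambda> :: "'h::real_inner \<Rightarrow> 'h"
  assumes lin: "bounded_linear \<Lambda>" and sym: "\<And>h k. inner h (\<Lambda> k) = inner k (\<Lambda> h)"
    and nonneg: "\<And>h. inner h (\<Lambda> h) \<ge> 0"
    and ortho: "\<And>i k. inner (\<psi> i) (\<psi> k) = (if i = k then 1 else 0 :: real)"
    and eig: "\<And>k. \<Lambda> (\<psi> k) = \<mu> k *\<^sub>R \<psi> k"
  shows "(\<Sum>k<n::nat. \<mu> k * (inner h (\<psi> k))\<^sup>2) \<le> inner h (\<Lambda> h)"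
proof -
  interpret bounded_linear \<Lambda> by fact
  define P where "P = (\<Sum>k<n. inner h (\<psi> k) *\<^sub>R \<psi> k)"
  have \<Lambda>P: "\<Lambda> P = (\<Sum>k<n. (inner h (\<psi> k) * \<mu> k) *\<^sub>R \<psi> k)"
    by (simp add: P_def sum scaleR eig)
  have P_psi: "inner P (\<psi> k) = inner h (\<psi> k)" if "k < n" for k
    using that by (simp add: P_def inner_sum_left ortho if_distrib cong: if_cong)
  have form: "inner g (\<Lambda> P) = (\<Sum>k<n. inner h (\<psi> k) * \<mu> k * inner g (\<psi> k))" for g
    by (simp add: \<Lambda>P inner_sum_right)
  have "inner (h - P) (\<Lambda> (h - P)) = inner h (\<Lambda> h) - inner P (\<Lambda> h) - inner h (\<Lambda> P) + inner P (\<Lambda> P)"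
    by (simp add: diff inner_diff_left inner_diff_right)
  also have "inner P (\<Lambda> h) = inner h (\<Lambda> P)" by (rule sym)
  also have "inner P (\<Lambda> P) = inner h (\<Lambda> P)"
    unfolding form using P_psi by (intro sum.cong) auto
  finally have "inner h (\<Lambda> P) \<le> inner h (\<Lambda> h)" using nonneg[of "h - P"] by simp
  then show ?thesis unfolding form by (simp add: power2_eq_square mult_ac)
qed

text \<open>
  Along the Karhunen--Loeve expansion \<open>inner h x\<close> is a limit of weighted sums of the independent
  coefficients, whose fourth moments are controlled by their variances; Fatou's lemma passes to
  the limit.  The constant is the same for all directions \<open>h\<close>, which is what makes the later estimates uniform in \<open>j\<close>.
\<close>

lemma fourth_moment_bound:
  fixes \<nu> :: "'h::{real_inner, second_countable_topology} measure"
  assumes "borel_prob \<nu>" and cov: "has_covariance \<nu> \<Lambda>" and KL: "KL_moment \<nu> \<Lambda>"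
  obtains K where "K \<ge> 3" "\<And>h. integrable \<nu> (\<lambda>x. (inner h x) ^ 4)"
    "\<And>h. (\<integral>x. (inner h x) ^ 4 \<partial>\<nu>) \<le> K * (inner h (\<Lambda> h))\<^sup>2"
proof -
  interpret prob_space \<nu> using assms by (simp add: borel_prob_def)
  have sets [measurable_cong]: "sets \<nu> = sets borel" using assms by (simp add: borel_prob_def)
  obtain \<psi> lam \<zeta> where ortho: "orthonormal_basis \<psi>"
    and eig: "\<And>k. \<Lambda> (\<psi> k) = (lam k)\<^sup>2 *\<^sub>R \<psi> k"
    and KL_sum: "AE x in \<nu>. (\<lambda>k. (lam k * \<zeta> k x) *\<^sub>R \<psi> k) sums x"
    and ind: "indep_vars (\<lambda>_. borel) \<zeta> UNIV"
    and mean: "\<And>k. expectation (\<zeta> k) = 0"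
    and var: "\<And>k. expectation (\<lambda>x. (\<zeta> k x)\<^sup>2) = 1"
    and four: "\<And>k. integrable \<nu> (\<lambda>x. (\<zeta> k x) ^ 4)"
    and kurt: "(\<lambda>k. expectation (\<lambda>x. (\<zeta> k x) ^ 4)) \<in> O(\<lambda>_. 1)"
    using KL unfolding KL_moment_def by blast
  obtain C where C: "\<And>k. \<bar>expectation (\<lambda>x. (\<zeta> k x) ^ 4)\<bar> \<le> C * 1"
    using bigo_bound_everywhere[OF kurt] by auto
  define K where "K = max 3 C"
  have K: "K \<ge> 3" "expectation (\<lambda>x. (\<zeta> k x) ^ 4) \<le> K" for k
    using C[of k] by (auto simp: K_def)
  have rv [measurable]: "\<zeta> k \<in> borel_measurable \<nu>" for k
    using ind by (auto simp: indep_vars_def)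
  have bl: "bounded_linear \<Lambda>" and form: "\<And>h k. inner h (\<Lambda> k) = (\<integral>x. inner h x * inner k x \<partial>\<nu>)"
    using cov by (auto simp: has_covariance_def)
  have sym: "inner h (\<Lambda> k) = inner k (\<Lambda> h)" for h k by (simp add: form mult.commute)
  have nonneg: "inner h (\<Lambda> h) \<ge> 0" for h by (simp add: form)
  have nn: "(\<integral>\<^sup>+x. ennreal ((inner h x) ^ 4) \<partial>\<nu>) \<le> ennreal (K * (inner h (\<Lambda> h))\<^sup>2)" for h
  proof -
    define c where "c k = lam k * inner h (\<psi> k)" for k
    define T where "T n x = (\<Sum>k<n. c k * \<zeta> k x)" for n x
    have [measurable]: "T n \<in> borel_measurable \<nu>" for n unfolding T_def by measurable
    have "(\<integral>\<^sup>+x. ennreal ((inner h x) ^ 4) \<partial>\<nu>) = (\<integral>\<^sup>+x. liminf (\<lambda>n. ennreal ((T n x) ^ 4)) \<partial>\<nu>)"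
    proof (rule nn_integral_cong_AE, use KL_sum in eventually_elim)
      fix x assume "(\<lambda>k. (lam k * \<zeta> k x) *\<^sub>R \<psi> k) sums x"
      from bounded_linear.sums[OF bounded_linear_inner_right this, of h]
      have "(\<lambda>k. c k * \<zeta> k x) sums inner h x" by (simp add: c_def mult_ac)
      then have "(\<lambda>n. T n x) \<longlonglongrightarrow> inner h x" by (simp add: sums_def T_def)
      then have "(\<lambda>n. ennreal ((T n x) ^ 4)) \<longlonglongrightarrow> ennreal ((inner h x) ^ 4)"
        by (intro tendsto_ennrealI tendsto_power)
      then show "ennreal ((inner h x) ^ 4) = liminf (\<lambda>n. ennreal ((T n x) ^ 4))"
        by (intro lim_imp_Liminf[symmetric]) auto
    qed
    also have "\<dots> \<le> liminf (\<lambda>n. \<integral>\<^sup>+x. ennreal ((T n x) ^ 4) \<partial>\<nu>)"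
      by (rule nn_integral_liminf) measurable
    also have "\<dots> \<le> liminf (\<lambda>n::nat. ennreal (K * (inner h (\<Lambda> h))\<^sup>2))"
    proof (rule Liminf_mono, rule always_eventually, rule allI)
      fix n
      have fm: "integrable \<nu> (\<lambda>x. (T n x) ^ 4) \<and> expectation (\<lambda>x. (T n x) ^ 4) \<le> K * (\<Sum>k<n. (c k)\<^sup>2)\<^sup>2"
        unfolding T_def
        by (rule fourth_moment_weighted_sum[OF _ indep_vars_subset[OF ind]]) (use mean var four K in auto)
      have "(\<Sum>k<n. (c k)\<^sup>2) \<le> inner h (\<Lambda> h)"
        using eigen_coefficients_le_quadratic_form[OF bl sym nonneg _ eig, where n = n and h = h] ortho
        by (simp add: c_def power_mult_distrib orthonormal_basis_def)
      then have "(\<Sum>k<n. (c k)\<^sup>2)\<^sup>2 \<le> (inner h (\<Lambda> h))\<^sup>2"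
        by (intro power_mono) (auto simp: sum_nonneg)
      then have "expectation (\<lambda>x. (T n x) ^ 4) \<le> K * (inner h (\<Lambda> h))\<^sup>2"
        using fm K(1) by (elim conjE order_trans) (intro mult_left_mono, auto)
      then show "(\<integral>\<^sup>+x. ennreal ((T n x) ^ 4) \<partial>\<nu>) \<le> ennreal (K * (inner h (\<Lambda> h))\<^sup>2)"
        using fm by (subst nn_integral_eq_integral) (auto intro: ennreal_leI)
    qed
    finally show ?thesis by (simp add: Liminf_const)
  qed
  have int: "integrable \<nu> (\<lambda>x. (inner h x) ^ 4)" for h
    using nn[of h] by (intro integrableI_bounded) (auto simp: le_less_trans)
  have "(\<integral>x. (inner h x) ^ 4 \<partial>\<nu>) \<le> K * (inner h (\<Lambda> h))\<^sup>2" for h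
    using nn[of h] K(1) int[of h] by (subst (asm) nn_integral_eq_integral) (auto simp: ennreal_le_iff)
  with that K(1) int show ?thesis by blast
qed

section \<open>Moments of the shrinkage factor\<close>

lemma (in prob_space)
  fixes f :: "'a \<Rightarrow> real"
  assumes f: "integrable M f" and N: "N \<ge> 1"
  shows integrable_empirical_mean: "integrable (PiM {1..N} (\<lambda>_. M)) (\<lambda>X. 1 / real N * (\<Sum>n=1..N. f (X n)))"
    and integral_empirical_mean: "(\<integral>X. 1 / real N * (\<Sum>n=1..N. f (X n)) \<partial>PiM {1..N} (\<lambda>_. M)) = expectation f"
proof -
  have [measurable]: "f \<in> borel_measurable M" using f by simp
  have comp: "distr (PiM {1..N} (\<lambda>_. M)) M (\<lambda>X. X n) = M" if "n \<in> {1..N}" for n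
    using distr_PiM_component[of "{1..N}" "\<lambda>_. M" n] that prob_space_axioms by simp
  have int: "integrable (PiM {1..N} (\<lambda>_. M)) (\<lambda>X. f (X n))" if "n \<in> {1..N}" for n
    using f that by (subst integrable_distr_eq[symmetric, of "\<lambda>X. X n" _ M f]) (auto simp: comp simp del: One_nat_def)
  have eq: "(\<integral>X. f (X n) \<partial>PiM {1..N} (\<lambda>_. M)) = expectation f" if "n \<in> {1..N}" for n
    using that by (subst integral_distr[symmetric, of "\<lambda>X. X n" _ M f]) (auto simp: comp simp del: One_nat_def)
  show "integrable (PiM {1..N} (\<lambda>_. M)) (\<lambda>X. 1 / real N * (\<Sum>n=1..N. f (X n)))"
    by (intro integrable_mult_right Bochner_Integration.integrable_sum int)
  have "(\<integral>X. 1 / real N * (\<Sum>n=1..N. f (X n)) \<partial>PiM {1..N} (\<lambda>_. M))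
      = 1 / real N * (\<Sum>n=1..N. \<integral>X. f (X n) \<partial>PiM {1..N} (\<lambda>_. M))"
    using int by (subst integral_mult_right_zero, subst Bochner_Integration.integral_sum) auto
  also have "\<dots> = expectation f" using eq N by simp
  finally show "(\<integral>X. 1 / real N * (\<Sum>n=1..N. f (X n)) \<partial>PiM {1..N} (\<lambda>_. M)) = expectation f" .
qed

lemma (in prob_space)
  fixes f :: "'a \<Rightarrow> real"
  assumes f: "f \<in> borel_measurable M" "\<And>x. f x \<ge> 0" and a: "a \<ge> 0"
  shows integrable_shrinkage: "integrable (PiM {1..N} (\<lambda>_. M)) (\<lambda>X. 1 / (1 + a * (1 / real N * (\<Sum>n=1..N. f (X n)))) ^ k)"
proof -
  interpret P: prob_space "PiM {1..N} (\<lambda>_. M)" by (intro prob_space_PiM prob_space_axioms)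
  note f(1)[measurable]
  show ?thesis
  proof (rule P.integrable_const_bound[where B = 1])
    have "norm (1 / (1 + a * (1 / real N * (\<Sum>n=1..N. f (X n)))) ^ k) \<le> 1" for X
    proof -
      have "0 \<le> a * (1 / real N * (\<Sum>n=1..N. f (X n)))" using a f by (simp add: sum_nonneg)
      then have "1 \<le> (1 + a * (1 / real N * (\<Sum>n=1..N. f (X n)))) ^ k" by (intro one_le_power) simp
      then show ?thesis by simp
    qed
    then show "AE X in PiM {1..N} (\<lambda>_. M). norm (1 / (1 + a * (1 / real N * (\<Sum>n=1..N. f (X n)))) ^ k) \<le> 1"
      by simp
  qed measurable
qed

text \<open>
  Jensen's inequality for \<open>x \<mapsto> 1 / (1 + a * x) ^ k\<close>, obtained by integrating the tangent at the mean; that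
  the tangent lies below the function is Bernoulli's inequality.
\<close>

lemma (in prob_space) shrinkage_expectation_ge:
  fixes f :: "'a \<Rightarrow> real"
  assumes f: "integrable M f" "\<And>x. f x \<ge> 0" and a: "a \<ge> 0" and N: "N \<ge> 1"
  shows "1 / (1 + a * expectation f) ^ k
    \<le> (\<integral>X. 1 / (1 + a * (1 / real N * (\<Sum>n=1..N. f (X n)))) ^ k \<partial>PiM {1..N} (\<lambda>_. M))"
proof -
  define P where "P = PiM {1..N} (\<lambda>_. M)"
  define G where "G X = 1 / real N * (\<Sum>n=1..N. f (X n))" for X
  define w where "w = 1 + a * expectation f"
  interpret P: prob_space P unfolding P_def by (intro prob_space_PiM prob_space_axioms)
  have w: "w \<ge> 1" using a f by (simp add: w_def)
  have G: "integrable P G" "P.expectation G = expectation f"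
    using integrable_empirical_mean[OF f(1) N] integral_empirical_mean[OF f(1) N]
    by (simp_all add: P_def G_def[abs_def])
  have tangent: "1 / w ^ k * (1 + real k * (1 - (1 + a * G X) / w)) \<le> 1 / (1 + a * G X) ^ k" for X
  proof -
    define r where "r = (1 + a * G X) / w"
    have "G X \<ge> 0" using f by (simp add: G_def sum_nonneg)
    then have r: "r > 0" using a w by (simp add: r_def add_pos_nonneg)
    have "0 \<le> (r - 1)\<^sup>2" by simp
    then have "1 - r \<le> 1 / r - 1" using r by (simp add: field_simps power2_eq_square)
    then have "1 + real k * (1 - r) \<le> 1 + real k * (1 / r - 1)" by (simp add: mult_left_mono)
    also have "\<dots> \<le> (1 + (1 / r - 1)) ^ k" using r by (intro Bernoulli_inequality) auto
    also have "\<dots> = (1 / r) ^ k" by simp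
    finally have "1 / w ^ k * (1 + real k * (1 - r)) \<le> 1 / w ^ k * (1 / r) ^ k"
      using w by (intro mult_left_mono) auto
    also have "\<dots> = 1 / (1 + a * G X) ^ k" using w by (simp add: r_def power_divide)
    finally show ?thesis unfolding r_def .
  qed
  have "P.expectation (\<lambda>X. 1 / w ^ k * (1 + real k * (1 - (1 + a * G X) / w))) = 1 / w ^ k * (1 + real k * (1 - (1 + a * expectation f) / w))"
    using G by (simp add: P.prob_space)
  also have "\<dots> = 1 / w ^ k" using w by (simp add: w_def[symmetric])
  finally have "1 / w ^ k = P.expectation (\<lambda>X. 1 / w ^ k * (1 + real k * (1 - (1 + a * G X) / w)))" ..
  also have "\<dots> \<le> P.expectation (\<lambda>X. 1 / (1 + a * G X) ^ k)"
  proof (rule integral_mono[OF _ _ tangent])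
    show "integrable P (\<lambda>X. 1 / w ^ k * (1 + real k * (1 - (1 + a * G X) / w)))"
      using G by simp
    show "integrable P (\<lambda>X. 1 / (1 + a * G X) ^ k)"
      unfolding P_def G_def using f a by (intro integrable_shrinkage) auto
  qed
  finally show ?thesis by (simp add: w_def P_def G_def)
qed

text \<open>
  If the empirical mean is at least half the true mean, the integrand is at most the first summand.  Otherwise it is
  at most \<open>1\<close>, and the exponential Markov inequality bounds the probability of this event.  A nonnegative
  variable has a Laplace transform of at most \<open>1 - t E f + t\<^sup>2 E f\<^sup>2 / 2\<close>, so a second moment
  is enough for an exponentially small lower tail.
\<close>

lemma (in prob_space) shrinkage_expectation_le:
  fixes f :: "'a \<Rightarrow> real"
  assumes f: "integrable M f" "integrable M (\<lambda>x. (f x)\<^sup>2)" "\<And>x. f x \<ge> 0"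
    and pos: "expectation f > 0" and K: "K > 0" "expectation (\<lambda>x. (f x)\<^sup>2) \<le> K * (expectation f)\<^sup>2"
    and a: "a \<ge> 0" and N: "N \<ge> 1"
  shows "(\<integral>X. 1 / (1 + a * (1 / real N * (\<Sum>n=1..N. f (X n)))) ^ k \<partial>PiM {1..N} (\<lambda>_. M))
    \<le> 1 / (1 + a * (expectation f / 2)) ^ k + exp (- (real N / (8 * K)))"
proof -
  define P where "P = PiM {1..N} (\<lambda>_. M)"
  define \<theta> where "\<theta> = expectation f"
  \<comment> \<open>This \<open>t\<close> minimises the exponent \<open>- t * \<theta> / 2 + t\<^sup>2 * K * \<theta>\<^sup>2 / 2\<close> of the Chernoff bound per sample.\<close>
  define t where "t = 1 / (2 * K * \<theta>)"
  define G where "G X = 1 / real N * (\<Sum>n=1..N. f (X n))" for X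
  interpret P: prob_space P unfolding P_def by (intro prob_space_PiM prob_space_axioms)
  interpret prod: product_prob_space "\<lambda>_. M" "{1..N}" ..
  have \<theta>: "\<theta> > 0" and t: "t > 0" using pos K by (auto simp: \<theta>_def t_def)
  have [measurable]: "f \<in> borel_measurable M" using f(1) by simp
  have int_exp: "integrable M (\<lambda>x. exp (- (t * f x)))"
    using t f(3) by (intro integrable_const_bound[where B = 1]) auto
  have "expectation (\<lambda>x. exp (- (t * f x))) \<le> expectation (\<lambda>x. 1 - t * f x + t\<^sup>2 / 2 * (f x)\<^sup>2)"
  proof (rule integral_mono[OF int_exp])
    fix x
    have y: "t * f x \<ge> 0" using t f(3)[of x] by simp
    have "exp (- y) \<le> 1 - y + y\<^sup>2 / 2" if "y \<ge> 0" for y :: real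
    proof -
      define D where "D z = 1 - z + z\<^sup>2 / 2 - exp (- z)" for z :: real
      have "D 0 \<le> D y"
      proof (rule DERIV_nonneg_imp_nondecreasing[OF that])
        fix z :: real
        have "DERIV D z :> - 1 + z + exp (- z)"
          unfolding D_def by (auto intro!: derivative_eq_intros)
        moreover have "- 1 + z + exp (- z) \<ge> 0" using exp_ge_add_one_self[of "- z"] by simp
        ultimately show "\<exists>d. DERIV D z :> d \<and> d \<ge> 0" by blast
      qed
      then show ?thesis by (simp add: D_def)
    qed
    from this[OF y] show "exp (- (t * f x)) \<le> 1 - t * f x + t\<^sup>2 / 2 * (f x)\<^sup>2"
      by (simp add: power_mult_distrib)
  qed (use f in auto)
  also have "\<dots> = 1 - t * \<theta> + t\<^sup>2 / 2 * expectation (\<lambda>x. (f x)\<^sup>2)"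
    using f by (simp add: \<theta>_def prob_space)
  also have "\<dots> \<le> 1 - t * \<theta> + t\<^sup>2 / 2 * (K * \<theta>\<^sup>2)"
    using K(2) by (intro add_left_mono mult_left_mono) (auto simp: \<theta>_def)
  also have "\<dots> = 1 + - (3 / (8 * K))"
    using \<theta> K by (simp add: t_def field_simps power2_eq_square)
  also have "\<dots> \<le> exp (- (3 / (8 * K)))" by (rule exp_ge_add_one_self)
  finally have laplace: "expectation (\<lambda>x. exp (- (t * f x))) \<le> exp (- (3 / (8 * K)))" .
  have int_prod: "integrable P (\<lambda>X. \<Prod>n=1..N. exp (- (t * f (X n))))"
    unfolding P_def by (intro prod.product_integrable_prod int_exp) auto
  have "P.expectation (\<lambda>X. \<Prod>n=1..N. exp (- (t * f (X n)))) = (expectation (\<lambda>x. exp (- (t * f x)))) ^ N"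
    unfolding P_def by (subst prod.product_integral_prod) (auto intro: int_exp)
  also have "\<dots> \<le> exp (- (3 / (8 * K))) ^ N"
    by (intro power_mono laplace integral_nonneg) auto
  also have "\<dots> = exp (- (3 * real N / (8 * K)))"
    by (simp add: exp_of_nat_mult[symmetric] mult.commute)
  finally have chernoff: "P.expectation (\<lambda>X. \<Prod>n=1..N. exp (- (t * f (X n)))) \<le> exp (- (3 * real N / (8 * K)))" .
  have split: "1 / (1 + a * G X) ^ k \<le> 1 / (1 + a * (\<theta> / 2)) ^ k + exp (real N / (4 * K)) * (\<Prod>n=1..N. exp (- (t * f (X n))))" for X
  proof -
    have G0: "G X \<ge> 0" using f by (simp add: G_def sum_nonneg)
    have nn: "0 \<le> 1 / (1 + a * (\<theta> / 2)) ^ k" using a \<theta> by simp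
    show ?thesis
    proof (cases "\<theta> / 2 \<le> G X")
      case True
      have "1 / (1 + a * G X) ^ k \<le> 1 / (1 + a * (\<theta> / 2)) ^ k"
        using a \<theta> G0 mult_left_mono[OF True a]
        by (intro divide_left_mono power_mono mult_pos_pos zero_less_power add_pos_nonneg) auto
      moreover have "0 \<le> exp (real N / (4 * K)) * (\<Prod>n=1..N. exp (- (t * f (X n))))"
        by (intro mult_nonneg_nonneg prod_nonneg) auto
      ultimately show ?thesis by linarith
    next
      case False
      have "1 \<le> (1 + a * G X) ^ k" using a G0 by (intro one_le_power) simp
      then have "1 / (1 + a * G X) ^ k \<le> 1" by simp
      also have "1 \<le> exp (real N / (4 * K) - t * (real N * G X))"
      proof -
        have "t * (real N * G X) \<le> t * (real N * (\<theta> / 2))"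
          using False t by (intro mult_left_mono) auto
        also have "\<dots> = real N / (4 * K)" using \<theta> K by (simp add: t_def)
        finally show ?thesis by simp
      qed
      also have "\<dots> = exp (real N / (4 * K)) * (\<Prod>n=1..N. exp (- (t * f (X n))))"
      proof -
        have "real N * G X = (\<Sum>n=1..N. f (X n))" using N by (simp add: G_def)
        then have "- (t * (real N * G X)) = (\<Sum>n=1..N. - (t * f (X n)))"
          by (simp only: sum_negf sum_distrib_left)
        then have "exp (- (t * (real N * G X))) = (\<Prod>n=1..N. exp (- (t * f (X n))))"
          by (simp only: exp_sum finite_atLeastAtMost)
        then show ?thesis by (simp only: diff_conv_add_uminus exp_add)
      qed
      finally show ?thesis using nn by linarith
    qed
  qed
  have "P.expectation (\<lambda>X. 1 / (1 + a * G X) ^ k)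
      \<le> P.expectation (\<lambda>X. 1 / (1 + a * (\<theta> / 2)) ^ k + exp (real N / (4 * K)) * (\<Prod>n=1..N. exp (- (t * f (X n)))))"
  proof (rule integral_mono[OF _ _ split])
    show "integrable P (\<lambda>X. 1 / (1 + a * G X) ^ k)"
      unfolding P_def G_def using f a by (intro integrable_shrinkage) auto
  qed (use int_prod in simp)
  also have "\<dots> = 1 / (1 + a * (\<theta> / 2)) ^ k + exp (real N / (4 * K)) * P.expectation (\<lambda>X. \<Prod>n=1..N. exp (- (t * f (X n))))"
    using int_prod by (simp add: P.prob_space)
  also have "\<dots> \<le> 1 / (1 + a * (\<theta> / 2)) ^ k + exp (real N / (4 * K)) * exp (- (3 * real N / (8 * K)))"
    by (intro add_left_mono mult_left_mono chernoff) auto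
  also have "exp (real N / (4 * K)) * exp (- (3 * real N / (8 * K))) = exp (- (real N / (8 * K)))"
    unfolding mult_exp_exp by (rule arg_cong[where f = exp]) (use K in \<open>simp add: field_simps\<close>)
  finally show ?thesis by (simp add: P_def G_def \<theta>_def)
qed

text \<open>
  Replaces \<open>y / 2\<close> by \<open>y\<close> and absorbs the exponential term, using that \<open>y\<close> grows at most linearly in \<open>N\<close>.
\<close>

lemma exponential_absorbed:
  fixes K D :: real
  assumes K: "K > 0" and D: "D \<ge> 0"
  obtains C where "C > 0"
    "\<And>y N k. 0 \<le> y \<Longrightarrow> y \<le> D * real N \<Longrightarrow> k \<le> 2 \<Longrightarrow>
       1 / (1 + y / 2) ^ k + exp (- (real N / (8 * K))) \<le> C / (1 + y) ^ k"
proof -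
  define L where "L = max 1 (8 * K * D)"
  have L: "L \<ge> 1" "8 * K * D \<le> L" by (auto simp: L_def)
  have "1 / (1 + y / 2) ^ k + exp (- (real N / (8 * K))) \<le> (4 + 2 * L\<^sup>2) / (1 + y) ^ k"
    if y: "0 \<le> y" "y \<le> D * real N" and k: "k \<le> 2" for y N k
  proof -
    define x where "x = real N / (8 * K)"
    have x: "x \<ge> 0" "real N = 8 * K * x" using K by (auto simp: x_def)
    have p: "(1 + y) ^ k > 0" using y by (intro zero_less_power) simp
    have "(1 + y) ^ k \<le> (2 * (1 + y / 2)) ^ k" using y by (intro power_mono) auto
    also have "\<dots> = 2 ^ k * (1 + y / 2) ^ k" by (simp only: power_mult_distrib)
    also have "\<dots> \<le> 2\<^sup>2 * (1 + y / 2) ^ k" using k y by (intro mult_right_mono power_increasing) auto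
    finally have le: "(1 + y) ^ k \<le> 2\<^sup>2 * (1 + y / 2) ^ k" .
    have "1 / (1 + y / 2) ^ k \<le> 4 / (1 + y) ^ k"
    proof -
      have "1 / U \<le> 4 / W" if "0 < U" "0 < W" "W \<le> 4 * U" for U W :: real
        using that by (simp add: field_simps)
      moreover have "0 < (1 + y / 2) ^ k" using y by (intro zero_less_power) simp
      ultimately show ?thesis using p le by simp
    qed
    moreover have "exp (- x) \<le> 2 * L\<^sup>2 / (1 + y) ^ k"
    proof -
      have "y \<le> L * x"
        using y(2) mult_right_mono[OF L(2) x(1)] by (simp add: x(2) mult_ac)
      also have "1 + \<dots> \<le> L * (1 + x)" using L by (simp add: algebra_simps)
      finally have "1 + y \<le> L * (1 + x)" by simp
      have "(1 + y) ^ k \<le> (1 + y)\<^sup>2" using y k by (intro power_increasing) auto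
      also have "\<dots> \<le> (L * (1 + x))\<^sup>2" using y \<open>1 + y \<le> L * (1 + x)\<close> by (intro power_mono) auto
      also have "\<dots> = L\<^sup>2 * (1 + 2 * x + x\<^sup>2)" by (simp add: power_mult_distrib power2_sum)
      also have "\<dots> \<le> L\<^sup>2 * (2 * exp x)"
        using exp_lower_Taylor_quadratic[OF x(1)] by (intro mult_left_mono) auto
      finally have "(1 + y) ^ k \<le> 2 * L\<^sup>2 * exp x" by simp
      then show ?thesis using p by (simp add: exp_minus divide_simps mult_ac)
    qed
    ultimately show ?thesis unfolding x_def by (simp add: add_divide_distrib)
  qed
  then show ?thesis using that[of "4 + 2 * L\<^sup>2"] by (simp add: add_pos_nonneg)
qed

text \<open>
  For \<open>h = \<phi> j\<close> and \<open>a = N * (\<sigma> j)\<^sup>2 / \<gamma>\<^sup>2\<close> the \<open>k\<close>-th moment of the factor by which the data shrink the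
  prior variance of the \<open>j\<close>-th eigenvalue.
\<close>

definition shrinkage_moment :: "'h::real_inner measure \<Rightarrow> 'h \<Rightarrow> real \<Rightarrow> nat \<Rightarrow> nat \<Rightarrow> real" where
  "shrinkage_moment \<nu> h a N k =
     (\<integral>X. 1 / (1 + a * (1 / real N * (\<Sum>n=1..N. (inner h (X n))\<^sup>2))) ^ k \<partial>PiM {1..N} (\<lambda>_. \<nu>))"

lemma shrinkage_moment_2_le_1:
  fixes \<nu> :: "'h::{real_inner, second_countable_topology} measure"
  assumes \<nu>: "borel_prob \<nu>" and a: "a \<ge> 0"
  shows "shrinkage_moment \<nu> h a N 2 \<le> shrinkage_moment \<nu> h a N 1"
proof -
  interpret prob_space \<nu> using \<nu> by (simp add: borel_prob_def)
  have sets: "sets \<nu> = sets borel" using \<nu> by (simp add: borel_prob_def)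
  have "inner h \<in> borel_measurable \<nu>" by (subst measurable_cong_sets[OF sets refl]) measurable
  then have m: "(\<lambda>x. (inner h x)\<^sup>2) \<in> borel_measurable \<nu>" by measurable
  show ?thesis unfolding shrinkage_moment_def
  proof (intro integral_mono integrable_shrinkage[OF m _ a])
    fix X
    have "0 \<le> a * (1 / real N * (\<Sum>n=1..N. (inner h (X n))\<^sup>2))"
      using a by (intro mult_nonneg_nonneg sum_nonneg) auto
    then show "1 / (1 + a * (1 / real N * (\<Sum>n=1..N. (inner h (X n))\<^sup>2))) ^ 2
        \<le> 1 / (1 + a * (1 / real N * (\<Sum>n=1..N. (inner h (X n))\<^sup>2))) ^ 1"
      by (intro divide_left_mono power_increasing mult_pos_pos zero_less_power add_pos_nonneg) auto
  qed auto
qed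

lemma shrinkage_moment_bounds:
  fixes \<nu> :: "'h::{real_inner, second_countable_topology} measure"
  assumes \<nu>: "borel_prob \<nu>" and cov: "has_covariance \<nu> \<Lambda>" and KL: "KL_moment \<nu> \<Lambda>" and D: "D \<ge> 0"
  obtains C where "C \<ge> 1"
    "\<And>h a N k. inner h (\<Lambda> h) > 0 \<Longrightarrow> 0 \<le> a \<Longrightarrow> a * inner h (\<Lambda> h) \<le> D * real N \<Longrightarrow> N \<ge> 1 \<Longrightarrow> k \<le> 2 \<Longrightarrow>
       1 / (1 + a * inner h (\<Lambda> h)) ^ k \<le> shrinkage_moment \<nu> h a N k
       \<and> shrinkage_moment \<nu> h a N k \<le> C / (1 + a * inner h (\<Lambda> h)) ^ k"
proof -
  interpret prob_space \<nu> using \<nu> by (simp add: borel_prob_def)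
  obtain K where K: "K \<ge> 3" "\<And>h. integrable \<nu> (\<lambda>x. (inner h x) ^ 4)"
    "\<And>h. (\<integral>x. (inner h x) ^ 4 \<partial>\<nu>) \<le> K * (inner h (\<Lambda> h))\<^sup>2"
    by (rule fourth_moment_bound[OF \<nu> cov KL]) blast
  have K0: "K > 0" using K(1) by simp
  obtain C where C: "C > 0" "\<And>y N k. 0 \<le> y \<Longrightarrow> y \<le> D * real N \<Longrightarrow> k \<le> 2 \<Longrightarrow>
       1 / (1 + y / 2) ^ k + exp (- (real N / (8 * K))) \<le> C / (1 + y) ^ k"
    by (rule exponential_absorbed[OF K0 D]) blast
  have "1 / (1 + a * inner h (\<Lambda> h)) ^ k \<le> shrinkage_moment \<nu> h a N k
       \<and> shrinkage_moment \<nu> h a N k \<le> max 1 C / (1 + a * inner h (\<Lambda> h)) ^ k"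
    if h: "inner h (\<Lambda> h) > 0" and a: "0 \<le> a" "a * inner h (\<Lambda> h) \<le> D * real N" and N: "N \<ge> 1" and k: "k \<le> 2"
    for h a N k
  proof
    define f where "f x = (inner h x)\<^sup>2" for x
    have "integrable \<nu> (\<lambda>x. inner h x * inner h x)" "inner h (\<Lambda> h) = (\<integral>x. inner h x * inner h x \<partial>\<nu>)"
      using cov by (auto simp: has_covariance_def)
    then have f: "integrable \<nu> f" "expectation f = inner h (\<Lambda> h)"
      by (simp_all add: f_def[abs_def] power2_eq_square)
    have f_sq: "(\<lambda>x. (f x)\<^sup>2) = (\<lambda>x. (inner h x) ^ 4)"
      by (simp add: f_def power_mult[symmetric])
    have f0: "f x \<ge> 0" for x by (simp add: f_def)
    have rm: "shrinkage_moment \<nu> h a N k = (\<integral>X. 1 / (1 + a * (1 / real N * (\<Sum>n=1..N. f (X n)))) ^ k \<partial>PiM {1..N} (\<lambda>_. \<nu>))"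
      by (simp only: shrinkage_moment_def f_def)
    show "1 / (1 + a * inner h (\<Lambda> h)) ^ k \<le> shrinkage_moment \<nu> h a N k"
      using shrinkage_expectation_ge[OF f(1) f0 a(1) N, of k] unfolding rm f(2) .
    have "shrinkage_moment \<nu> h a N k \<le> 1 / (1 + a * (inner h (\<Lambda> h) / 2)) ^ k + exp (- (real N / (8 * K)))"
      unfolding rm f(2)[symmetric]
      by (rule shrinkage_expectation_le[OF f(1) _ f0 _ K0 _ a(1) N]) (use f h K in \<open>simp_all add: f_sq\<close>)
    also have "\<dots> \<le> C / (1 + a * inner h (\<Lambda> h)) ^ k"
      using C(2)[of "a * inner h (\<Lambda> h)" N k] h a k by simp
    also have "\<dots> \<le> max 1 C / (1 + a * inner h (\<Lambda> h)) ^ k"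
      using h a by (intro divide_right_mono) auto
    finally show "shrinkage_moment \<nu> h a N k \<le> max 1 C / (1 + a * inner h (\<Lambda> h)) ^ k" .
  qed
  then show ?thesis by (intro that[of "max 1 C"]) auto
qed

section \<open>The exact expected error\<close>

lemma norm_orthonormal_series:
  fixes e :: "nat \<Rightarrow> 'h::{real_inner, banach}"
  assumes ortho: "\<And>i j. inner (e i) (e j) = (if i = j then 1 else 0 :: real)"
    and sq: "summable (\<lambda>j. (c j)\<^sup>2)"
  shows "(norm (\<Sum>j. c j *\<^sub>R e j))\<^sup>2 = (\<Sum>j. (c j)\<^sup>2)"
proof -
  have pyth: "(norm (\<Sum>j\<in>F. c j *\<^sub>R e j))\<^sup>2 = (\<Sum>j\<in>F. (c j)\<^sup>2)" if "finite F" for F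
  proof -
    have "(norm (\<Sum>j\<in>F. c j *\<^sub>R e j))\<^sup>2 = (\<Sum>i\<in>F. \<Sum>j\<in>F. c i * (c j * inner (e i) (e j)))"
      unfolding power2_norm_eq_inner inner_sum_left inner_sum_right
      by (simp add: sum_distrib_left) (intro sum.cong refl, simp add: inner_commute)
    also have "\<dots> = (\<Sum>i\<in>F. (c i)\<^sup>2)"
      using that by (intro sum.cong) (auto simp: ortho if_distrib power2_eq_square cong: if_cong)
    finally show ?thesis .
  qed
  have "summable (\<lambda>j. c j *\<^sub>R e j)"
    unfolding summable_Cauchy
  proof (intro allI impI)
    fix r :: real assume r: "r > 0"
    have "0 < r\<^sup>2" using r by simp
    then obtain N where N: "\<forall>m\<ge>N. \<forall>n. norm (\<Sum>j=m..<n. (c j)\<^sup>2) < r\<^sup>2"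
      using sq[unfolded summable_Cauchy] by (auto dest!: spec[of _ "r\<^sup>2"])
    have "norm (\<Sum>j=m..<n. c j *\<^sub>R e j) < r" if "m \<ge> N" for m n
    proof -
      have "(norm (\<Sum>j=m..<n. c j *\<^sub>R e j))\<^sup>2 < r\<^sup>2"
        using N[rule_format, OF that, of n] by (simp add: pyth sum_nonneg)
      then show ?thesis using r by (simp add: power_less_imp_less_base)
    qed
    then show "\<exists>N. \<forall>m\<ge>N. \<forall>n. norm (\<Sum>j=m..<n. c j *\<^sub>R e j) < r" by blast
  qed
  then have "(\<lambda>n. (norm (\<Sum>j<n. c j *\<^sub>R e j))\<^sup>2) \<longlonglongrightarrow> (norm (\<Sum>j. c j *\<^sub>R e j))\<^sup>2"
    by (intro tendsto_power tendsto_norm summable_LIMSEQ)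
  moreover have "(\<lambda>n. (norm (\<Sum>j<n. c j *\<^sub>R e j))\<^sup>2) \<longlonglongrightarrow> (\<Sum>j. (c j)\<^sup>2)"
    using summable_LIMSEQ[OF sq] by (simp add: pyth)
  ultimately show ?thesis by (rule LIMSEQ_unique)
qed

text \<open>
  By the theorem of Pythagoras for orthonormal series the squared norm of the image is a series in the coordinates of \<open>x\<close>, and it
  equals \<open>\<infinity>\<close> exactly outside the domain; so the extended-valued integrand is one series for all \<open>x\<close> and can
  be integrated term by term.
\<close>

lemma L2_norm_sq_eq:
  fixes \<nu> :: "'h::{real_inner, banach, second_countable_topology} measure"
  assumes \<phi>: "orthonormal_basis \<phi>" and "borel_prob \<nu>" and cov: "has_covariance \<nu> \<Lambda>"
  shows "L2_norm_sq \<nu> \<phi> t = (\<Sum>j. ennreal (inner (\<phi> j) (\<Lambda> (\<phi> j)) * (t j)\<^sup>2))"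
proof -
  have sets [measurable_cong]: "sets \<nu> = sets borel" using assms by (simp add: borel_prob_def)
  have ortho: "inner (\<phi> i) (\<phi> j) = (if i = j then 1 else 0 :: real)" for i j
    using \<phi> by (simp add: orthonormal_basis_def)
  have pt: "(if x \<in> diag_dom \<phi> t then ennreal ((norm (diag_op \<phi> t x))\<^sup>2) else \<infinity>)
      = (\<Sum>j. ennreal ((t j)\<^sup>2 * (inner (\<phi> j) x)\<^sup>2))" for x
  proof (cases "x \<in> diag_dom \<phi> t")
    case True
    then have sm: "summable (\<lambda>j. (t j)\<^sup>2 * (inner (\<phi> j) x)\<^sup>2)" by (simp add: diag_dom_def)
    then have "(norm (diag_op \<phi> t x))\<^sup>2 = (\<Sum>j. (t j)\<^sup>2 * (inner (\<phi> j) x)\<^sup>2)"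
      unfolding diag_op_def using norm_orthonormal_series[OF ortho, of "\<lambda>j. t j * inner (\<phi> j) x"]
      by (simp add: power_mult_distrib)
    moreover have "(\<Sum>j. ennreal ((t j)\<^sup>2 * (inner (\<phi> j) x)\<^sup>2)) = ennreal (\<Sum>j. (t j)\<^sup>2 * (inner (\<phi> j) x)\<^sup>2)"
      by (rule suminf_ennreal2[OF _ sm]) simp
    ultimately show ?thesis using True by simp
  next
    case False
    then have "\<not> summable (\<lambda>j. (t j)\<^sup>2 * (inner (\<phi> j) x)\<^sup>2)" by (simp add: diag_dom_def)
    moreover have "summable (\<lambda>j. (t j)\<^sup>2 * (inner (\<phi> j) x)\<^sup>2)"
      if "(\<Sum>j. ennreal ((t j)\<^sup>2 * (inner (\<phi> j) x)\<^sup>2)) \<noteq> top"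
      using that by (intro summable_suminf_not_top) auto
    ultimately have "(\<Sum>j. ennreal ((t j)\<^sup>2 * (inner (\<phi> j) x)\<^sup>2)) = top" by blast
    then show ?thesis using False by simp
  qed
  have "L2_norm_sq \<nu> \<phi> t = (\<Sum>j. \<integral>\<^sup>+x. ennreal ((t j)\<^sup>2 * (inner (\<phi> j) x)\<^sup>2) \<partial>\<nu>)"
    unfolding L2_norm_sq_def pt by (rule nn_integral_suminf) measurable
  also have "\<dots> = (\<Sum>j. ennreal (inner (\<phi> j) (\<Lambda> (\<phi> j)) * (t j)\<^sup>2))"
  proof (intro suminf_cong)
    fix j
    have "integrable \<nu> (\<lambda>x. inner (\<phi> j) x * inner (\<phi> j) x)"
      and eq: "inner (\<phi> j) (\<Lambda> (\<phi> j)) = (\<integral>x. inner (\<phi> j) x * inner (\<phi> j) x \<partial>\<nu>)"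
      using cov by (auto simp: has_covariance_def)
    then have int: "integrable \<nu> (\<lambda>x. (inner (\<phi> j) x)\<^sup>2)" by (simp add: power2_eq_square)
    have "(\<integral>\<^sup>+x. ennreal ((t j)\<^sup>2 * (inner (\<phi> j) x)\<^sup>2) \<partial>\<nu>) = ennreal (\<integral>x. (t j)\<^sup>2 * (inner (\<phi> j) x)\<^sup>2 \<partial>\<nu>)"
      using int by (intro nn_integral_eq_integral) auto
    also have "(\<integral>x. (t j)\<^sup>2 * (inner (\<phi> j) x)\<^sup>2 \<partial>\<nu>) = inner (\<phi> j) (\<Lambda> (\<phi> j)) * (t j)\<^sup>2"
      by (simp add: eq power2_eq_square mult.commute)
    finally show "(\<integral>\<^sup>+x. ennreal ((t j)\<^sup>2 * (inner (\<phi> j) x)\<^sup>2) \<partial>\<nu>) = ennreal (inner (\<phi> j) (\<Lambda> (\<phi> j)) * (t j)\<^sup>2)" .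
  qed
  finally show ?thesis .
qed

lemma gaussian_quadratic_moment:
  assumes "s > 0"
  shows "(\<integral>\<^sup>+t. ennreal ((l - t)\<^sup>2) \<partial>gaussian m s) = ennreal ((l - m)\<^sup>2 + s\<^sup>2)"
proof -
  have "has_bochner_integral lborel (\<lambda>t. normal_density m s t * (t - m) ^ (2 * 1)) (s\<^sup>2)"
    using normal_moment_even[OF assms, of m 1] by (simp add: fact_numeral)
  moreover have "has_bochner_integral lborel (\<lambda>t. normal_density m s t * (t - m) ^ (2 * 0 + 1)) 0"
    by (rule normal_moment_odd[OF assms])
  moreover have "has_bochner_integral lborel (\<lambda>t. normal_density m s t * (t - m) ^ (2 * 0)) 1"
    using normal_moment_even[OF assms, of m 0] by simp
  ultimately have "has_bochner_integral lborel (\<lambda>t. normal_density m s t * (t - m) ^ (2 * 1)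
      - 2 * (l - m) * (normal_density m s t * (t - m) ^ (2 * 0 + 1)) + (l - m)\<^sup>2 * (normal_density m s t * (t - m) ^ (2 * 0)))
      (s\<^sup>2 - 2 * (l - m) * 0 + (l - m)\<^sup>2 * 1)"
    by (intro has_bochner_integral_add has_bochner_integral_diff has_bochner_integral_mult_right)
  then have hb: "has_bochner_integral lborel (\<lambda>t. normal_density m s t * (l - t)\<^sup>2) ((l - m)\<^sup>2 + s\<^sup>2)"
    by (rule has_bochner_integral_cong[THEN iffD1, rotated -1]) (auto simp: power2_eq_square algebra_simps)
  have "(\<integral>\<^sup>+t. ennreal ((l - t)\<^sup>2) \<partial>gaussian m s) = (\<integral>\<^sup>+t. ennreal (normal_density m s t * (l - t)\<^sup>2) \<partial>lborel)"
    by (subst nn_integral_density) (auto simp: ennreal_mult normal_density_nonneg)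
  also have "\<dots> = ennreal ((l - m)\<^sup>2 + s\<^sup>2)"
    using hb by (subst nn_integral_eq_integral) (auto simp: has_bochner_integral_iff normal_density_nonneg)
  finally show ?thesis .
qed

lemma posterior_expectation:
  fixes \<nu>' :: "'h::{real_inner, banach, second_countable_topology} measure"
  assumes \<phi>: "orthonormal_basis \<phi>" and "borel_prob \<nu>'" and cov: "has_covariance \<nu>' \<Lambda>'"
    and pos: "\<And>j. post_var \<phi> \<sigma> \<gamma> N D j > 0"
  shows "(\<integral>\<^sup>+t. L2_norm_sq \<nu>' \<phi> (\<lambda>j. l j - t j) \<partial>posterior \<phi> \<sigma> \<gamma> N D)
    = (\<Sum>j. ennreal (inner (\<phi> j) (\<Lambda>' (\<phi> j)) * ((l j - post_mean \<phi> \<sigma> \<gamma> N D j)\<^sup>2 + post_var \<phi> \<sigma> \<gamma> N D j)))"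
proof -
  define Q where "Q j = gaussian (post_mean \<phi> \<sigma> \<gamma> N D j) (sqrt (post_var \<phi> \<sigma> \<gamma> N D j))" for j
  have Q: "prob_space (Q j)" for j
    unfolding Q_def using pos by (intro prob_space_normal_density) simp
  have [measurable_cong]: "sets (Q j) = sets borel" for j by (simp add: Q_def)
  have nonneg: "inner (\<phi> j) (\<Lambda>' (\<phi> j)) \<ge> 0" for j
    using cov by (simp add: has_covariance_def)
  have comp: "(\<lambda>t. t j) \<in> borel_measurable (PiM UNIV Q)" for j
    using measurable_component_singleton[of j UNIV Q] by (simp cong: measurable_cong_sets)
  have quad: "(\<lambda>u. ennreal (c * (l j - u)\<^sup>2)) \<in> borel_measurable borel" for c j
    by measurable
  have "(\<integral>\<^sup>+t. L2_norm_sq \<nu>' \<phi> (\<lambda>j. l j - t j) \<partial>posterior \<phi> \<sigma> \<gamma> N D)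
      = (\<integral>\<^sup>+t. (\<Sum>j. ennreal (inner (\<phi> j) (\<Lambda>' (\<phi> j)) * (l j - t j)\<^sup>2)) \<partial>PiM UNIV Q)"
    unfolding posterior_def Q_def L2_norm_sq_eq[OF assms(1-3)] ..
  also have "\<dots> = (\<Sum>j. \<integral>\<^sup>+t. ennreal (inner (\<phi> j) (\<Lambda>' (\<phi> j)) * (l j - t j)\<^sup>2) \<partial>PiM UNIV Q)"
    by (rule nn_integral_suminf) (rule measurable_compose[OF comp quad])
  also have "\<dots> = (\<Sum>j. ennreal (inner (\<phi> j) (\<Lambda>' (\<phi> j)) * ((l j - post_mean \<phi> \<sigma> \<gamma> N D j)\<^sup>2 + post_var \<phi> \<sigma> \<gamma> N D j)))"
  proof (intro suminf_cong)
    fix j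
    have "(\<integral>\<^sup>+t. ennreal (inner (\<phi> j) (\<Lambda>' (\<phi> j)) * (l j - t j)\<^sup>2) \<partial>PiM UNIV Q)
        = ennreal (inner (\<phi> j) (\<Lambda>' (\<phi> j))) * (\<integral>\<^sup>+t. ennreal ((l j - t j)\<^sup>2) \<partial>PiM UNIV Q)"
      using nonneg measurable_compose[OF comp quad[of 1]] by (simp add: ennreal_mult nn_integral_cmult)
    also have "(\<integral>\<^sup>+t. ennreal ((l j - t j)\<^sup>2) \<partial>PiM UNIV Q) = (\<integral>\<^sup>+u. ennreal ((l j - u)\<^sup>2) \<partial>distr (PiM UNIV Q) (Q j) (\<lambda>t. t j))"
    proof (rule nn_integral_distr[symmetric])
      show "(\<lambda>t. t j) \<in> PiM UNIV Q \<rightarrow>\<^sub>M Q j" by (rule measurable_component_singleton) simp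
      have "borel_measurable (distr (PiM UNIV Q) (Q j) (\<lambda>t. t j)) = (borel_measurable borel :: (real \<Rightarrow> ennreal) set)"
        by (intro measurable_cong_sets) (simp_all add: Q_def)
      then show "(\<lambda>u. ennreal ((l j - u)\<^sup>2)) \<in> borel_measurable (distr (PiM UNIV Q) (Q j) (\<lambda>t. t j))"
        using quad[of 1 j] by (simp only: mult_1)
    qed
    also have "distr (PiM UNIV Q) (Q j) (\<lambda>t. t j) = Q j"
      using Q by (intro distr_PiM_component) auto
    also have "(\<integral>\<^sup>+u. ennreal ((l j - u)\<^sup>2) \<partial>Q j) = ennreal ((l j - post_mean \<phi> \<sigma> \<gamma> N D j)\<^sup>2 + post_var \<phi> \<sigma> \<gamma> N D j)"
      unfolding Q_def using pos[of j] by (subst gaussian_quadratic_moment) auto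
    finally show "(\<integral>\<^sup>+t. ennreal (inner (\<phi> j) (\<Lambda>' (\<phi> j)) * (l j - t j)\<^sup>2) \<partial>PiM UNIV Q)
        = ennreal (inner (\<phi> j) (\<Lambda>' (\<phi> j)) * ((l j - post_mean \<phi> \<sigma> \<gamma> N D j)\<^sup>2 + post_var \<phi> \<sigma> \<gamma> N D j))"
      using nonneg pos[of j] by (simp add: ennreal_mult)
  qed
  finally show ?thesis .
qed

lemma indep_vars_PiM_coordinates:
  assumes M: "\<And>i. i \<in> I \<Longrightarrow> prob_space (M i)" and "I \<noteq> {}"
  shows "prob_space.indep_vars (PiM I M) M (\<lambda>i x. x i) I"
proof -
  interpret prob_space "PiM I M" by (intro prob_space_PiM M)
  have "distr (PiM I M) (PiM I M) (\<lambda>x. \<lambda>i\<in>I. x i) = distr (PiM I M) (PiM I M) (\<lambda>x. x)"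
    by (intro distr_cong) (auto simp: space_PiM)
  also have "\<dots> = PiM I M" by simp
  also have "\<dots> = PiM I (\<lambda>i. distr (PiM I M) (M i) (\<lambda>x. x i))"
    using M by (intro PiM_cong) (auto simp: distr_PiM_component)
  finally show ?thesis
    by (subst indep_vars_iff_distr_eq_PiM'[OF \<open>I \<noteq> {}\<close>]) auto
qed

text \<open>
  The noise variables are independent standard Gaussians, so the cross terms of the square have mean zero.
\<close>

lemma gaussian_noise_quadratic_moment:
  fixes v :: real
  assumes v: "v \<ge> 0" and F: "finite F" "F \<subseteq> I" and I: "I \<noteq> {}"
  shows "(\<integral>\<^sup>+\<xi>. ennreal ((A - (\<Sum>i\<in>F. c i * \<xi> i))\<^sup>2 + v) \<partial>PiM I (\<lambda>_. gaussian 0 1))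
    = ennreal (A\<^sup>2 + (\<Sum>i\<in>F. (c i)\<^sup>2) + v)"
proof -
  define P where "P = PiM I (\<lambda>_. gaussian 0 1)"
  have g: "prob_space (gaussian 0 1)" by (intro prob_space_normal_density) simp
  interpret prob_space P unfolding P_def by (intro prob_space_PiM g)
  have rv: "(\<lambda>\<xi>. \<xi> i) \<in> measurable P (gaussian 0 1)" if "i \<in> F" for i
    using that F by (auto simp: P_def)
  have rvb [measurable]: "(\<lambda>\<xi>. \<xi> i) \<in> borel_measurable P" if "i \<in> F" for i
    using rv[OF that] by (simp cong: measurable_cong_sets)
  have comp: "distr P (gaussian 0 1) (\<lambda>\<xi>. \<xi> i) = gaussian 0 1" if "i \<in> F" for i
    using that F g by (auto simp: P_def intro!: distr_PiM_component)
  have "indep_vars (\<lambda>_. gaussian 0 1) (\<lambda>i \<xi>. \<xi> i) I"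
    unfolding P_def by (intro indep_vars_PiM_coordinates g I)
  from indep_vars_compose2[OF indep_vars_subset[OF this F(2)], where Y = "\<lambda>i x. x" and N = "\<lambda>_. borel"]
  have ind: "indep_vars (\<lambda>_. borel) (\<lambda>i \<xi>. \<xi> i) F" by simp
  have int: "integrable P (\<lambda>\<xi>. \<xi> i ^ k)" if "i \<in> F" for i k
    using rv[OF that] integrable_std_normal_distribution_moment[of k]
    by (subst integrable_distr_eq[symmetric, of _ _ "gaussian 0 1" "\<lambda>u. u ^ k"]) (auto simp: comp[OF that])
  have moment: "expectation (\<lambda>\<xi>. \<xi> i ^ k) = (\<integral>u. u ^ k \<partial>gaussian 0 1)" if "i \<in> F" for i k
    using rv[OF that] by (subst integral_distr[symmetric, of _ _ "gaussian 0 1" "\<lambda>u. u ^ k"]) (auto simp: comp[OF that])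
  have mean: "expectation (\<lambda>\<xi>. \<xi> i) = 0" if "i \<in> F" for i
    using moment[OF that, of 1] integral_std_normal_distribution_moment_odd[of 1] by simp
  have var: "expectation (\<lambda>\<xi>. (\<xi> i)\<^sup>2) = 1" if "i \<in> F" for i
    using moment[OF that, of 2] std_normal_distribution_even_moments(1)[of 1] by (simp add: fact_numeral)
  define T where "T \<xi> = (\<Sum>i\<in>F. c i * \<xi> i)" for \<xi>
  have T2: "integrable P (\<lambda>\<xi>. (T \<xi>)\<^sup>2)" "expectation (\<lambda>\<xi>. (T \<xi>)\<^sup>2) = (\<Sum>i\<in>F. (c i)\<^sup>2)"
    using second_moment_weighted_sum[OF F(1) ind, of c] int[of _ 1] int[of _ 2] mean var
    by (auto simp: T_def)
  have T1: "integrable P T" "expectation T = 0"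
    unfolding T_def using int[of _ 1] mean by (auto simp: Bochner_Integration.integral_sum)
  have eq: "(A - T \<xi>)\<^sup>2 + v = A\<^sup>2 - 2 * A * T \<xi> + (T \<xi>)\<^sup>2 + v" for \<xi>
    by (simp add: power2_diff)
  have "(\<integral>\<^sup>+\<xi>. ennreal ((A - T \<xi>)\<^sup>2 + v) \<partial>P) = ennreal (expectation (\<lambda>\<xi>. (A - T \<xi>)\<^sup>2 + v))"
  proof (rule nn_integral_eq_integral)
    show "integrable P (\<lambda>\<xi>. (A - T \<xi>)\<^sup>2 + v)" unfolding eq using T1 T2 by simp
  qed (use v in simp)
  also have "expectation (\<lambda>\<xi>. (A - T \<xi>)\<^sup>2 + v) = A\<^sup>2 + (\<Sum>i\<in>F. (c i)\<^sup>2) + v"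
    unfolding eq using T1 T2 by (simp add: prob_space)
  finally show ?thesis by (simp add: T_def P_def)
qed

lemma measurable_data_components:
  fixes \<nu> :: "'h::{real_inner, second_countable_topology} measure"
  assumes "sets \<nu> = sets borel"
  shows "n \<in> {1..N} \<Longrightarrow> (\<lambda>X. inner h (X n)) \<in> borel_measurable (PiM {1..N} (\<lambda>_. \<nu>))"
    and "n \<in> {1..N} \<Longrightarrow> (\<lambda>D. inner h (fst D n)) \<in> borel_measurable (PiM {1..N} (\<lambda>_. \<nu>) \<Otimes>\<^sub>M R)"
    and "i \<in> I \<Longrightarrow> sets M = sets borel \<Longrightarrow>
      (\<lambda>D. snd D i) \<in> borel_measurable (R' \<Otimes>\<^sub>M PiM I (\<lambda>_. M :: real measure))"
proof -
  have c: "(\<lambda>X. X n) \<in> PiM {1..N} (\<lambda>_. \<nu>) \<rightarrow>\<^sub>M \<nu>" if "n \<in> {1..N}" for n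
    using that by (rule measurable_component_singleton)
  have h: "inner h \<in> borel_measurable \<nu>"
    by (subst measurable_cong_sets[OF assms refl]) measurable
  show 1: "(\<lambda>X. inner h (X n)) \<in> borel_measurable (PiM {1..N} (\<lambda>_. \<nu>))" if "n \<in> {1..N}" for n
    using measurable_compose[OF c[OF that] h] .
  show "(\<lambda>D. inner h (fst D n)) \<in> borel_measurable (PiM {1..N} (\<lambda>_. \<nu>) \<Otimes>\<^sub>M R)" if "n \<in> {1..N}" for n
    using measurable_compose[OF measurable_fst 1[OF that]] .
  show "(\<lambda>D. snd D i) \<in> borel_measurable (R' \<Otimes>\<^sub>M PiM I (\<lambda>_. M))" if "i \<in> I" "sets M = sets borel"
  proof -
    have "(\<lambda>Y. Y i) \<in> PiM I (\<lambda>_. M) \<rightarrow>\<^sub>M M" using that(1) by (rule measurable_component_singleton)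
    then have "(\<lambda>Y. Y i) \<in> borel_measurable (PiM I (\<lambda>_. M))"
      by (subst (asm) measurable_cong_sets[OF refl that(2)])
    then show ?thesis by (rule measurable_compose[OF measurable_snd])
  qed
qed

lemma post_var_pos:
  assumes "(\<sigma> j)\<^sup>2 > 0"
  shows "post_var \<phi> \<sigma> \<gamma> N D j > 0"
proof -
  have "0 \<le> real N * (1 / \<gamma>\<^sup>2) * (\<sigma> j)\<^sup>2 * (1 / real N * (\<Sum>n=1..N. (inner (\<phi> j) (fst D n))\<^sup>2))"
    by (intro mult_nonneg_nonneg sum_nonneg) auto
  then show ?thesis
    unfolding post_var_def Let_def by (intro divide_pos_pos assms add_pos_nonneg zero_less_one)
qed

text \<open>
  Bias-variance decomposition of the posterior mean before averaging: a deterministic part \<open>l j * r\<close> and a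
  linear combination of the noise variables.  As \<open>\<gamma>\<^sup>2 * a / N = (\<sigma> j)\<^sup>2\<close> and \<open>r * a * G = 1 - r\<close>, the variance of the
  latter depends on the inputs through \<open>r\<close> only.
\<close>

lemma post_mean_error:
  fixes X \<phi> :: "nat \<Rightarrow> 'h::real_inner" and \<xi> :: "nat \<times> nat \<Rightarrow> real" and \<sigma> l :: "nat \<Rightarrow> real" and j :: nat
  assumes N: "N \<ge> 1" and \<gamma>: "\<gamma> > 0"
  defines "a \<equiv> real N * (1 / \<gamma>\<^sup>2) * (\<sigma> j)\<^sup>2"
    and "r \<equiv> 1 / (1 + real N * (1 / \<gamma>\<^sup>2) * (\<sigma> j)\<^sup>2 * (1 / real N * (\<Sum>n=1..N. (inner (\<phi> j) (X n))\<^sup>2)))"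
  defines "c \<equiv> \<lambda>i. \<gamma> * a * r / real N * inner (\<phi> j) (X (snd i))"
  defines "D \<equiv> (X, \<lambda>(i, n) \<in> UNIV \<times> {1..N}. inner (\<phi> i) (X n) * l i + \<gamma> * \<xi> (i, n))"
  shows "l j - post_mean \<phi> \<sigma> \<gamma> N D j = l j * r - (\<Sum>i\<in>{j} \<times> {1..N}. c i * \<xi> i)"
    and "(\<Sum>i\<in>{j} \<times> {1..N}. (c i)\<^sup>2) = (\<sigma> j)\<^sup>2 * (r - r\<^sup>2)"
    and "post_var \<phi> \<sigma> \<gamma> N D j = (\<sigma> j)\<^sup>2 * r"
proof -
  define g where "g n = inner (\<phi> j) (X n)" for n
  define G where "G = 1 / real N * (\<Sum>n=1..N. (g n)\<^sup>2)"
  have G: "G \<ge> 0" "a \<ge> 0" by (auto simp: G_def a_def sum_nonneg)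
  then have "a * G \<ge> 0" by simp
  then have den: "1 + a * G > 0" by simp
  have r: "r = 1 / (1 + a * G)" by (simp add: r_def a_def G_def g_def)
  have r1: "r * (a * G) = 1 - r" using den by (simp add: r field_simps)
  have NG: "(\<Sum>n=1..N. (g n)\<^sup>2) = real N * G" using N by (simp add: G_def)
  have pairs: "(\<Sum>i\<in>{j} \<times> {1..N}. h i) = (\<Sum>n=1..N. h (j, n))" for h :: "nat \<times> nat \<Rightarrow> real"
    by (rule sum.reindex_bij_witness[of _ "\<lambda>n. (j, n)" snd]) auto
  have "post_mean \<phi> \<sigma> \<gamma> N D j = a * (1 / real N * (\<Sum>n=1..N. (g n * l j + \<gamma> * \<xi> (j, n)) * g n)) * r"
    by (simp add: post_mean_def Let_def D_def r a_def G_def g_def)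
  also have "(\<Sum>n=1..N. (g n * l j + \<gamma> * \<xi> (j, n)) * g n) = l j * (\<Sum>n=1..N. (g n)\<^sup>2) + \<gamma> * (\<Sum>n=1..N. g n * \<xi> (j, n))"
    by (simp add: sum.distrib sum_distrib_left power2_eq_square algebra_simps)
  also have "a * (1 / real N * (l j * (\<Sum>n=1..N. (g n)\<^sup>2) + \<gamma> * (\<Sum>n=1..N. g n * \<xi> (j, n)))) * r
      = l j * (r * (a * G)) + \<gamma> * a * r / real N * (\<Sum>n=1..N. g n * \<xi> (j, n))"
    unfolding NG using N by (simp add: field_simps)
  also have "\<dots> = l j * (1 - r) + (\<Sum>i\<in>{j} \<times> {1..N}. c i * \<xi> i)"
    unfolding r1 pairs by (simp add: c_def g_def sum_distrib_left mult_ac)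
  finally show "l j - post_mean \<phi> \<sigma> \<gamma> N D j = l j * r - (\<Sum>i\<in>{j} \<times> {1..N}. c i * \<xi> i)"
    by (simp add: algebra_simps)
  have "(\<Sum>i\<in>{j} \<times> {1..N}. (c i)\<^sup>2) = (\<gamma> * a * r / real N)\<^sup>2 * (\<Sum>n=1..N. (g n)\<^sup>2)"
    unfolding pairs by (simp add: c_def g_def power_mult_distrib power_divide sum_distrib_left)
  also have "\<dots> = (\<gamma>\<^sup>2 * a / real N) * (r * (r * (a * G)))"
    unfolding NG using N by (simp add: power2_eq_square field_simps)
  also have "\<gamma>\<^sup>2 * a / real N = (\<sigma> j)\<^sup>2" using \<gamma> N by (simp add: a_def)
  also have "r * (r * (a * G)) = r - r\<^sup>2" unfolding r1 by (simp add: power2_eq_square algebra_simps)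
  finally show "(\<Sum>i\<in>{j} \<times> {1..N}. (c i)\<^sup>2) = (\<sigma> j)\<^sup>2 * (r - r\<^sup>2)" .
  show "post_var \<phi> \<sigma> \<gamma> N D j = (\<sigma> j)\<^sup>2 * r"
    by (simp add: post_var_def Let_def D_def r_def)
qed

lemma data_expectation:
  fixes \<nu> :: "'h::{real_inner, second_countable_topology} measure" and \<sigma> l :: "nat \<Rightarrow> real" and j :: nat
  assumes "borel_prob \<nu>" and \<gamma>: "\<gamma> > 0" and N: "N \<ge> 1" and \<theta>: "\<theta> \<ge> 0"
  defines "a \<equiv> real N * (1 / \<gamma>\<^sup>2) * (\<sigma> j)\<^sup>2"
  shows "(\<lambda>D. ennreal (\<theta> * ((l j - post_mean \<phi> \<sigma> \<gamma> N D j)\<^sup>2 + post_var \<phi> \<sigma> \<gamma> N D j)))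
      \<in> borel_measurable (data_law \<nu> \<phi> l \<gamma> N)" (is "?f \<in> _")
    and "(\<integral>\<^sup>+D. ennreal (\<theta> * ((l j - post_mean \<phi> \<sigma> \<gamma> N D j)\<^sup>2 + post_var \<phi> \<sigma> \<gamma> N D j)) \<partial>data_law \<nu> \<phi> l \<gamma> N)
      = ennreal (\<theta> * ((l j)\<^sup>2 * shrinkage_moment \<nu> (\<phi> j) a N 2
          + (\<sigma> j)\<^sup>2 * (2 * shrinkage_moment \<nu> (\<phi> j) a N 1 - shrinkage_moment \<nu> (\<phi> j) a N 2)))"
proof -
  interpret prob_space \<nu> using assms by (simp add: borel_prob_def)
  have sets: "sets \<nu> = sets borel" using assms by (simp add: borel_prob_def)
  define I where "I = (UNIV :: nat set) \<times> {1..N}"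
  define PX where "PX = PiM {1..N} (\<lambda>_. \<nu>)"
  define P\<xi> where "P\<xi> = PiM I (\<lambda>_. gaussian 0 1)"
  define T where "T = (\<lambda>(X, \<xi>). (X, \<lambda>(j, n) \<in> I. inner (\<phi> j) (X n) * l j + \<gamma> * \<xi> (j, n)))"
  have data: "data_law \<nu> \<phi> l \<gamma> N = distr (PX \<Otimes>\<^sub>M P\<xi>) (PX \<Otimes>\<^sub>M PiM I (\<lambda>_. borel)) T"
    unfolding data_law_def PX_def P\<xi>_def T_def I_def ..
  interpret PX: prob_space PX unfolding PX_def by (intro prob_space_PiM prob_space_axioms)
  interpret P\<xi>: prob_space P\<xi> unfolding P\<xi>_def by (intro prob_space_PiM prob_space_normal_density zero_less_one)
  note mX = measurable_data_components(2)[OF sets, of _ N, folded PX_def]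
  note mY = measurable_data_components(3)[OF sets]
  have T_eq: "T = (\<lambda>\<omega>. (fst \<omega>, \<lambda>i\<in>I. inner (\<phi> (fst i)) (fst \<omega> (snd i)) * l (fst i) + \<gamma> * snd \<omega> i))"
    by (auto simp: T_def fun_eq_iff)
  have T [measurable]: "T \<in> PX \<Otimes>\<^sub>M P\<xi> \<rightarrow>\<^sub>M PX \<Otimes>\<^sub>M PiM I (\<lambda>_. borel)"
    unfolding T_eq P\<xi>_def
    by (intro measurable_Pair measurable_fst measurable_restrict borel_measurable_add borel_measurable_times
        borel_measurable_const mX mY) (auto simp: I_def)
  have meas: "?f \<in> borel_measurable (PX \<Otimes>\<^sub>M PiM I (\<lambda>_. borel))"
    unfolding post_mean_def post_var_def Let_def
    by (intro measurable_compose[OF _ measurable_ennreal] borel_measurable_add borel_measurable_times borel_measurable_diff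
        borel_measurable_const borel_measurable_divide borel_measurable_sum borel_measurable_power mX mY) (auto simp: I_def)
  then show "?f \<in> borel_measurable (data_law \<nu> \<phi> l \<gamma> N)" by (simp add: data)
  define r where "r X = 1 / (1 + a * (1 / real N * (\<Sum>n=1..N. (inner (\<phi> j) (X n))\<^sup>2)))" for X
  have r01: "0 \<le> r X" "r X \<le> 1" for X
  proof -
    have "0 \<le> a * (1 / real N * (\<Sum>n=1..N. (inner (\<phi> j) (X n))\<^sup>2))"
      unfolding a_def by (intro mult_nonneg_nonneg sum_nonneg) auto
    then show "0 \<le> r X" "r X \<le> 1" by (auto simp: r_def)
  qed
  have r_sq: "(r X)\<^sup>2 \<le> r X" for X
    using r01[of X] by (simp add: power2_eq_square mult_left_le_one_le)
  define E where "E X = \<theta> * ((l j)\<^sup>2 * (r X)\<^sup>2 + (\<sigma> j)\<^sup>2 * (2 * r X - (r X)\<^sup>2))" for X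
  have inner_int: "(\<integral>\<^sup>+\<xi>. ?f (T (X, \<xi>)) \<partial>P\<xi>) = ennreal (E X)" for X
  proof -
    define c where "c i = \<gamma> * a * r X / real N * inner (\<phi> j) (X (snd i))" for i :: "nat \<times> nat"
    note pm = post_mean_error[OF N \<gamma>, where \<sigma> = \<sigma> and j = j and \<phi> = \<phi> and X = X,
        folded a_def, folded r_def, folded c_def, folded I_def]
    have v: "(\<sigma> j)\<^sup>2 * r X \<ge> 0" using r01 by simp
    have f_eq: "?f (T (X, \<xi>)) = ennreal \<theta> * ennreal ((l j * r X - (\<Sum>i\<in>{j} \<times> {1..N}. c i * \<xi> i))\<^sup>2 + (\<sigma> j)\<^sup>2 * r X)" for \<xi>
    proof -
      have "l j - post_mean \<phi> \<sigma> \<gamma> N (T (X, \<xi>)) j = l j * r X - (\<Sum>i\<in>{j} \<times> {1..N}. c i * \<xi> i)"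
        "post_var \<phi> \<sigma> \<gamma> N (T (X, \<xi>)) j = (\<sigma> j)\<^sup>2 * r X"
        using pm(1)[of l \<xi>] pm(3)[of l \<xi>] by (simp_all add: T_def)
      then show ?thesis using v \<theta> by (simp add: ennreal_mult)
    qed
    have "(\<integral>\<^sup>+\<xi>. ?f (T (X, \<xi>)) \<partial>P\<xi>)
        = ennreal \<theta> * (\<integral>\<^sup>+\<xi>. ennreal ((l j * r X - (\<Sum>i\<in>{j} \<times> {1..N}. c i * \<xi> i))\<^sup>2 + (\<sigma> j)\<^sup>2 * r X) \<partial>P\<xi>)"
      unfolding f_eq
    proof (rule nn_integral_cmult)
      have "(\<lambda>\<xi>. \<xi> i) \<in> borel_measurable P\<xi>" if "i \<in> {j} \<times> {1..N}" for i
      proof -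
        have "(\<lambda>\<xi>. \<xi> i) \<in> P\<xi> \<rightarrow>\<^sub>M gaussian 0 1"
          unfolding P\<xi>_def using that by (intro measurable_component_singleton) (auto simp: I_def)
        then show ?thesis by (simp cong: measurable_cong_sets)
      qed
      then show "(\<lambda>\<xi>. ennreal ((l j * r X - (\<Sum>i\<in>{j} \<times> {1..N}. c i * \<xi> i))\<^sup>2 + (\<sigma> j)\<^sup>2 * r X)) \<in> borel_measurable P\<xi>"
        by (intro measurable_compose[OF _ measurable_ennreal] borel_measurable_add borel_measurable_times borel_measurable_diff
          borel_measurable_const borel_measurable_sum borel_measurable_power) auto
    qed
    also have "(\<integral>\<^sup>+\<xi>. ennreal ((l j * r X - (\<Sum>i\<in>{j} \<times> {1..N}. c i * \<xi> i))\<^sup>2 + (\<sigma> j)\<^sup>2 * r X) \<partial>P\<xi>)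
        = ennreal ((l j * r X)\<^sup>2 + (\<Sum>i\<in>{j} \<times> {1..N}. (c i)\<^sup>2) + (\<sigma> j)\<^sup>2 * r X)"
      unfolding P\<xi>_def using N by (intro gaussian_noise_quadratic_moment v) (auto simp: I_def)
    also have "ennreal \<theta> * \<dots> = ennreal (\<theta> * ((l j * r X)\<^sup>2 + (\<Sum>i\<in>{j} \<times> {1..N}. (c i)\<^sup>2) + (\<sigma> j)\<^sup>2 * r X))"
      using \<theta> v by (subst ennreal_mult) (auto intro!: add_nonneg_nonneg sum_nonneg)
    also have "\<theta> * ((l j * r X)\<^sup>2 + (\<Sum>i\<in>{j} \<times> {1..N}. (c i)\<^sup>2) + (\<sigma> j)\<^sup>2 * r X) = E X"
      unfolding pm(2) by (simp add: E_def power_mult_distrib algebra_simps)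
    finally show ?thesis .
  qed
  have int_r: "integrable PX (\<lambda>X. (r X) ^ k)" "PX.expectation (\<lambda>X. (r X) ^ k) = shrinkage_moment \<nu> (\<phi> j) a N k" for k
  proof -
    have "inner (\<phi> j) \<in> borel_measurable \<nu>" by (subst measurable_cong_sets[OF sets refl]) measurable
    then have "(\<lambda>x. (inner (\<phi> j) x)\<^sup>2) \<in> borel_measurable \<nu>" by measurable
    moreover have "a \<ge> 0" by (simp add: a_def)
    ultimately have "integrable PX (\<lambda>X. 1 / (1 + a * (1 / real N * (\<Sum>n=1..N. (inner (\<phi> j) (X n))\<^sup>2))) ^ k)"
      unfolding PX_def by (intro integrable_shrinkage) auto
    then show "integrable PX (\<lambda>X. (r X) ^ k)" by (simp only: r_def power_divide power_one)
    show "PX.expectation (\<lambda>X. (r X) ^ k) = shrinkage_moment \<nu> (\<phi> j) a N k"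
      by (simp add: r_def shrinkage_moment_def PX_def power_divide)
  qed
  have "(\<integral>\<^sup>+D. ?f D \<partial>data_law \<nu> \<phi> l \<gamma> N) = (\<integral>\<^sup>+\<omega>. ?f (T \<omega>) \<partial>(PX \<Otimes>\<^sub>M P\<xi>))"
  proof -
    have "?f \<in> borel_measurable (distr (PX \<Otimes>\<^sub>M P\<xi>) (PX \<Otimes>\<^sub>M PiM I (\<lambda>_. borel)) T)" using meas by simp
    from nn_integral_distr[OF T this] show ?thesis unfolding data .
  qed
  also have "\<dots> = (\<integral>\<^sup>+X. (\<integral>\<^sup>+\<xi>. ?f (T (X, \<xi>)) \<partial>P\<xi>) \<partial>PX)"
    by (rule P\<xi>.nn_integral_fst[symmetric]) (rule measurable_compose[OF T meas])
  also have "\<dots> = (\<integral>\<^sup>+X. ennreal (E X) \<partial>PX)" unfolding inner_int ..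
  also have "\<dots> = ennreal (PX.expectation E)"
  proof (rule nn_integral_eq_integral)
    show "integrable PX E" unfolding E_def using int_r(1)[of 1] int_r(1)[of 2] by simp
    show "AE X in PX. 0 \<le> E X"
    proof (rule AE_I2)
      fix X
      have "0 \<le> 2 * r X - (r X)\<^sup>2" using r_sq[of X] r01[of X] by linarith
      then show "0 \<le> E X" using \<theta> by (simp add: E_def)
    qed
  qed
  also have "PX.expectation E = \<theta> * ((l j)\<^sup>2 * shrinkage_moment \<nu> (\<phi> j) a N 2
          + (\<sigma> j)\<^sup>2 * (2 * shrinkage_moment \<nu> (\<phi> j) a N 1 - shrinkage_moment \<nu> (\<phi> j) a N 2))"
    unfolding E_def int_r(2)[symmetric] using int_r(1)[of 1] int_r(1)[of 2] by simp
  finally show "(\<integral>\<^sup>+D. ?f D \<partial>data_law \<nu> \<phi> l \<gamma> N) = ennreal (\<theta> * ((l j)\<^sup>2 * shrinkage_moment \<nu> (\<phi> j) a N 2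
          + (\<sigma> j)\<^sup>2 * (2 * shrinkage_moment \<nu> (\<phi> j) a N 1 - shrinkage_moment \<nu> (\<phi> j) a N 2)))" .
qed

lemma expected_error_eq:
  fixes \<nu> \<nu>' :: "'h::{real_inner, banach, second_countable_topology} measure" and \<sigma> l :: "nat \<Rightarrow> real"
  assumes \<phi>: "orthonormal_basis \<phi>" and \<nu>: "borel_prob \<nu>" and \<nu>': "borel_prob \<nu>'" "has_covariance \<nu>' \<Lambda>'"
    and \<gamma>: "\<gamma> > 0" and N: "N \<ge> 1" and \<sigma>: "\<And>j. (\<sigma> j)\<^sup>2 > 0"
  defines "a \<equiv> \<lambda>j. real N * (1 / \<gamma>\<^sup>2) * (\<sigma> j)\<^sup>2"
  shows "expected_error \<nu> \<nu>' \<phi> l \<sigma> \<gamma> N = (\<Sum>j. ennreal (inner (\<phi> j) (\<Lambda>' (\<phi> j)) * ((l j)\<^sup>2 * shrinkage_moment \<nu> (\<phi> j) (a j) N 2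
          + (\<sigma> j)\<^sup>2 * (2 * shrinkage_moment \<nu> (\<phi> j) (a j) N 1 - shrinkage_moment \<nu> (\<phi> j) (a j) N 2))))"
proof -
  have nonneg: "inner (\<phi> j) (\<Lambda>' (\<phi> j)) \<ge> 0" for j
    using \<nu>'(2) by (simp add: has_covariance_def)
  note data = data_expectation[OF \<nu> \<gamma> N nonneg, where l = l and \<phi> = \<phi> and \<sigma> = \<sigma>]
  have "expected_error \<nu> \<nu>' \<phi> l \<sigma> \<gamma> N = (\<integral>\<^sup>+D. (\<Sum>j. ennreal (inner (\<phi> j) (\<Lambda>' (\<phi> j)) *
      ((l j - post_mean \<phi> \<sigma> \<gamma> N D j)\<^sup>2 + post_var \<phi> \<sigma> \<gamma> N D j))) \<partial>data_law \<nu> \<phi> l \<gamma> N)"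
    unfolding expected_error_def
    by (intro nn_integral_cong posterior_expectation \<phi> \<nu>' post_var_pos \<sigma>)
  also have "\<dots> = (\<Sum>j. \<integral>\<^sup>+D. ennreal (inner (\<phi> j) (\<Lambda>' (\<phi> j)) *
      ((l j - post_mean \<phi> \<sigma> \<gamma> N D j)\<^sup>2 + post_var \<phi> \<sigma> \<gamma> N D j)) \<partial>data_law \<nu> \<phi> l \<gamma> N)"
    by (rule nn_integral_suminf) (rule data(1))
  finally show ?thesis unfolding data(2) a_def .
qed

section \<open>The rate\<close>

text \<open>
  Because \<open>0 \<le> r\<^sup>2 \<le> r\<close>, the factor \<open>2 E[r] - E[r\<^sup>2]\<close> of the prior variance lies between \<open>E[r]\<close> and \<open>2 E[r]\<close>;
  both moments are then replaced by their values at the true variance of the input coordinate.  Summability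
  makes the error finite, so \<open>enn2real\<close> does not lose it.
\<close>

lemma expected_error_bounds:
  fixes \<nu> \<nu>' :: "'h::{real_inner, banach, second_countable_topology} measure" and \<sigma> l :: "nat \<Rightarrow> real"
  assumes \<phi>: "orthonormal_basis \<phi>" and \<nu>: "borel_prob \<nu>" "has_covariance \<nu> \<Lambda>" "strictly_positive \<Lambda>" "KL_moment \<nu> \<Lambda>"
    and \<nu>': "borel_prob \<nu>'" "has_covariance \<nu>' \<Lambda>'"
    and \<gamma>: "\<gamma> > 0" and \<sigma>: "\<And>j. (\<sigma> j)\<^sup>2 > 0"
  defines "b \<equiv> \<lambda>j. 1 / \<gamma>\<^sup>2 * (\<sigma> j)\<^sup>2 * inner (\<phi> j) (\<Lambda> (\<phi> j))"
    and "A \<equiv> \<lambda>j. inner (\<phi> j) (\<Lambda>' (\<phi> j)) * (l j)\<^sup>2"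
    and "B \<equiv> \<lambda>j. inner (\<phi> j) (\<Lambda>' (\<phi> j)) * (\<sigma> j)\<^sup>2"
  assumes D: "\<And>j. b j \<le> D" and sm: "summable A" "summable B"
  obtains C where "\<And>N. N \<ge> 1 \<Longrightarrow>
      (\<Sum>j. A j / (1 + real N * b j)\<^sup>2) + (\<Sum>j. B j / (1 + real N * b j)) \<le> enn2real (expected_error \<nu> \<nu>' \<phi> l \<sigma> \<gamma> N)"
    "\<And>N. N \<ge> 1 \<Longrightarrow> enn2real (expected_error \<nu> \<nu>' \<phi> l \<sigma> \<gamma> N)
      \<le> C * ((\<Sum>j. A j / (1 + real N * b j)\<^sup>2) + (\<Sum>j. B j / (1 + real N * b j)))"
    "\<And>j. b j > 0" "\<And>j. A j \<ge> 0" "\<And>j. B j \<ge> 0"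
proof -
  define \<theta> where "\<theta> j = inner (\<phi> j) (\<Lambda> (\<phi> j))" for j
  define \<theta>' where "\<theta>' j = inner (\<phi> j) (\<Lambda>' (\<phi> j))" for j
  have "inner (\<phi> j) (\<phi> j) = 1" for j using \<phi> by (simp add: orthonormal_basis_def)
  then have "\<phi> j \<noteq> 0" for j by (metis inner_zero_left zero_neq_one)
  then have \<theta>: "\<theta> j > 0" for j using \<nu>(3) by (simp add: \<theta>_def strictly_positive_def)
  have \<theta>': "\<theta>' j \<ge> 0" for j using \<nu>'(2) by (simp add: \<theta>'_def has_covariance_def)
  have b: "b j > 0" for j unfolding b_def \<theta>_def[symmetric]
    using \<theta>[of j] \<sigma>[of j] \<gamma> by (intro mult_pos_pos divide_pos_pos) auto
  have A: "A j \<ge> 0" and B: "B j \<ge> 0" for j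
    using \<theta>'[of j] by (simp_all add: A_def B_def \<theta>'_def)
  have "D \<ge> 0" using D[of 0] b[of 0] by linarith
  from shrinkage_moment_bounds[OF \<nu>(1,2,4) this]
  obtain C where C: "C \<ge> 1" and bounds: "\<And>h a N k. inner h (\<Lambda> h) > 0 \<Longrightarrow> 0 \<le> a \<Longrightarrow> a * inner h (\<Lambda> h) \<le> D * real N \<Longrightarrow> N \<ge> 1 \<Longrightarrow> k \<le> 2 \<Longrightarrow>
       1 / (1 + a * inner h (\<Lambda> h)) ^ k \<le> shrinkage_moment \<nu> h a N k
       \<and> shrinkage_moment \<nu> h a N k \<le> C / (1 + a * inner h (\<Lambda> h)) ^ k"
    by blast
  define U where "U N j = A j / (1 + real N * b j)\<^sup>2" for N j
  define W where "W N j = B j / (1 + real N * b j)" for N j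
  have smU: "summable (U N)" for N
    unfolding U_def by (rule summable_filtered[OF A sm(1) b])
  have smW: "summable (W N)" for N
    unfolding W_def using summable_filtered[OF B sm(2) b, where N = N and k = 1] by simp
  have main: "suminf (U N) + suminf (W N) \<le> enn2real (expected_error \<nu> \<nu>' \<phi> l \<sigma> \<gamma> N)
      \<and> enn2real (expected_error \<nu> \<nu>' \<phi> l \<sigma> \<gamma> N) \<le> (2 * C) * (suminf (U N) + suminf (W N))" if N: "N \<ge> 1" for N
  proof -
    define a where "a j = real N * (1 / \<gamma>\<^sup>2) * (\<sigma> j)\<^sup>2" for j
    define \<rho> where "\<rho> j k = shrinkage_moment \<nu> (\<phi> j) (a j) N k" for j k
    define e where "e j = \<theta>' j * ((l j)\<^sup>2 * \<rho> j 2 + (\<sigma> j)\<^sup>2 * (2 * \<rho> j 1 - \<rho> j 2))" for j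
    have a0: "a j \<ge> 0" for j by (simp add: a_def)
    have ab: "a j * \<theta> j = real N * b j" for j by (simp add: a_def b_def \<theta>_def)
    have \<rho>: "1 / (1 + real N * b j) ^ k \<le> \<rho> j k" "\<rho> j k \<le> C / (1 + real N * b j) ^ k" if "k \<le> 2" for j k
    proof -
      have "a j * \<theta> j \<le> D * real N"
        unfolding ab using mult_left_mono[OF D[of j], of "real N"] by (simp add: mult.commute)
      from bounds[OF \<theta>[of j, unfolded \<theta>_def] a0[of j] this[unfolded \<theta>_def] N that]
      show "1 / (1 + real N * b j) ^ k \<le> \<rho> j k" "\<rho> j k \<le> C / (1 + real N * b j) ^ k"
        unfolding \<theta>_def[symmetric] ab \<rho>_def by auto
    qed
    have \<rho>21: "\<rho> j 2 \<le> \<rho> j 1" for j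
      unfolding \<rho>_def by (rule shrinkage_moment_2_le_1[OF \<nu>(1) a0])
    have \<rho>0: "0 \<le> \<rho> j 2" for j
      using order_trans[OF _ \<rho>(1)[of 2 j]] by simp
    have e_lower: "U N j + W N j \<le> e j" for j
    proof -
      have "U N j + W N j = \<theta>' j * ((l j)\<^sup>2 * (1 / (1 + real N * b j) ^ 2) + (\<sigma> j)\<^sup>2 * (1 / (1 + real N * b j) ^ 1))"
        by (simp add: U_def W_def A_def B_def \<theta>'_def distrib_left)
      also have "\<dots> \<le> e j" unfolding e_def
      proof (intro mult_left_mono add_mono \<theta>' zero_le_power2 \<rho>(1) order_refl)
        show "1 / (1 + real N * b j) ^ 1 \<le> 2 * \<rho> j 1 - \<rho> j 2"
          using \<rho>(1)[of 1 j] \<rho>21[of j] by linarith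
      qed
      finally show ?thesis .
    qed
    have e_upper: "e j \<le> (2 * C) * (U N j + W N j)" for j
    proof -
      have "e j \<le> \<theta>' j * ((l j)\<^sup>2 * (2 * C * (1 / (1 + real N * b j) ^ 2)) + (\<sigma> j)\<^sup>2 * (2 * C * (1 / (1 + real N * b j) ^ 1)))"
        unfolding e_def
      proof (intro mult_left_mono add_mono \<theta>' zero_le_power2)
        show "\<rho> j 2 \<le> 2 * C * (1 / (1 + real N * b j) ^ 2)"
          using \<rho>(2)[of 2 j] \<rho>0[of j] by simp
        show "2 * \<rho> j 1 - \<rho> j 2 \<le> 2 * C * (1 / (1 + real N * b j) ^ 1)"
          using \<rho>(2)[of 1 j] \<rho>0[of j] by simp
      qed
      also have "\<dots> = (2 * C) * (U N j + W N j)"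
        by (simp add: U_def W_def A_def B_def \<theta>'_def algebra_simps)
      finally show ?thesis .
    qed
    have UW0: "0 \<le> U N j + W N j" for j
      using A[of j] B[of j] b[of j] by (simp add: U_def W_def)
    then have e0: "0 \<le> e j" for j using e_lower[of j] by (rule order_trans)
    have smUW: "summable (\<lambda>j. U N j + W N j)" by (intro summable_add smU smW)
    have sme: "summable e"
      by (rule summable_comparison_test'[OF summable_mult[OF smUW, of "2 * C"]]) (use e_upper e0 in auto)
    have "expected_error \<nu> \<nu>' \<phi> l \<sigma> \<gamma> N = (\<Sum>j. ennreal (e j))"
      unfolding expected_error_eq[OF \<phi> \<nu>(1) \<nu>' \<gamma> N \<sigma>] e_def \<rho>_def \<theta>'_def a_def ..
    also have "\<dots> = ennreal (suminf e)" by (rule suminf_ennreal2[OF e0 sme])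
    finally have err: "enn2real (expected_error \<nu> \<nu>' \<phi> l \<sigma> \<gamma> N) = suminf e"
      using suminf_nonneg[OF sme e0] by simp
    have "suminf (U N) + suminf (W N) = (\<Sum>j. U N j + W N j)" by (rule suminf_add[OF smU smW])
    moreover have "(\<Sum>j. U N j + W N j) \<le> suminf e" by (intro suminf_le e_lower smUW sme)
    moreover have "suminf e \<le> (\<Sum>j. (2 * C) * (U N j + W N j))"
      by (intro suminf_le e_upper sme summable_mult smUW)
    moreover have "\<dots> = (2 * C) * (\<Sum>j. U N j + W N j)" by (rule suminf_mult[OF smUW])
    ultimately show ?thesis unfolding err by simp
  qed
  show ?thesis
    by (rule that[of "2 * C"]) (use main b A B in \<open>auto simp: U_def[abs_def] W_def[abs_def]\<close>)
qed

text \<open>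
  Eigenvalue decay, prior and covariances combine into the exponents \<open>- \<beta> - 1\<close>, \<open>- \<tau>\<close> and \<open>- 2 * q\<close> of the sequences
  \<open>A\<close>, \<open>B\<close> and \<open>b\<close>; the conditions on \<open>s\<close> and \<open>p\<close>, together with \<open>\<alpha> > 1/2\<close>, give
  \<open>\<beta> > 0\<close>, \<open>\<tau> > 1\<close> and \<open>q > 0\<close>.
\<close>

theorem theorem3p5:
  fixes \<phi> :: "nat \<Rightarrow> 'h :: {real_inner, banach, second_countable_topology}"
    and \<nu> \<nu>' :: "'h measure" and \<Lambda> \<Lambda>' :: "'h \<Rightarrow> 'h"
    and l \<sigma> :: "nat \<Rightarrow> real" and S :: "real \<Rightarrow> real"
    and \<gamma> s p \<alpha> \<alpha>' :: real
  assumes "orthonormal_basis \<phi>"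
    and "\<gamma> > 0"
    and "borel_prob \<nu>" and "centered \<nu>" and "integrable \<nu> (\<lambda>x. (norm x)\<^sup>2)"
    and "has_covariance \<nu> \<Lambda>" and "strictly_positive \<Lambda>" and "positive_trace_class \<phi> \<Lambda>"
    and "borel_prob \<nu>'" and "centered \<nu>'" and "has_covariance \<nu>' \<Lambda>'"
    and "\<And>j. (\<sigma> j)\<^sup>2 > 0"
    and "\<alpha> > 1/2" and "\<alpha>' \<ge> 0"
    and "min \<alpha> \<alpha>' + s > 0" and "min \<alpha> \<alpha>' + (p - 1/2) > 0"
    and "slowly_varying S"
    and "(\<lambda>j. \<bar>l j\<bar>) \<in> \<Theta>(\<lambda>j. real (Suc j) powr (-1/2 - s) * S (real (Suc j)))"
    and "(\<lambda>j. (\<sigma> j)\<^sup>2) \<in> \<Theta>(\<lambda>j. real (Suc j) powr (-2 * p))"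
    and "(\<lambda>j. inner (\<phi> j) (\<Lambda> (\<phi> j))) \<in> \<Theta>(\<lambda>j. real (Suc j) powr (-2 * \<alpha>))"
    and "(\<lambda>j. inner (\<phi> j) (\<Lambda>' (\<phi> j))) \<in> \<Theta>(\<lambda>j. real (Suc j) powr (-2 * \<alpha>'))"
    and "KL_moment \<nu> \<Lambda>" and "inverse_moment \<nu> \<Lambda> \<phi>"
  shows "(\<lambda>N. enn2real (expected_error \<nu> \<nu>' \<phi> l \<sigma> \<gamma> N))
           \<in> \<Theta>(\<lambda>N. rho \<alpha> \<alpha>' p N + real N powr (- ((\<alpha>' + s) / (\<alpha> + p))) * (S (of_int (J \<alpha> p N)))\<^sup>2)"
proof -
  define q \<tau> \<beta> where "q = \<alpha> + p" and "\<tau> = 2 * \<alpha>' + 2 * p" and "\<beta> = 2 * (\<alpha>' + s)"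
  have q: "q > 0" and \<tau>: "\<tau> > 1" and \<beta>: "\<beta> > 0"
    using assms(13-16) by (auto simp: q_def \<tau>_def \<beta>_def min_def split: if_splits)
  define b where "b j = 1 / \<gamma>\<^sup>2 * (\<sigma> j)\<^sup>2 * inner (\<phi> j) (\<Lambda> (\<phi> j))" for j
  define A where "A j = inner (\<phi> j) (\<Lambda>' (\<phi> j)) * (l j)\<^sup>2" for j
  define B where "B j = inner (\<phi> j) (\<Lambda>' (\<phi> j)) * (\<sigma> j)\<^sup>2" for j
  have "(\<lambda>j. 1 / \<gamma>\<^sup>2 * ((\<sigma> j)\<^sup>2 * inner (\<phi> j) (\<Lambda> (\<phi> j)))) \<in> \<Theta>(\<lambda>j. real (Suc j) powr (-2 * p) * real (Suc j) powr (-2 * \<alpha>))"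
    using landau_theta.mult[OF assms(19,20)] assms(2) by simp
  moreover have "real (Suc j) powr (-2 * p) * real (Suc j) powr (-2 * \<alpha>) = real (Suc j) powr (- 2 * q)" for j
    by (simp add: q_def powr_add[symmetric] algebra_simps)
  ultimately have b_theta: "b \<in> \<Theta>(\<lambda>j. real (Suc j) powr (- 2 * q))"
    by (simp add: b_def[abs_def] mult.assoc)
  have "(\<lambda>j. inner (\<phi> j) (\<Lambda>' (\<phi> j)) * (\<bar>l j\<bar> * \<bar>l j\<bar>)) \<in> \<Theta>(\<lambda>j. real (Suc j) powr (-2 * \<alpha>') *
      ((real (Suc j) powr (-1/2 - s) * S (real (Suc j))) * (real (Suc j) powr (-1/2 - s) * S (real (Suc j)))))"
    by (intro landau_theta.mult assms)
  moreover have "real (Suc j) powr (-2 * \<alpha>') * ((real (Suc j) powr (-1/2 - s) * S (real (Suc j))) * (real (Suc j) powr (-1/2 - s) * S (real (Suc j))))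
      = real (Suc j) powr (- \<beta> - 1) * (S (real (Suc j)))\<^sup>2" for j
  proof -
    have "real (Suc j) powr (-2 * \<alpha>') * (real (Suc j) powr (-1/2 - s) * real (Suc j) powr (-1/2 - s)) = real (Suc j) powr (- \<beta> - 1)"
      unfolding powr_add[symmetric] by (rule arg_cong[where f = "\<lambda>e. real (Suc j) powr e"]) (simp add: \<beta>_def)
    then show ?thesis by (simp add: power2_eq_square mult_ac)
  qed
  ultimately have A_theta: "A \<in> \<Theta>(\<lambda>j. real (Suc j) powr (- \<beta> - 1) * (S (real (Suc j)))\<^sup>2)"
    by (simp add: A_def[abs_def] power2_eq_square[of "l _"])
  have "B \<in> \<Theta>(\<lambda>j. real (Suc j) powr (-2 * \<alpha>') * real (Suc j) powr (-2 * p))"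
    unfolding B_def[abs_def] by (intro landau_theta.mult assms)
  moreover have "real (Suc j) powr (-2 * \<alpha>') * real (Suc j) powr (-2 * p) = real (Suc j) powr (- \<tau>)" for j
    by (simp add: \<tau>_def powr_add[symmetric])
  ultimately have B_theta: "B \<in> \<Theta>(\<lambda>j. real (Suc j) powr (- \<tau>))" by simp
  have "B \<in> O(\<lambda>j. real (Suc j) powr (- (\<tau> - 1) - 1))" using B_theta by auto
  then have smB: "summable B"
    by (rule summable_of_bigo_powr) (use \<tau> in simp)
  have "A \<in> O(\<lambda>j. real (Suc j) powr (- \<beta> - 1) * (S (real (Suc j)))\<^sup>2)" using A_theta by blast
  then have "A \<in> O(\<lambda>j. real (Suc j) powr (- \<beta> - 1 + \<beta> / 2))"
    using \<beta> by (intro regularly_varying_bigo[OF assms(17)]) auto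
  then have "A \<in> O(\<lambda>j. real (Suc j) powr (- (\<beta> / 2) - 1))" by (simp add: algebra_simps)
  then have smA: "summable A"
    by (rule summable_of_bigo_powr) (use \<beta> in simp)
  have "b \<in> O(\<lambda>j. real (Suc j) powr (- 2 * q))" using b_theta by blast
  then obtain D where D: "D > 0" "\<And>j. \<bar>b j\<bar> \<le> D * real (Suc j) powr (- 2 * q)"
    by (rule bigo_bound_everywhere) auto
  have bD: "b j \<le> D" for j
  proof -
    have "real (Suc j) powr (- 2 * q) \<le> real (Suc j) powr 0" using q by (intro powr_mono) auto
    then have "D * real (Suc j) powr (- 2 * q) \<le> D * 1" using D(1) by (intro mult_left_mono) auto
    then show ?thesis using D(2)[of j] by linarith
  qed
  define U where "U N = (\<Sum>j. A j / (1 + real N * b j)\<^sup>2)" for N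
  define W where "W N = (\<Sum>j. B j / (1 + real N * b j))" for N
  define err where "err N = enn2real (expected_error \<nu> \<nu>' \<phi> l \<sigma> \<gamma> N)" for N
  obtain C where lower: "\<And>N. N \<ge> 1 \<Longrightarrow> U N + W N \<le> err N" and upper: "\<And>N. N \<ge> 1 \<Longrightarrow> err N \<le> C * (U N + W N)"
    and b_pos: "\<And>j. b j > 0" and A0: "\<And>j. A j \<ge> 0" and B0: "\<And>j. B j \<ge> 0"
    using expected_error_bounds[where D = D and l = l and \<sigma> = \<sigma>, OF assms(1,3,6,7,22,9,11,2,12), folded b_def A_def B_def, OF bD smA smB]
    unfolding U_def W_def err_def by blast
  define R where "R N = real N powr (- \<beta> / (2 * q)) * (S (real (cutoff q N)))\<^sup>2" for N
  define V where "V N = spectral_rate q \<tau> N + R N" for N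
  have rate: "rho \<alpha> \<alpha>' p N + real N powr (- ((\<alpha>' + s) / (\<alpha> + p))) * (S (of_int (J \<alpha> p N)))\<^sup>2 = V N" for N
  proof -
    have "rho \<alpha> \<alpha>' p N = spectral_rate q \<tau> N"
    proof -
      have "- (1 - (\<alpha> + 1/2 - \<alpha>') / (\<alpha> + p)) = (1 - \<tau>) / (2 * q)"
        using q by (simp add: q_def \<tau>_def field_simps)
      moreover have "(\<alpha>' < \<alpha> + 1/2) = (\<tau> < 2 * q + 1)" "(\<alpha>' = \<alpha> + 1/2) = (\<tau> = 2 * q + 1)"
        by (auto simp: q_def \<tau>_def)
      ultimately show ?thesis by (simp only: rho_def spectral_rate_def)
    qed
    moreover have "- ((\<alpha>' + s) / (\<alpha> + p)) = - \<beta> / (2 * q)"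
      using q by (simp add: \<beta>_def q_def field_simps)
    moreover have "of_int (J \<alpha> p N) = real (cutoff q N)"
      by (simp add: J_def q_def)
    ultimately show ?thesis by (simp only: V_def R_def)
  qed
  have R0: "R N \<ge> 0" for N by (simp add: R_def)
  have UW0: "U N \<ge> 0" "W N \<ge> 0" for N
  proof -
    show "U N \<ge> 0" unfolding U_def
      using A0 by (intro suminf_nonneg summable_filtered[OF A0 smA b_pos]) simp
    show "W N \<ge> 0" unfolding W_def
      using summable_filtered[OF B0 smB b_pos, where N = N and k = 1] B0 b_pos by (intro suminf_nonneg) (simp_all add: less_imp_le)
  qed
  have V_ge: "\<forall>\<^sub>F N in at_top. 1 / real N + R N \<le> V N \<and> 0 \<le> spectral_rate q \<tau> N"
    using eventually_ge_at_top[of 3]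
  proof eventually_elim
    case (elim N)
    have "1 / real N \<le> spectral_rate q \<tau> N" by (rule spectral_rate_ge_inverse[OF q elim])
    moreover have "0 \<le> 1 / real N" by simp
    ultimately show ?case unfolding V_def by linarith
  qed
  have W: "W \<in> O(spectral_rate q \<tau>)" "spectral_rate q \<tau> \<in> O(W)"
    using spread_sum_bigo[OF q b_pos b_theta \<tau> B0] spread_sum_bigomega[OF q b_pos b_theta \<tau> B0 B_theta] B_theta
    by (auto simp: W_def[abs_def] bigomega_iff_bigo)
  have U: "U \<in> O(\<lambda>N. 1 / real N + R N)" "R \<in> O(U)"
    using bias_sum_bigo[OF q b_pos b_theta \<beta> assms(17) A0] bias_sum_bigomega[OF q b_pos b_theta \<beta> assms(17) A0 A_theta] A_theta
    by (auto simp: U_def[abs_def] R_def[abs_def] bigomega_iff_bigo)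
  have "spectral_rate q \<tau> \<in> O(V)"
    using V_ge R0 by (intro landau_o.big_mono) (auto elim!: eventually_mono simp: V_def)
  then have "W \<in> O(V)" using W(1) landau_o.big_trans by blast
  moreover have "(\<lambda>N. 1 / real N + R N) \<in> O(V)"
    using V_ge R0 by (intro landau_o.big_mono) (auto elim!: eventually_mono)
  then have "U \<in> O(V)" using U(1) landau_o.big_trans by blast
  ultimately have "(\<lambda>N. U N + W N) \<in> O(V)" by (intro sum_in_bigo)
  moreover have "err \<in> O(\<lambda>N. U N + W N)"
  proof (rule bigoI[where c = C])
    show "\<forall>\<^sub>F N in at_top. norm (err N) \<le> C * norm (U N + W N)"
      using eventually_ge_at_top[of 1]
      by eventually_elim (use upper UW0 in \<open>simp add: err_def\<close>)
  qed
  ultimately have "err \<in> O(V)" using landau_o.big_trans by blast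
  moreover have "U \<in> O(err)" "W \<in> O(err)"
  proof -
    have "\<forall>\<^sub>F N in at_top. norm (U N) \<le> 1 * norm (err N) \<and> norm (W N) \<le> 1 * norm (err N)"
      using eventually_ge_at_top[of 1]
    proof eventually_elim
      case (elim N)
      show ?case using lower[OF elim] UW0[of N] by simp
    qed
    then show "U \<in> O(err)" "W \<in> O(err)" by (auto intro!: bigoI[where c = 1] elim: eventually_mono)
  qed
  then have "V \<in> O(err)"
    unfolding V_def[abs_def] using W(2) U(2) by (intro sum_in_bigo) (blast intro: landau_o.big_trans)+
  ultimately show ?thesis
    unfolding rate err_def[abs_def, symmetric] by (simp add: bigtheta_def bigomega_iff_bigo err_def[abs_def])
qed

end
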